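(* Suppose that $\theta,\kappa,\sigma,\lambda,\nu$ are cardinals with $\omega \le \theta < \kappa < \sigma = \sigma^{<\sigma} < \lambda$, $\kappa = \mathrm{cf}\,\lambda < \lambda \le \nu$, that $\lambda$ is a strong limit cardinal, and that for every cardinal $\mu<\kappa$, $\mu^{<\theta}<\kappa$. Let $\mathbf{P}$ be the partial ordering for adding $\nu$ Cohen subsets of $\sigma$. Then in $V^{\mathbf P}$ (i.e., in every generic extension of the ground model $V$ by $\mathbf P$), $\lambda \rightarrow (\lambda,\ \theta+1)^2$.
   Context: The partial ordering for adding $\nu$ Cohen subsets of $\sigma$ consists of partial functions $p$ from $\nu\times\sigma$ to $\{0,1\}$ with $|\mathrm{dom}\,p|<\sigma$, ordered by extension. For a cardinal $\lambda$ and an ordinal $\zeta$, $\lambda \rightarrow (\lambda,\ \zeta)^2$ means that for every coloring $c:[\lambda]^2 \to \{\text{red},\text{green}\}$ there is either a set $X\subseteq\lambda$ of cardinality $\lambda$ with $c$ constantly red on $[X]^2$, or a set $Y\subseteq \lambda$ of order type $\zeta$ with $c$ constantly green on $[Y]^2$. All hypotheses on cardinals are evaluated in the ground model $V$. *)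

theory Defs
  imports Main
begin

unbundle cardinal_syntax

section \<open>Cardinal arithmetic in the ground model\<close>

text \<open>
  The ground model \<open>V\<close> is the ambient universe of HOL; its cardinals are the cardinal orders of
  the library (well-orders \<open>r\<close> with \<^term>\<open>Card_order r\<close>, compared by \<open><o\<close>, \<open>\<le>o\<close>, \<open>=o\<close>).
\<close>

text \<open>\<open>cless_exp r s\<close> is \<open>r\<^sup>< \<^sup>s\<close>, the number of functions from a proper initial segment of \<open>s\<close> to \<open>r\<close>.\<close>

definition cless_exp :: "'a rel \<Rightarrow> 'b rel \<Rightarrow> ('b \<rightharpoonup> 'a) rel" where
  "cless_exp r s = card_of {f. (\<exists>b\<in>Field s. dom f = underS s b) \<and> ran f \<subseteq> Field r}"

definition strong_limit :: "'a rel \<Rightarrow> bool" where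
  "strong_limit r \<longleftrightarrow> (\<forall>\<mu>::'a rel. Card_order \<mu> \<longrightarrow> \<mu> <o r \<longrightarrow> ctwo ^c \<mu> <o r)"

text \<open>\<open>is_cofinality k r\<close>: \<open>k = cf r\<close>, the least cardinality of an unbounded subset of \<open>r\<close>.\<close>

definition is_cofinality :: "'b rel \<Rightarrow> 'a rel \<Rightarrow> bool" where
  "is_cofinality k r \<longleftrightarrow> Card_order k \<and>
     (\<exists>A\<subseteq>Field r. cofinal A r \<and> card_of A =o k) \<and>
     (\<forall>A\<subseteq>Field r. cofinal A r \<longrightarrow> k \<le>o card_of A)"


section \<open>Names\<close>

text \<open>
  A name is a set of pairs (condition, name). A datatype must bound the size of such sets: here
  they are the ranges of partial functions on \<open>'i\<close>, so that \<open>('i, 'p) pname\<close> contains the names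
  that are hereditarily of size at most \<open>|'i|\<close>. Provided that \<open>'i\<close> is infinite and at least as
  large as the forcing notion \<open>P\<close>, these are names for exactly the elements of \<open>H(|'i|\<^sup>+)\<close> of the
  extension. Statements quantified over all large \<open>'i\<close> thus take all names into account.
\<close>

datatype ('i, 'p) pname = PName "'i \<Rightarrow> ('p \<times> ('i, 'p) pname) option"

primrec elems :: "('i, 'p) pname \<Rightarrow> ('p \<times> ('i, 'p) pname) set" where
  "elems (PName f) = ran f"

definition mk_name :: "('p \<times> ('i, 'p) pname) set \<Rightarrow> ('i, 'p) pname" where
  "mk_name S = PName (SOME f. ran f = S)"

lemma elems_mk_name:
  fixes S :: "('p \<times> ('i, 'p) pname) set"
  assumes "card_of S \<le>o card_of (UNIV :: 'i set)"
  shows "elems (mk_name S) = S"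
proof -
  obtain g where g: "inj_on g S" "g ` S \<subseteq> (UNIV :: 'i set)"
    using assms card_of_ordLeq[of S "UNIV :: 'i set"] by auto
  define f where "f i = (if i \<in> g ` S then Some (inv_into S g i) else None)" for i
  have "ran f = S"
  proof (intro equalityI subsetI)
    fix x assume "x \<in> ran f"
    then show "x \<in> S"
      by (auto simp: f_def ran_def inv_into_into split: if_splits)
  next
    fix x assume "x \<in> S"
    then have "f (g x) = Some x"
      using g by (simp add: f_def)
    then show "x \<in> ran f"
      by (rule ranI)
  qed
  then have "ran (SOME f :: 'i \<Rightarrow> _. ran f = S) = S"
    by (rule someI[where P = "\<lambda>f. ran f = S"])
  then show ?thesis
    by (simp add: mk_name_def)
qed

definition name_rel :: "(('i, 'p) pname \<times> ('i, 'p) pname) set" where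
  "name_rel = {(s, a). \<exists>c. (c, s) \<in> elems a}"

lemma wf_name_rel: "wf (name_rel :: (('i, 'p) pname \<times> ('i, 'p) pname) set)"
proof (rule wfUNIVI)
  fix Q :: "('i, 'p) pname \<Rightarrow> bool" and a
  assume *: "\<forall>a. (\<forall>s. (s, a) \<in> name_rel \<longrightarrow> Q s) \<longrightarrow> Q a"
  show "Q a"
  proof (induction a)
    case (PName f)
    have "Q s" if "(c, s) \<in> ran f" for c s
    proof -
      from that obtain i where "f i = Some (c, s)"
        by (auto simp: ran_def)
      then show ?thesis
        by (intro PName.IH[of "f i" "(c, s)"]) (auto intro: range_eqI[OF sym])
    qed
    then show ?case
      by (intro *[THEN spec, THEN mp]) (auto simp: name_rel_def)
  qed
qed

inductive_set P_names :: "'p set \<Rightarrow> ('i, 'p) pname set" for P where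
  "(\<And>c s. (c, s) \<in> elems a \<Longrightarrow> c \<in> P) \<Longrightarrow> (\<And>c s. (c, s) \<in> elems a \<Longrightarrow> s \<in> P_names P) \<Longrightarrow> a \<in> P_names P"


section \<open>The forcing relation\<close>

text \<open>
  Formulas of the language of set theory with names as parameters. Bound variables are represented
  by functions; the formulas below are polymorphic in \<open>'n\<close>, hence they are ordinary first-order
  formulas.
\<close>

datatype 'n fm =
    Mem 'n 'n
  | Eq 'n 'n
  | Neg "'n fm"
  | Conj "'n fm" "'n fm"
  | All "'n \<Rightarrow> 'n fm"

definition dense_below :: "'p set \<Rightarrow> ('p \<Rightarrow> 'p \<Rightarrow> bool) \<Rightarrow> 'p \<Rightarrow> ('p \<Rightarrow> bool) \<Rightarrow> bool" where
  "dense_below P le p D \<longleftrightarrow> (\<forall>r\<in>P. le r p \<longrightarrow> (\<exists>q\<in>P. le q r \<and> D q))"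

lemma dense_below_cong [fundef_cong]:
  "P = P' \<Longrightarrow> le = le' \<Longrightarrow> p = p' \<Longrightarrow> (\<And>q. q \<in> P' \<Longrightarrow> D q = D' q) \<Longrightarrow>
   dense_below P le p D = dense_below P' le' p' D'"
  by (auto simp: dense_below_def)

text \<open>
  The forcing relation for a preorder \<open>le\<close> on \<open>P\<close> (\<open>le q p\<close>: \<open>q\<close> is stronger than \<open>p\<close>), by
  Kunen's recursion: first for equality of names, then for all formulas.
\<close>

function forces_eq :: "'p set \<Rightarrow> ('p \<Rightarrow> 'p \<Rightarrow> bool) \<Rightarrow> 'p \<Rightarrow> ('i, 'p) pname \<Rightarrow> ('i, 'p) pname \<Rightarrow> bool" where
  "forces_eq P le p a b \<longleftrightarrow>
     (\<forall>(c, s)\<in>elems a. dense_below P le p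
        (\<lambda>q. le q c \<longrightarrow> (\<exists>(d, t)\<in>elems b. le q d \<and> forces_eq P le q s t))) \<and>
     (\<forall>(d, t)\<in>elems b. dense_below P le p
        (\<lambda>q. le q d \<longrightarrow> (\<exists>(c, s)\<in>elems a. le q c \<and> forces_eq P le q s t)))"
  by pat_completeness auto
termination
  by (relation "inv_image name_rel (\<lambda>(P, le, p, a, b). a)")
     (simp_all add: wf_name_rel, auto simp: name_rel_def)

declare forces_eq.simps [simp del]

primrec forces :: "'p set \<Rightarrow> ('p \<Rightarrow> 'p \<Rightarrow> bool) \<Rightarrow> 'p \<Rightarrow> ('i, 'p) pname fm \<Rightarrow> bool" where
  "forces P le p (Mem a b) \<longleftrightarrow>
     dense_below P le p (\<lambda>q. \<exists>(d, t)\<in>elems b. le q d \<and> forces_eq P le q t a)"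
| "forces P le p (Eq a b) \<longleftrightarrow> forces_eq P le p a b"
| "forces P le p (Neg \<phi>) \<longleftrightarrow> (\<forall>q\<in>P. le q p \<longrightarrow> \<not> forces P le q \<phi>)"
| "forces P le p (Conj \<phi> \<psi>) \<longleftrightarrow> forces P le p \<phi> \<and> forces P le p \<psi>"
| "forces P le p (All \<Phi>) \<longleftrightarrow> (\<forall>a\<in>P_names P. forces P le p (\<Phi> a))"

text \<open>
  No filter is generic over the whole universe. Hence truth in every generic extension is, as
  usual, expressed by the forcing relation: the formula is forced by every condition.
\<close>

definition forced :: "'p set \<Rightarrow> ('p \<Rightarrow> 'p \<Rightarrow> bool) \<Rightarrow> ('i, 'p) pname fm \<Rightarrow> bool" where
  "forced P le \<phi> \<longleftrightarrow> (\<forall>p\<in>P. forces P le p \<phi>)"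


section \<open>Canonical names for ordinals\<close>

text \<open>
  For a well-order \<open>r\<close>, \<open>elt_name one r a\<close> is the check name of the von Neumann ordinal of the
  initial segment of \<open>r\<close> below \<open>a\<close> (\<open>one\<close> is the largest condition), and \<open>ord_name one r\<close> that of the order type of \<open>r\<close>.
\<close>

definition elt_name :: "'p \<Rightarrow> 'a rel \<Rightarrow> 'a \<Rightarrow> ('i, 'p) pname" where
  "elt_name one r = wo_rel.worec r (\<lambda>f a. mk_name ((\<lambda>b. (one, f b)) ` underS r a))"

definition ord_name :: "'p \<Rightarrow> 'a rel \<Rightarrow> ('i, 'p) pname" where
  "ord_name one r = mk_name ((\<lambda>a. (one, elt_name one r a)) ` Field r)"

definition succ_name :: "'p \<Rightarrow> ('i, 'p) pname \<Rightarrow> ('i, 'p) pname" where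
  "succ_name one a = mk_name (insert (one, a) (elems a))"


section \<open>The partition relation as a formula of set theory\<close>

definition Disj :: "'n fm \<Rightarrow> 'n fm \<Rightarrow> 'n fm" where
  "Disj \<phi> \<psi> = Neg (Conj (Neg \<phi>) (Neg \<psi>))"

definition Impl :: "'n fm \<Rightarrow> 'n fm \<Rightarrow> 'n fm" where
  "Impl \<phi> \<psi> = Neg (Conj \<phi> (Neg \<psi>))"

definition Iff :: "'n fm \<Rightarrow> 'n fm \<Rightarrow> 'n fm" where
  "Iff \<phi> \<psi> = Conj (Impl \<phi> \<psi>) (Impl \<psi> \<phi>)"

definition Ex :: "('n \<Rightarrow> 'n fm) \<Rightarrow> 'n fm" where
  "Ex \<Phi> = Neg (All (\<lambda>x. Neg (\<Phi> x)))"

definition AllIn :: "'n \<Rightarrow> ('n \<Rightarrow> 'n fm) \<Rightarrow> 'n fm" where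
  "AllIn a \<Phi> = All (\<lambda>x. Impl (Mem x a) (\<Phi> x))"

definition ExIn :: "'n \<Rightarrow> ('n \<Rightarrow> 'n fm) \<Rightarrow> 'n fm" where
  "ExIn a \<Phi> = Ex (\<lambda>x. Conj (Mem x a) (\<Phi> x))"

definition Subset :: "'n \<Rightarrow> 'n \<Rightarrow> 'n fm" where
  "Subset a b = AllIn a (\<lambda>x. Mem x b)"

text \<open>\<open>z = {x, y}\<close> and \<open>z = (x, y)\<close> (Kuratowski)\<close>

definition UPair :: "'n \<Rightarrow> 'n \<Rightarrow> 'n \<Rightarrow> 'n fm" where
  "UPair z x y = All (\<lambda>w. Iff (Mem w z) (Disj (Eq w x) (Eq w y)))"

definition OPair :: "'n \<Rightarrow> 'n \<Rightarrow> 'n \<Rightarrow> 'n fm" where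
  "OPair z x y = Ex (\<lambda>u. Ex (\<lambda>v. Conj (UPair u x x) (Conj (UPair v x y) (UPair z u v))))"

text \<open>\<open>(x, y) \<in> f\<close>\<close>

definition Maps :: "'n \<Rightarrow> 'n \<Rightarrow> 'n \<Rightarrow> 'n fm" where
  "Maps f x y = Ex (\<lambda>z. Conj (OPair z x y) (Mem z f))"

text \<open>\<open>f : a \<rightarrow> b\<close>\<close>

definition Fun :: "'n \<Rightarrow> 'n \<Rightarrow> 'n \<Rightarrow> 'n fm" where
  "Fun f a b = Conj
     (AllIn f (\<lambda>z. ExIn a (\<lambda>x. ExIn b (\<lambda>y. OPair z x y))))
     (AllIn a (\<lambda>x. ExIn b (\<lambda>y. Conj (Maps f x y) (All (\<lambda>y'. Impl (Maps f x y') (Eq y' y))))))"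

definition Bij :: "'n \<Rightarrow> 'n \<Rightarrow> 'n \<Rightarrow> 'n fm" where
  "Bij f a b = Conj (Fun f a b)
     (AllIn b (\<lambda>y. ExIn a (\<lambda>x. Conj (Maps f x y) (All (\<lambda>x'. Impl (Maps f x' y) (Eq x' x))))))"

definition Equinumerous :: "'n \<Rightarrow> 'n \<Rightarrow> 'n fm" where
  "Equinumerous a b = Ex (\<lambda>f. Bij f a b)"

text \<open>The set of ordinals \<open>y\<close>, ordered by \<open>\<in>\<close>, has order type \<open>\<zeta>\<close>.\<close>

definition OrderType :: "'n \<Rightarrow> 'n \<Rightarrow> 'n fm" where
  "OrderType y \<zeta> = Ex (\<lambda>f. Conj (Bij f \<zeta> y)
     (AllIn \<zeta> (\<lambda>u. AllIn \<zeta> (\<lambda>v. AllIn y (\<lambda>u'. AllIn y (\<lambda>v'.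
        Impl (Conj (Maps f u u') (Maps f v v')) (Iff (Mem u v) (Mem u' v'))))))))"

text \<open>\<open>d = [a]\<^sup>2\<close>\<close>

definition Pairs :: "'n \<Rightarrow> 'n \<Rightarrow> 'n fm" where
  "Pairs d a = All (\<lambda>s. Iff (Mem s d)
     (ExIn a (\<lambda>x. ExIn a (\<lambda>y. Conj (Neg (Eq x y)) (UPair s x y)))))"

text \<open>\<open>c\<close> is constantly \<open>i\<close> on \<open>[x]\<^sup>2\<close>.\<close>

definition Homogeneous :: "'n \<Rightarrow> 'n \<Rightarrow> 'n \<Rightarrow> 'n fm" where
  "Homogeneous c x i = All (\<lambda>d. Impl (Pairs d x) (AllIn d (\<lambda>s. Maps c s i)))"

text \<open>\<open>l \<rightarrow> (l, \<zeta>)\<^sup>2\<close>\<close>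

definition Arrow :: "'n \<Rightarrow> 'n \<Rightarrow> 'n fm" where
  "Arrow l \<zeta> = All (\<lambda>red. All (\<lambda>green. All (\<lambda>colours. All (\<lambda>d. All (\<lambda>c.
     Impl (Conj (Neg (Eq red green)) (Conj (UPair colours red green) (Conj (Pairs d l) (Fun c d colours))))
       (Disj
         (Ex (\<lambda>x. Conj (Subset x l) (Conj (Equinumerous x l) (Homogeneous c x red))))
         (Ex (\<lambda>y. Conj (Subset y l) (Conj (OrderType y \<zeta>) (Homogeneous c y green))))))))))"


section \<open>Adding Cohen subsets\<close>

definition Cohen :: "'e rel \<Rightarrow> 'c rel \<Rightarrow> ('e \<times> 'c \<rightharpoonup> bool) set" where
  "Cohen \<nu> \<sigma> = {p. dom p \<subseteq> Field \<nu> \<times> Field \<sigma> \<and> card_of (dom p) <o \<sigma>}"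

definition Cohen_le :: "('e \<times> 'c \<rightharpoonup> bool) \<Rightarrow> ('e \<times> 'c \<rightharpoonup> bool) \<Rightarrow> bool" where
  "Cohen_le q p \<longleftrightarrow> p \<subseteq>\<^sub>m q"

end

theory Submission imports Defs begin

text \<open>
  Let \<open>g x y p\<close> mean that the condition \<open>p\<close> forces the pair \<open>{x, y}\<close> to be green, and suppose that
  no condition below \<open>q\<close> forces a green set of type \<open>\<theta> + 1\<close>. Split \<open>\<lambda>\<close> into \<open>\<kappa>\<close> consecutive blocks,
  each larger than the power set of the initial segment \<open>T i\<close> below it. In each block the
  partition tree argument yields many points \<open>x\<close> with conditions \<open>p x\<close> below \<open>q\<close> such that no
  common extension of \<open>p x\<close> and \<open>p y\<close> makes \<open>{x, y}\<close> green. Thinning out the blocks twice, we may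
  assume that the conditions deciding the colours of pairs from two blocks depend on the two points
  only through coordinates private to them. A single condition \<open>z\<close>, with virtual coordinates for
  generic points of the blocks, then decides for each pair of blocks whether generic points of
  them can become green. This colours the pairs of blocks, and the assumption on \<open>\<mu>\<close> to the power
  less than \<open>\<theta>\<close> gives \<open>\<kappa> \<rightarrow> (\<kappa>, \<theta> + 1)\<^sup>2\<close>. On \<open>\<theta> + 1\<close> green blocks one generic point of each can be
  amalgamated to a green set below \<open>q\<close>, a contradiction. On \<open>\<kappa>\<close> red blocks, adjoin to the
  conditions of the generic points what \<open>z\<close> says about their private coordinates; by genericity
  \<open>\<lambda>\<close> of these conditions belong to the generic filter, and their points form a red set.
\<close>

section \<open>Forcing\<close>

text \<open>Two uniformizations are forced by the sizes. The data of a point \<open>x\<close> of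
  block \<open>i\<close> towards the at most |T i| smaller points can be made independent of
  \<open>x\<close>, because the block has more than 2^|T i| points. Towards larger points this fails
  for the raw data, as there are too many of them; but after the first pass a larger point counts
  only through its block, which leaves at most |T i| data again. The hypothesis on powers below
  \<theta> serves \<kappa> itself; inside a block the corresponding bound for the successor of 2^|T
  i| is automatic. That the red set has cardinality \<lambda> in the extension is not derived from
  preservation of cardinals: the conditions of the red points are grouped into \<lambda> fibres,
  each predense below one condition, and the least admissible point of every fibre gives a bijection
  with \<lambda>.\<close>

lemma pname_induct [case_names step]:
  fixes a :: "('i, 'p) pname"
  assumes "\<And>a::('i, 'p) pname. (\<And>c s. (c, s) \<in> elems a \<Longrightarrow> Q s) \<Longrightarrow> Q a"
  shows "Q a"
  using wf_name_rel by (induction a rule: wf_induct_rule) (auto simp: name_rel_def intro: assms)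

lemma P_names_elems:
  assumes "a \<in> P_names P" "(c, s) \<in> elems a"
  shows "c \<in> P" "s \<in> P_names P"
  using assms by (auto elim: P_names.cases)

locale forcing_notion =
  fixes P :: "'p set" and le :: "'p \<Rightarrow> 'p \<Rightarrow> bool" and one :: 'p
  assumes le_refl [simp]: "le p p"
    and le_trans: "le r q \<Longrightarrow> le q p \<Longrightarrow> le r p"
    and one_P [simp]: "one \<in> P"
    and le_one [simp]: "p \<in> P \<Longrightarrow> le p one"
begin

abbreviation "dn \<equiv> dense_below P le"
abbreviation "feq \<equiv> forces_eq P le"
abbreviation "fc \<equiv> forces P le"

lemma dn_mono: "dn p D \<Longrightarrow> le q p \<Longrightarrow> (\<And>r. r \<in> P \<Longrightarrow> le r q \<Longrightarrow> D r \<Longrightarrow> D' r) \<Longrightarrow> dn q D'"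
  unfolding dense_below_def by (meson le_trans)

lemma dn_le: "dn p D \<Longrightarrow> le q p \<Longrightarrow> dn q D"
  by (rule dn_mono)

lemma dn_dn: "dn p (\<lambda>q. dn q D) \<Longrightarrow> dn p D"
  unfolding dense_below_def by (meson le_refl le_trans)

lemma dnI: "(\<And>q. q \<in> P \<Longrightarrow> le q p \<Longrightarrow> \<exists>r\<in>P. le r q \<and> D r) \<Longrightarrow> dn p D"
  unfolding dense_below_def by blast

lemma dnE:
  assumes "dn p D" "q \<in> P" "le q p"
  obtains r where "r \<in> P" "le r q" "D r"
  using assms unfolding dense_below_def by blast

lemma dn_all: "(\<And>q. q \<in> P \<Longrightarrow> le q p \<Longrightarrow> D q) \<Longrightarrow> dn p D"
  unfolding dense_below_def by force

lemma feq_le: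
  assumes "feq p a b" "le q p"
  shows "feq q a b"
  using assms by (subst (asm) forces_eq.simps, subst forces_eq.simps) (blast intro: dn_le)

lemma feq_dn:
  assumes "dn p (\<lambda>q. feq q a b)"
  shows "feq p a b"
proof -
  define D1 where "D1 c s q \<longleftrightarrow> (le q c \<longrightarrow> (\<exists>(d, t)\<in>elems b. le q d \<and> feq q s t))" for c s q
  define D2 where "D2 d t q \<longleftrightarrow> (le q d \<longrightarrow> (\<exists>(c, s)\<in>elems a. le q c \<and> feq q s t))" for d t q
  have *: "feq q a b \<longleftrightarrow> (\<forall>(c, s)\<in>elems a. dn q (D1 c s)) \<and> (\<forall>(d, t)\<in>elems b. dn q (D2 d t))" for q
    unfolding D1_def D2_def by (rule forces_eq.simps)
  have "dn p (D1 c s)" if "(c, s) \<in> elems a" for c s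
    using that by (intro dn_dn[OF dn_mono[OF assms le_refl]]) (auto simp: *)
  moreover have "dn p (D2 c s)" if "(c, s) \<in> elems b" for c s
    using that by (intro dn_dn[OF dn_mono[OF assms le_refl]]) (auto simp: *)
  ultimately show ?thesis
    by (auto simp: *)
qed

lemma feq_refl [simp]: "feq p a a"
proof (induction a arbitrary: p rule: pname_induct)
  case (step a)
  show ?case
    by (subst forces_eq.simps) (fastforce intro!: dn_all intro: step)
qed

lemma feq_sym: "feq p a b \<Longrightarrow> feq p b a"
proof (induction a arbitrary: p b rule: pname_induct)
  case (step a)
  note eq = step.prems[unfolded forces_eq.simps[of P le p a b]]
  have 1: "dn p (\<lambda>q. le q c \<longrightarrow> (\<exists>(d, t)\<in>elems b. le q d \<and> feq q t s))" if "(c, s) \<in> elems a" for c s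
  proof -
    have "dn p (\<lambda>q. le q c \<longrightarrow> (\<exists>(d, t)\<in>elems b. le q d \<and> feq q s t))"
      using eq that by blast
    then show ?thesis
      by (rule dn_mono) (use that step.IH in fastforce)+
  qed
  have 2: "dn p (\<lambda>q. le q d \<longrightarrow> (\<exists>(c, s)\<in>elems a. le q c \<and> feq q t s))" if "(d, t) \<in> elems b" for d t
  proof -
    have "dn p (\<lambda>q. le q d \<longrightarrow> (\<exists>(c, s)\<in>elems a. le q c \<and> feq q s t))"
      using eq that by blast
    then show ?thesis
      by (rule dn_mono) (use that step.IH in fastforce)+
  qed
  show ?case
    by (subst forces_eq.simps) (use 1 2 in blast)
qed

lemma feq_trans: "feq p a b \<Longrightarrow> feq p b e \<Longrightarrow> feq p a e"
proof (induction a arbitrary: p b e rule: pname_induct)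
  case (step a)
  note eq1 = step.prems(1)[unfolded forces_eq.simps[of P le p a b]]
  note eq2 = step.prems(2)[unfolded forces_eq.simps[of P le p b e]]
  have 1: "dn p (\<lambda>q. le q c \<longrightarrow> (\<exists>(d, t)\<in>elems e. le q d \<and> feq q s t))" if "(c, s) \<in> elems a" for c s
  proof (rule dnI)
    fix q assume q: "q \<in> P" "le q p"
    have "dn p (\<lambda>q. le q c \<longrightarrow> (\<exists>(d, t)\<in>elems b. le q d \<and> feq q s t))"
      using eq1 that by blast
    from dnE[OF this q] obtain r where r: "r \<in> P" "le r q" "le r c \<longrightarrow> (\<exists>(d, t)\<in>elems b. le r d \<and> feq r s t)"
      by blast
    show "\<exists>r\<in>P. le r q \<and> (le r c \<longrightarrow> (\<exists>(d, t)\<in>elems e. le r d \<and> feq r s t))"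
    proof (cases "le r c")
      case True
      then obtain d t where dt: "(d, t) \<in> elems b" "le r d" "feq r s t"
        using r by blast
      then have "dn p (\<lambda>q. le q d \<longrightarrow> (\<exists>(d, u)\<in>elems e. le q d \<and> feq q t u))"
        using eq2 by blast
      from dnE[OF this r(1) le_trans[OF r(2) q(2)]] obtain r' where
        r': "r' \<in> P" "le r' r" "le r' d \<longrightarrow> (\<exists>(d, u)\<in>elems e. le r' d \<and> feq r' t u)"
        by blast
      then have "\<exists>(d, u)\<in>elems e. le r' d \<and> feq r' s u"
        using step.IH[OF that feq_le[OF dt(3)]] dt(2) le_trans[of r' r d] by blast
      then show ?thesis
        using r' r le_trans by blast
    qed (use r in blast)
  qed
  have 2: "dn p (\<lambda>q. le q d \<longrightarrow> (\<exists>(c, s)\<in>elems a. le q c \<and> feq q s t))" if "(d, t) \<in> elems e" for d t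
  proof (rule dnI)
    fix q assume q: "q \<in> P" "le q p"
    have "dn p (\<lambda>q. le q d \<longrightarrow> (\<exists>(c, s)\<in>elems b. le q c \<and> feq q s t))"
      using eq2 that by blast
    from dnE[OF this q] obtain r where r: "r \<in> P" "le r q" "le r d \<longrightarrow> (\<exists>(c, s)\<in>elems b. le r c \<and> feq r s t)"
      by blast
    show "\<exists>r\<in>P. le r q \<and> (le r d \<longrightarrow> (\<exists>(c, s)\<in>elems a. le r c \<and> feq r s t))"
    proof (cases "le r d")
      case True
      then obtain c s where dt: "(c, s) \<in> elems b" "le r c" "feq r s t"
        using r by blast
      then have "dn p (\<lambda>q. le q c \<longrightarrow> (\<exists>(d, u)\<in>elems a. le q d \<and> feq q u s))"
        using eq1 by blast
      from dnE[OF this r(1) le_trans[OF r(2) q(2)]] obtain r' where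
        r': "r' \<in> P" "le r' r" "le r' c \<longrightarrow> (\<exists>(d, u)\<in>elems a. le r' d \<and> feq r' u s)"
        by blast
      then have "\<exists>(d, u)\<in>elems a. le r' d \<and> feq r' u t"
        using step.IH[OF _ _ feq_le[OF dt(3)]] dt(2) le_trans[of r' r c] by blast
      then show ?thesis
        using r' r le_trans by blast
    qed (use r in blast)
  qed
  show ?case
    by (subst forces_eq.simps) (use 1 2 in blast)
qed

lemma fc_le: "fc p \<phi> \<Longrightarrow> le q p \<Longrightarrow> fc q \<phi>"
proof (induction \<phi> arbitrary: p q)
  case (Neg \<phi>)
  then show ?case
    by (simp, meson le_trans)
next
  case (All \<Phi>)
  then show ?case
    by (metis forces.simps(5) rangeI)
qed (auto intro: dn_le feq_le)

lemma fc_dn: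
  fixes \<phi> :: "('i, 'p) pname fm"
  shows "dn p (\<lambda>q. fc q \<phi>) \<Longrightarrow> fc p \<phi>"
proof (induction \<phi> arbitrary: p)
  case (Mem a b)
  then show ?case unfolding forces.simps by (rule dn_dn)
next
  case (Eq a b)
  then show ?case unfolding forces.simps by (rule feq_dn)
next
  case (Neg \<phi>)
  show ?case
    unfolding forces.simps
  proof (intro ballI impI notI)
    fix q assume q: "q \<in> P" "le q p" "fc q \<phi>"
    then obtain r where "r \<in> P" "le r q" "fc r (Neg \<phi>)"
      using dnE[OF Neg.prems q(1,2)] by blast
    then show False
      using fc_le[OF q(3)] by auto
  qed
next
  case (Conj \<phi> \<psi>)
  show ?case
    using Conj.IH dn_mono[OF Conj.prems le_refl] by simp
next
  case (All \<Phi>)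
  show ?case
    unfolding forces.simps
  proof
    fix a :: "('i, 'p) pname"
    assume "a \<in> P_names P"
    then show "fc p (\<Phi> a)"
      by (intro All.IH[OF rangeI dn_mono[OF All.prems le_refl]]) simp
  qed
qed

text \<open>Disjunctions and existential statements are decided only by passing to stronger
  conditions. This rule allows such a passage inside the proof of any forced formula and takes the
  place of an argument with a generic filter.\<close>

lemma fcI: "(\<And>q. q \<in> P \<Longrightarrow> le q p \<Longrightarrow> \<exists>r\<in>P. le r q \<and> fc r \<phi>) \<Longrightarrow> fc p \<phi>"
  by (rule fc_dn) (rule dnI)

lemma fc_Impl: "fc p (Impl \<phi> \<psi>) \<longleftrightarrow> (\<forall>q\<in>P. le q p \<longrightarrow> fc q \<phi> \<longrightarrow> fc q \<psi>)"
proof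
  assume *: "fc p (Impl \<phi> \<psi>)"
  show "\<forall>q\<in>P. le q p \<longrightarrow> fc q \<phi> \<longrightarrow> fc q \<psi>"
  proof (intro ballI impI)
    fix q assume q: "q \<in> P" "le q p" "fc q \<phi>"
    show "fc q \<psi>"
    proof (rule fcI)
      fix r assume r: "r \<in> P" "le r q"
      then have "fc r \<phi>" "le r p"
        using q fc_le le_trans by blast+
      then show "\<exists>r'\<in>P. le r' r \<and> fc r' \<psi>"
        using * r by (auto simp: Impl_def)
    qed
  qed
next
  assume *: "\<forall>q\<in>P. le q p \<longrightarrow> fc q \<phi> \<longrightarrow> fc q \<psi>"
  show "fc p (Impl \<phi> \<psi>)"
    unfolding Impl_def forces.simps using * le_refl by blast
qed

lemma fc_Disj: "fc p (Disj \<phi> \<psi>) \<longleftrightarrow> dn p (\<lambda>q. fc q \<phi> \<or> fc q \<psi>)"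
proof
  assume *: "fc p (Disj \<phi> \<psi>)"
  show "dn p (\<lambda>q. fc q \<phi> \<or> fc q \<psi>)"
  proof (rule dnI)
    fix q assume "q \<in> P" "le q p"
    then have "\<not> (\<forall>r\<in>P. le r q \<longrightarrow> \<not> fc r \<phi>) \<or> \<not> (\<forall>r\<in>P. le r q \<longrightarrow> \<not> fc r \<psi>)"
      using * by (auto simp: Disj_def)
    then show "\<exists>r\<in>P. le r q \<and> (fc r \<phi> \<or> fc r \<psi>)"
      by blast
  qed
next
  assume *: "dn p (\<lambda>q. fc q \<phi> \<or> fc q \<psi>)"
  show "fc p (Disj \<phi> \<psi>)"
    unfolding Disj_def forces.simps using * le_refl by (auto simp: dense_below_def)
qed

lemma fc_Ex: "fc p (Ex \<Phi>) \<longleftrightarrow> dn p (\<lambda>q. \<exists>a\<in>P_names P. fc q (\<Phi> a))"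
proof
  assume *: "fc p (Ex \<Phi>)"
  show "dn p (\<lambda>q. \<exists>a\<in>P_names P. fc q (\<Phi> a))"
  proof (rule dnI)
    fix q assume "q \<in> P" "le q p"
    then show "\<exists>r\<in>P. le r q \<and> (\<exists>a\<in>P_names P. fc r (\<Phi> a))"
      using * by (fastforce simp: Ex_def)
  qed
next
  assume *: "dn p (\<lambda>q. \<exists>a\<in>P_names P. fc q (\<Phi> a))"
  show "fc p (Ex \<Phi>)"
    unfolding Ex_def forces.simps
  proof (intro ballI impI notI)
    fix q assume "q \<in> P" "le q p"
      and no: "\<forall>a\<in>P_names P. \<forall>r\<in>P. le r q \<longrightarrow> \<not> fc r (\<Phi> a)"
    from dnE[OF * this(1,2)] show False
      using no by blast
  qed
qed

lemma fc_Iff: "fc p (Iff \<phi> \<psi>) \<longleftrightarrow> (\<forall>q\<in>P. le q p \<longrightarrow> (fc q \<phi> \<longleftrightarrow> fc q \<psi>))"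
  by (simp add: Iff_def fc_Impl) blast

lemma fc_AllIn:
  "fc p (AllIn a \<Phi>) \<longleftrightarrow> (\<forall>x\<in>P_names P. \<forall>q\<in>P. le q p \<longrightarrow> fc q (Mem x a) \<longrightarrow> fc q (\<Phi> x))"
  by (simp add: AllIn_def fc_Impl del: forces.simps(1))

lemma fc_ExIn:
  "fc p (ExIn a \<Phi>) \<longleftrightarrow> dn p (\<lambda>q. \<exists>x\<in>P_names P. fc q (Mem x a) \<and> fc q (\<Phi> x))"
  by (simp add: ExIn_def fc_Ex del: forces.simps(1))

declare forces.simps(1) [simp del]

lemma fc_Mem_elem: "(c, s) \<in> elems a \<Longrightarrow> le p c \<Longrightarrow> fc p (Mem s a)"
  unfolding forces.simps(1) by (intro dn_all) (auto intro!: bexI[of _ "(c, s)"] intro: le_trans)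

lemma fc_MemE:
  assumes "fc p (Mem x a)" "q \<in> P" "le q p"
  obtains r c s where "r \<in> P" "le r q" "(c, s) \<in> elems a" "le r c" "feq r s x"
  using assms unfolding forces.simps(1) dense_below_def by blast

lemma fc_Mem_cong1:
  assumes "feq p x y" "fc p (Mem x a)"
  shows "fc p (Mem y a)"
  unfolding forces.simps(1)
proof (rule dn_mono[OF assms(2)[unfolded forces.simps(1)] le_refl])
  fix r assume "le r p" "\<exists>(d, t)\<in>elems a. le r d \<and> feq r t x"
  then show "\<exists>(d, t)\<in>elems a. le r d \<and> feq r t y"
    using feq_trans[OF _ feq_le[OF assms(1), of r]] by fast
qed

lemma fc_Mem_cong2:
  assumes "feq p a b" "fc p (Mem x a)"
  shows "fc p (Mem x b)"
proof (rule fcI)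
  fix q assume q: "q \<in> P" "le q p"
  obtain r c s where r: "r \<in> P" "le r q" "(c, s) \<in> elems a" "le r c" "feq r s x"
    using fc_MemE[OF assms(2) q] .
  have "feq r a b"
    using assms(1) r q feq_le le_trans by blast
  then have "dn r (\<lambda>q. le q c \<longrightarrow> (\<exists>(d, t)\<in>elems b. le q d \<and> feq q s t))"
    using r(3) by (subst (asm) forces_eq.simps) blast
  from dnE[OF this r(1) le_refl] obtain r' where
    r': "r' \<in> P" "le r' r" "le r' c \<longrightarrow> (\<exists>(d, t)\<in>elems b. le r' d \<and> feq r' s t)"
    by blast
  then obtain d t where dt: "(d, t) \<in> elems b" "le r' d" "feq r' s t"
    using r(4) le_trans by blast
  have "feq r' t x"
    using dt(3) feq_le[OF r(5) r'(2)] feq_sym feq_trans by blast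
  then show "\<exists>r\<in>P. le r q \<and> fc r (Mem x b)"
    using r' r dt fc_Mem_elem fc_Mem_cong1 le_trans by blast
qed

text \<open>Extensionality. Testing with names in \<open>P_names P\<close> suffices, because the
  only test objects used are the components of \<open>a\<close> and \<open>b\<close>.\<close>

lemma feqI:
  assumes "a \<in> P_names P" "b \<in> P_names P"
    and "\<And>x q. x \<in> P_names P \<Longrightarrow> q \<in> P \<Longrightarrow> le q p \<Longrightarrow> fc q (Mem x a) \<longleftrightarrow> fc q (Mem x b)"
  shows "feq p a b"
proof -
  have 1: "dn p (\<lambda>q. le q c \<longrightarrow> (\<exists>(d, t)\<in>elems b. le q d \<and> feq q s t))" if "(c, s) \<in> elems a" for c s
  proof (rule dnI)
    fix q assume q: "q \<in> P" "le q p"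
    show "\<exists>r\<in>P. le r q \<and> (le r c \<longrightarrow> (\<exists>(d, t)\<in>elems b. le r d \<and> feq r s t))"
    proof (cases "le q c")
      case True
      then have "fc q (Mem s b)"
        using fc_Mem_elem[OF that] assms(3)[of s q] P_names_elems[OF assms(1) that] q by blast
      from fc_MemE[OF this q(1) le_refl] show ?thesis
        using feq_sym by (metis (no_types, lifting) case_prodI)
    qed (use q le_refl in blast)
  qed
  have 2: "dn p (\<lambda>q. le q d \<longrightarrow> (\<exists>(c, s)\<in>elems a. le q c \<and> feq q s t))" if "(d, t) \<in> elems b" for d t
  proof (rule dnI)
    fix q assume q: "q \<in> P" "le q p"
    show "\<exists>r\<in>P. le r q \<and> (le r d \<longrightarrow> (\<exists>(c, s)\<in>elems a. le r c \<and> feq r s t))"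
    proof (cases "le q d")
      case True
      then have "fc q (Mem t a)"
        using fc_Mem_elem[OF that] assms(3)[of t q] P_names_elems[OF assms(2) that] q by blast
      from fc_MemE[OF this q(1) le_refl] show ?thesis
        by (metis (no_types, lifting) case_prodI)
    qed (use q le_refl in blast)
  qed
  show ?thesis
    by (subst forces_eq.simps) (use 1 2 in blast)
qed

text \<open>The body of \<open>All\<close> is an arbitrary function on names and need not respect
  forced equality, so substitution is not a theorem about \<open>fm\<close>; it is checked for the
  formulas that occur.\<close>

definition resp :: "(('i, 'p) pname \<Rightarrow> ('i, 'p) pname fm) \<Rightarrow> bool" where
  "resp \<Phi> \<longleftrightarrow> (\<forall>p\<in>P. \<forall>a b. feq p a b \<longrightarrow> fc p (\<Phi> a) \<longrightarrow> fc p (\<Phi> b))"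

lemma respD: "resp \<Phi> \<Longrightarrow> p \<in> P \<Longrightarrow> feq p a b \<Longrightarrow> fc p (\<Phi> a) \<Longrightarrow> fc p (\<Phi> b)"
  unfolding resp_def by blast

lemma resp_const: "resp (\<lambda>_. \<phi>)"
  by (simp add: resp_def)

lemma resp_atoms:
  "resp (\<lambda>x. Mem x a)" "resp (\<lambda>x. Mem a x)" "resp (\<lambda>x. Eq x a)" "resp (\<lambda>x. Eq a x)"
  by (auto simp: resp_def intro: fc_Mem_cong1 fc_Mem_cong2 feq_trans feq_sym)

lemma resp_Neg: "resp \<Phi> \<Longrightarrow> resp (\<lambda>x. Neg (\<Phi> x))"
  by (auto simp: resp_def) (meson feq_le feq_sym)

lemma resp_Conj: "resp \<Phi> \<Longrightarrow> resp \<Psi> \<Longrightarrow> resp (\<lambda>x. Conj (\<Phi> x) (\<Psi> x))"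
  by (auto simp: resp_def)

lemma resp_All: "(\<And>y. resp (\<lambda>x. \<Phi> x y)) \<Longrightarrow> resp (\<lambda>x. All (\<Phi> x))"
  by (auto simp: resp_def)

lemmas resp_intros = resp_const resp_atoms resp_Neg resp_Conj resp_All

lemma resp_UPair:
  "resp (\<lambda>x. UPair x a b)" "resp (\<lambda>x. UPair a x b)" "resp (\<lambda>x. UPair a b x)" "resp (\<lambda>x. UPair a x x)"
  unfolding UPair_def Iff_def Impl_def Disj_def by (intro resp_intros)+

lemma resp_OPair: "resp (\<lambda>x. OPair x a b)" "resp (\<lambda>x. OPair a x b)" "resp (\<lambda>x. OPair a b x)"
  unfolding OPair_def Ex_def by (intro resp_UPair resp_intros)+

lemma resp_Maps: "resp (\<lambda>x. Maps a x b)" "resp (\<lambda>x. Maps a b x)"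
  unfolding Maps_def Ex_def by (intro resp_OPair resp_intros)+

end

section \<open>Pairs and functions in the forcing language\<close>

lemma finite_ordLeq_infinite:
  assumes "finite A" "infinite B"
  shows "|A| \<le>o |B|"
  by (rule ordLess_imp_ordLeq[OF finite_ordLess_infinite[OF card_of_Well_order card_of_Well_order]])
     (use assms in \<open>simp_all add: Field_card_of\<close>)

locale forcing_names = forcing_notion P le one
  for P :: "'p set" and le :: "'p \<Rightarrow> 'p \<Rightarrow> bool" and one :: 'p +
  fixes ity :: "'i itself"
  assumes infinite_i: "infinite (UNIV :: 'i set)"
    and P_small: "|P| \<le>o |UNIV :: 'i set|"
begin

abbreviation Pn :: "('i, 'p) pname set" where "Pn \<equiv> P_names P"

definition up :: "('i, 'p) pname \<Rightarrow> ('i, 'p) pname \<Rightarrow> ('i, 'p) pname" where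
  "up x y = mk_name {(one, x), (one, y)}"

definition op :: "('i, 'p) pname \<Rightarrow> ('i, 'p) pname \<Rightarrow> ('i, 'p) pname" where
  "op x y = up (up x x) (up x y)"

lemma elems_up [simp]: "elems (up x y) = {(one, x), (one, y)}"
  unfolding up_def by (rule elems_mk_name) (rule finite_ordLeq_infinite[OF _ infinite_i], simp)

lemma up_Pn [intro]: "x \<in> Pn \<Longrightarrow> y \<in> Pn \<Longrightarrow> up x y \<in> Pn"
  by (rule P_names.intros) auto

lemma op_Pn [intro]: "x \<in> Pn \<Longrightarrow> y \<in> Pn \<Longrightarrow> op x y \<in> Pn"
  unfolding op_def by blast

lemma fc_UPair:
  fixes x :: "('i, 'p) pname"
  shows "fc p (UPair z x y) \<longleftrightarrow>
    (\<forall>w\<in>Pn. \<forall>q\<in>P. le q p \<longrightarrow> (fc q (Mem w z) \<longleftrightarrow> dn q (\<lambda>r. feq r w x \<or> feq r w y)))"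
  by (simp add: UPair_def fc_Iff fc_Disj)

lemma UPair_MemE:
  assumes "fc p (UPair z x y)" "w \<in> Pn" "fc q (Mem w z)" "q \<in> P" "le q p"
  obtains r where "r \<in> P" "le r q" "feq r w x \<or> feq r w y"
  using assms by (auto simp: fc_UPair elim!: dnE[OF _ \<open>q \<in> P\<close> le_refl])

lemma UPair_Mem:
  assumes "fc p (UPair z x y)" "q \<in> P" "le q p"
  shows "x \<in> Pn \<Longrightarrow> fc q (Mem x z)" "y \<in> Pn \<Longrightarrow> fc q (Mem y z)"
  using assms by (auto simp: fc_UPair intro: dn_all)

lemma UPair_singleton:
  assumes "fc p (UPair z x x)" "w \<in> Pn" "fc q (Mem w z)" "q \<in> P" "le q p"
  shows "feq q w x"
  using assms by (auto simp: fc_UPair intro: feq_dn)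

lemma UPair_sym:
  fixes x :: "('i, 'p) pname"
  shows "fc p (UPair z x y) \<Longrightarrow> fc p (UPair z y x)"
  by (simp add: fc_UPair disj_commute)

lemma UPair_unique:
  assumes "fc p (UPair z x y)" "fc p (UPair z' x y)" "z \<in> Pn" "z' \<in> Pn"
  shows "feq p z z'"
  using assms by (intro feqI) (auto simp: fc_UPair)

lemma UPair_up: "x \<in> Pn \<Longrightarrow> y \<in> Pn \<Longrightarrow> fc p (UPair (up x y) x y)"
  unfolding fc_UPair
proof (intro ballI impI iffI)
  fix w q assume "q \<in> P" "fc q (Mem w (up x y))"
  then show "dn q (\<lambda>r. feq r w x \<or> feq r w y)"
    by (intro dnI, elim fc_MemE) (auto dest: feq_sym)
next
  fix w q assume q: "q \<in> P" "dn q (\<lambda>r. feq r w x \<or> feq r w y)"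
  show "fc q (Mem w (up x y))"
  proof (rule fcI)
    fix r assume "r \<in> P" "le r q"
    then obtain r' where r': "r' \<in> P" "le r' r" "feq r' w x \<or> feq r' w y"
      using q(2) dnE by blast
    have "fc r' (Mem x (up x y))" "fc r' (Mem y (up x y))"
      using r'(1) by (auto intro!: fc_Mem_elem[of one])
    then show "\<exists>r'\<in>P. le r' r \<and> fc r' (Mem w (up x y))"
      using r' fc_Mem_cong1 feq_sym by blast
  qed
qed

lemma OPair_op: "x \<in> Pn \<Longrightarrow> y \<in> Pn \<Longrightarrow> fc p (OPair (op x y) x y)"
  unfolding OPair_def fc_Ex op_def
  by (rule dn_all, rule bexI[of _ "up x x"], rule dn_all, rule bexI[of _ "up x y"])
     (auto intro!: UPair_up)

text \<open>Injectivity of Kuratowski pairs. A forced membership in a pair gives only a disjunction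
  of equalities below some stronger condition, so both conclusions are shown densely below
  \<open>p\<close>, with one passage to a stronger condition per case distinction.\<close>

lemma UPair_pair_inj:
  fixes a :: "('i, 'p) pname"
  assumes n: "a \<in> Pn" "b \<in> Pn" "s \<in> Pn" "t \<in> Pn" "u \<in> Pn" "v \<in> Pn" "u' \<in> Pn" "v' \<in> Pn"
    and u: "fc p (UPair u a a)" and v: "fc p (UPair v a b)" and z: "fc p (UPair z u v)"
    and u': "fc p (UPair u' s s)" and v': "fc p (UPair v' s t)" and z': "fc p (UPair z u' v')"
  shows "feq p a s" "feq p b t"
proof -
  show as: "feq p a s"
  proof (rule feq_dn, rule dnI)
    fix q assume q: "q \<in> P" "le q p"
    obtain r where r: "r \<in> P" "le r q" "feq r u u' \<or> feq r u v'"
      using UPair_MemE[OF z' n(5) UPair_Mem(1)[OF z q n(5)] q] .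
    have rp: "le r p"
      using r(2) q(2) by (rule le_trans)
    from r(3) have "feq r a s"
    proof
      assume "feq r u u'"
      from fc_Mem_cong2[OF this UPair_Mem(1)[OF u r(1) rp n(1)]] show ?thesis
        by (rule UPair_singleton[OF u' n(1) _ r(1) rp])
    next
      assume "feq r u v'"
      from fc_Mem_cong2[OF feq_sym[OF this] UPair_Mem(1)[OF v' r(1) rp n(3)]] show ?thesis
        by (intro feq_sym[OF UPair_singleton[OF u n(3) _ r(1) rp]])
    qed
    then show "\<exists>r\<in>P. le r q \<and> feq r a s"
      using r by blast
  qed
  show "feq p b t"
  proof (rule feq_dn, rule dnI)
    fix q assume q: "q \<in> P" "le q p"
    obtain r where r: "r \<in> P" "le r q" "feq r v u' \<or> feq r v v'"
      using UPair_MemE[OF z' n(6) UPair_Mem(2)[OF z q n(6)] q] .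
    have rp: "le r p"
      using r(2) q(2) by (rule le_trans)
    have asr: "feq r a s"
      using as rp by (rule feq_le)
    from r(3) have "\<exists>r'\<in>P. le r' r \<and> feq r' b t"
    proof
      \<comment> \<open>Case {a, b} = {s, t}: if \<open>b\<close> equals \<open>s\<close>, then it
        equals \<open>a\<close>, and so does \<open>t\<close>, which is one of \<open>a\<close> and
        \<open>b\<close>.\<close>
      assume vv: "feq r v v'"
      have "fc r (Mem b v')"
        by (rule fc_Mem_cong2[OF vv UPair_Mem(2)[OF v r(1) rp n(2)]])
      then obtain r' where r': "r' \<in> P" "le r' r" "feq r' b s \<or> feq r' b t"
        using UPair_MemE[OF v' n(2) _ r(1) rp] by blast
      have r'p: "le r' p"
        using r'(2) rp by (rule le_trans)
      have "fc r' (Mem t v)"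
        by (rule fc_Mem_cong2[OF feq_sym[OF feq_le[OF vv r'(2)]] UPair_Mem(2)[OF v' r'(1) r'p n(4)]])
      then obtain r'' where r'': "r'' \<in> P" "le r'' r'" "feq r'' t a \<or> feq r'' t b"
        using UPair_MemE[OF v n(4) _ r'(1) r'p] by blast
      have "le r'' r"
        using r''(2) r'(2) by (rule le_trans)
      moreover have "feq r'' b s \<or> feq r'' b t" "feq r'' a s"
        using r'(3) feq_le r''(2) feq_le[OF asr \<open>le r'' r\<close>] by blast+
      then have "feq r'' b t"
        using r''(3) by (meson feq_sym feq_trans)
      ultimately show ?thesis
        using r''(1) by blast
    next
      \<comment> \<open>Case {a, b} = {s}: then \<open>b\<close> equals \<open>s\<close>, and {s, t}
        is one of {a} and {a, b}, both equal to {s}, so \<open>t\<close> equals \<open>s\<close>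
        too.\<close>
      assume vu: "feq r v u'"
      have "fc r (Mem b u')"
        by (rule fc_Mem_cong2[OF vu UPair_Mem(2)[OF v r(1) rp n(2)]])
      then have bs: "feq r b s"
        by (rule UPair_singleton[OF u' n(2) _ r(1) rp])
      obtain r' where r': "r' \<in> P" "le r' r" "feq r' v' u \<or> feq r' v' v"
        using UPair_MemE[OF z n(8) UPair_Mem(2)[OF z' r(1) rp n(8)] r(1) rp] .
      have r'p: "le r' p"
        using r'(2) rp by (rule le_trans)
      have t: "fc r' (Mem t v')"
        by (rule UPair_Mem(2)[OF v' r'(1) r'p n(4)])
      have "feq r' t s"
        using r'(3)
      proof
        assume "feq r' v' u"
        then have "fc r' (Mem t u)"
          using t by (rule fc_Mem_cong2)
        then have "feq r' t a"
          by (rule UPair_singleton[OF u n(4) _ r'(1) r'p])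
        then show ?thesis
          by (rule feq_trans[OF _ feq_le[OF asr r'(2)]])
      next
        assume "feq r' v' v"
        then have "fc r' (Mem t u')"
          using t feq_le[OF vu r'(2)] by (blast intro: fc_Mem_cong2)
        then show ?thesis
          by (rule UPair_singleton[OF u' n(4) _ r'(1) r'p])
      qed
      then have "feq r' b t"
        using feq_le[OF bs r'(2)] by (meson feq_sym feq_trans)
      then show ?thesis
        using r' by blast
    qed
    then show "\<exists>r\<in>P. le r q \<and> feq r b t"
      using r(2) le_trans by blast
  qed
qed

lemma OPair_inj:
  fixes a :: "('i, 'p) pname"
  assumes n: "a \<in> Pn" "b \<in> Pn" "s \<in> Pn" "t \<in> Pn"
    and "fc p (OPair z a b)" "fc p (OPair z s t)"
  shows "feq p a s \<and> feq p b t"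
proof -
  have "\<exists>r\<in>P. le r q \<and> feq r a s \<and> feq r b t" if q: "q \<in> P" "le q p" for q
  proof -
    obtain r u where r: "r \<in> P" "le r q" "u \<in> Pn"
      "fc r (Ex (\<lambda>v. Conj (UPair u a a) (Conj (UPair v a b) (UPair z u v))))"
      using assms(5) q unfolding OPair_def fc_Ex[of p] by (elim dnE) auto
    obtain r1 v where r1: "r1 \<in> P" "le r1 r" "v \<in> Pn"
      "fc r1 (UPair u a a)" "fc r1 (UPair v a b)" "fc r1 (UPair z u v)"
      using r(4)[unfolded fc_Ex] r(1) by (auto elim!: dnE[OF _ _ le_refl])
    have r1p: "le r1 p"
      using r1(2) r(2) q(2) le_trans by blast
    obtain r2 u' where r2: "r2 \<in> P" "le r2 r1" "u' \<in> Pn"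
      "fc r2 (Ex (\<lambda>v. Conj (UPair u' s s) (Conj (UPair v s t) (UPair z u' v))))"
      using assms(6) r1(1) r1p unfolding OPair_def fc_Ex[of p] by (elim dnE) auto
    obtain r3 v' where r3: "r3 \<in> P" "le r3 r2" "v' \<in> Pn"
      "fc r3 (UPair u' s s)" "fc r3 (UPair v' s t)" "fc r3 (UPair z u' v')"
      using r2(4)[unfolded fc_Ex] r2(1) by (auto elim!: dnE[OF _ _ le_refl])
    have r31: "le r3 r1"
      using r3(2) r2(2) by (rule le_trans)
    have "feq r3 a s" "feq r3 b t"
      using UPair_pair_inj[OF n r(3) r1(3) r2(3) r3(3) fc_le[OF r1(4) r31] fc_le[OF r1(5) r31]
          fc_le[OF r1(6) r31] r3(4-6)] .
    moreover have "le r3 q"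
      using r31 r1(2) r(2) le_trans by blast
    ultimately show ?thesis
      using r3(1) by blast
  qed
  then show ?thesis
    by (intro conjI feq_dn dnI) blast+
qed

lemma fc_Maps_elem:
  assumes "(r, op s t) \<in> elems f" "s \<in> Pn" "t \<in> Pn" "p \<in> P" "le p r"
  shows "fc p (Maps f s t)"
  unfolding Maps_def fc_Ex
  by (rule dn_all, rule bexI[of _ "op s t"])
     (use assms in \<open>auto intro: OPair_op fc_le[OF fc_Mem_elem]\<close>)

text \<open>The name \<open>f\<close> is given by triples of a condition, an argument and a value. A
  forced \<open>Maps\<close> is traced, below a stronger condition, to a single triple whose
  condition is met.\<close>

lemma fc_Maps_graph:
  fixes s :: "'x \<Rightarrow> ('i, 'p) pname" and t :: "'y \<Rightarrow> ('i, 'p) pname"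
  assumes f: "elems f = (\<lambda>(r, i, j). (r, op (s i) (t j))) ` G"
    and G: "\<And>r i j. (r, i, j) \<in> G \<Longrightarrow> r \<in> P \<and> s i \<in> Pn \<and> t j \<in> Pn"
    and maps: "fc q (Maps f a b)" and q: "q \<in> P" and a: "a \<in> Pn" and b: "b \<in> Pn"
  shows "\<exists>r\<in>P. le r q \<and> (\<exists>(d, i, j)\<in>G. le r d \<and> feq r (s i) a \<and> feq r (t j) b)"
proof -
  obtain r0 z where r0: "r0 \<in> P" "le r0 q" "z \<in> Pn" "fc r0 (OPair z a b)" "fc r0 (Mem z f)"
    using maps q unfolding Maps_def fc_Ex by (auto elim!: dnE[OF _ _ le_refl])
  obtain r d e where r: "r \<in> P" "le r r0" "(d, e) \<in> elems f" "le r d" "feq r e z"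
    using fc_MemE[OF r0(5,1) le_refl] .
  obtain i j where ij: "(d, i, j) \<in> G" "e = op (s i) (t j)"
    using r(3) unfolding f by auto
  have "fc r (OPair z (s i) (t j))"
    using respD[OF resp_OPair(1) r(1,5)] OPair_op ij G by blast
  then have "feq r (s i) a \<and> feq r (t j) b"
    using OPair_inj[OF _ _ a b _ fc_le[OF r0(4) r(2)]] ij G by blast
  then show ?thesis
    using r(1,4) ij(1) le_trans[OF r(2) r0(2)] by blast
qed

subsection \<open>Names for ordinals and for functions\<close>

text \<open>Stated for any well-founded total relation, to serve both for the elements of an ordinal
  and for its successor. If \<open>n x\<close> and \<open>n y\<close> with \<open>R x y\<close> were
  forced equal, then \<open>n x\<close> would be a member of itself, hence equal to the name of a
  smaller index, against the induction hypothesis.\<close>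

lemma check_name_system:
  fixes n :: "'x \<Rightarrow> ('i, 'p) pname"
  assumes el: "\<And>y. y \<in> I \<Longrightarrow> elems (n y) = (\<lambda>x. (one, n x)) ` {x \<in> I. R x y}"
    and wf: "wfP R"
    and tot: "\<And>x y. x \<in> I \<Longrightarrow> y \<in> I \<Longrightarrow> x = y \<or> R x y \<or> R y x"
    and x: "x \<in> I" and y: "y \<in> I" and p: "p \<in> P"
  shows "feq p (n x) (n y) \<longleftrightarrow> x = y" "fc p (Mem (n x) (n y)) \<longleftrightarrow> R x y"
proof -
  have mem: "fc p (Mem (n x) (n y))" if "x \<in> I" "y \<in> I" "R x y" "p \<in> P" for p x y
    using that by (intro fc_Mem_elem[of one]) (auto simp: el)
  have memE: "\<exists>r\<in>P. le r p \<and> (\<exists>x\<in>I. R x y \<and> feq r (n x) w)"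
    if *: "y \<in> I" "fc p (Mem w (n y))" "p \<in> P" for p w y
  proof -
    obtain r c s where r: "r \<in> P" "le r p" "(c, s) \<in> elems (n y)" "feq r s w"
      using fc_MemE[OF *(2,3) le_refl] .
    obtain x where "x \<in> I" "R x y" "s = n x"
      using r(3) unfolding el[OF *(1)] by auto
    then show ?thesis
      using r by blast
  qed
  have irr: "\<not> feq p (n x) (n y)" if "x \<in> I" "y \<in> I" "R x y" "p \<in> P" for x y p
    using that
  proof (induction y arbitrary: x p rule: wfp_induct_rule[OF wf])
    case (1 y)
    show ?case
    proof
      assume "feq p (n x) (n y)"
      then have "fc p (Mem (n x) (n x))"
        using mem[OF 1(2-5)] fc_Mem_cong2 feq_sym by blast
      from memE[OF 1(2) this 1(5)] show False
        using 1 by blast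
    qed
  qed
  show eq: "feq p (n x) (n y) \<longleftrightarrow> x = y"
    using irr tot[OF x y] x y p feq_sym by (metis feq_refl)
  have eq': "feq p (n x') (n y') \<Longrightarrow> x' = y'" if "x' \<in> I" "y' \<in> I" "p \<in> P" for x' y' p
    using irr tot[OF that(1,2)] that feq_sym by metis
  show "fc p (Mem (n x) (n y)) \<longleftrightarrow> R x y"
    using mem[OF x y _ p] memE[OF y _ p] eq' x by blast
qed

text \<open>Arguments and values have to determine each other only among triples whose conditions
  lie above a common \<open>q\<close>, that is, can be met simultaneously. For the green set all
  conditions are trivial; for the red set they are not.\<close>

lemma fc_Bij:
  fixes s :: "'x \<Rightarrow> ('i, 'p) pname" and t :: "'y \<Rightarrow> ('i, 'p) pname"
  assumes f: "elems f = (\<lambda>(r, i, j). (r, op (s i) (t j))) ` G"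
    and G: "\<And>r i j. (r, i, j) \<in> G \<Longrightarrow> r \<in> P \<and> s i \<in> Pn \<and> t j \<in> Pn"
    and p: "p \<in> P"
    and tot: "\<And>q x. q \<in> P \<Longrightarrow> le q p \<Longrightarrow> x \<in> Pn \<Longrightarrow> fc q (Mem x A) \<Longrightarrow>
      \<exists>r\<in>P. le r q \<and> (\<exists>(r', i, j)\<in>G. le r r' \<and> feq r (s i) x)"
    and sur: "\<And>q y. q \<in> P \<Longrightarrow> le q p \<Longrightarrow> y \<in> Pn \<Longrightarrow> fc q (Mem y B) \<Longrightarrow>
      \<exists>r\<in>P. le r q \<and> (\<exists>(r', i, j)\<in>G. le r r' \<and> feq r (t j) y)"
    and mem: "\<And>q r i j. (r, i, j) \<in> G \<Longrightarrow> q \<in> P \<Longrightarrow> le q p \<Longrightarrow> le q r \<Longrightarrow>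
      fc q (Mem (s i) A) \<and> fc q (Mem (t j) B)"
    and inj: "\<And>q r i j r' i' j'. (r, i, j) \<in> G \<Longrightarrow> (r', i', j') \<in> G \<Longrightarrow> q \<in> P \<Longrightarrow> le q p \<Longrightarrow>
      le q r \<Longrightarrow> le q r' \<Longrightarrow> (feq q (s i) (s i') \<longrightarrow> j = j') \<and> (feq q (t j) (t j') \<longrightarrow> i = i')"
  shows "fc p (Bij f A B)"
proof -
  have fE: "\<exists>r\<in>P. le r q \<and> (\<exists>(d, i, j)\<in>G. le r d \<and> feq r (s i) a \<and> feq r (t j) b)"
    if "fc q (Maps f a b)" "q \<in> P" "a \<in> Pn" "b \<in> Pn" for q a b
    using fc_Maps_graph[OF f _ that] G by blast
  have maps: "fc q (Maps f x y)"
    if "(d, i, j) \<in> G" "q \<in> P" "le q d" "feq q (s i) x" "feq q (t j) y" for d i j q x y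
  proof -
    have "fc q (Maps f (s i) (t j))"
      using that(1-3) G f by (intro fc_Maps_elem[of d]) force+
    then show ?thesis
      using respD[OF resp_Maps(1) that(2,4)] respD[OF resp_Maps(2) that(2,5)] by blast
  qed
  have 1: "fc p (AllIn f (\<lambda>z. ExIn A (\<lambda>x. ExIn B (\<lambda>y. OPair z x y))))"
    unfolding fc_AllIn
  proof (intro ballI impI)
    fix z q assume q: "z \<in> Pn" "q \<in> P" "le q p" "fc q (Mem z f)"
    show "fc q (ExIn A (\<lambda>x. ExIn B (\<lambda>y. OPair z x y)))"
      unfolding fc_ExIn
    proof (rule dnI)
      fix r assume r: "r \<in> P" "le r q"
      obtain r' d e where r': "r' \<in> P" "le r' r" "(d, e) \<in> elems f" "le r' d" "feq r' e z"
        using fc_MemE[OF q(4) r] .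
      obtain i j where ij: "(d, i, j) \<in> G" "e = op (s i) (t j)"
        using r'(3) unfolding f by auto
      have "fc r' (OPair z (s i) (t j))"
        using respD[OF resp_OPair(1) r'(1,5)] OPair_op ij G by blast
      moreover have r'p: "le r' p"
        using r'(2) r(2) q(3) le_trans by blast
      ultimately have "dn r' (\<lambda>q. \<exists>y\<in>Pn. fc q (Mem y B) \<and> fc q (OPair z (s i) y))"
        using mem[OF ij(1) r'(1) r'p r'(4)] G[OF ij(1)] fc_le[of r']
        by (intro dn_all bexI[of _ "t j"] conjI) blast+
      then show "\<exists>r'\<in>P. le r' r \<and> (\<exists>x\<in>Pn. fc r' (Mem x A) \<and>
          dn r' (\<lambda>q. \<exists>y\<in>Pn. fc q (Mem y B) \<and> fc q (OPair z x y)))"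
        using mem[OF ij(1) r'(1) r'p r'(4)] G[OF ij(1)] r'(1,2) by blast
    qed
  qed
  have 2: "fc p (AllIn A (\<lambda>x. ExIn B (\<lambda>y. Conj (Maps f x y) (All (\<lambda>y'. Impl (Maps f x y') (Eq y' y))))))"
    unfolding fc_AllIn
  proof (intro ballI impI)
    fix x q assume x: "x \<in> Pn" and q: "q \<in> P" "le q p" "fc q (Mem x A)"
    show "fc q (ExIn B (\<lambda>y. Conj (Maps f x y) (All (\<lambda>y'. Impl (Maps f x y') (Eq y' y)))))"
      unfolding fc_ExIn
    proof (rule dnI)
      fix r assume r: "r \<in> P" "le r q"
      obtain r' d i j where r': "r' \<in> P" "le r' r" "(d, i, j) \<in> G" "le r' d" "feq r' (s i) x"
        using tot[OF r(1) le_trans[OF r(2) q(2)] x fc_le[OF q(3) r(2)]] by blast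
      have r'p: "le r' p"
        using r'(2) r(2) q(2) le_trans by blast
      have "feq q' y' (t j)" if q': "y' \<in> Pn" "q' \<in> P" "le q' r'" "fc q' (Maps f x y')" for y' q'
      proof (rule feq_dn, rule dnI)
        fix r1 assume r1: "r1 \<in> P" "le r1 q'"
        have r1p: "le r1 p"
          using r1 q' r'p le_trans by blast
        obtain r2 d2 i2 j2 where r2: "r2 \<in> P" "le r2 r1" "(d2, i2, j2) \<in> G" "le r2 d2" "feq r2 (s i2) x" "feq r2 (t j2) y'"
          using fE[OF fc_le[OF q'(4) r1(2)] r1(1) x q'(1)] by blast
        have r2': "le r2 r'"
          using r2(2) r1(2) q'(3) le_trans by blast
        have "feq r2 (s i) (s i2)"
          using feq_le[OF r'(5) r2'] r2(5) feq_sym feq_trans by blast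
        then have "j = j2"
          using inj[OF r'(3) r2(3) r2(1)] r'(4) r'p r2(4) r2' le_trans by blast
        then show "\<exists>r\<in>P. le r r1 \<and> feq r y' (t j)"
          using r2 feq_sym by blast
      qed
      then show "\<exists>r'\<in>P. le r' r \<and> (\<exists>y\<in>Pn. fc r' (Mem y B) \<and>
          fc r' (Conj (Maps f x y) (All (\<lambda>y'. Impl (Maps f x y') (Eq y' y)))))"
        using r' maps[OF r'(3,1,4,5) feq_refl] mem[OF r'(3,1) r'p r'(4)] G[OF r'(3)]
        by (intro bexI[of _ r'] conjI bexI[of _ "t j"]) (auto simp: fc_Impl)
    qed
  qed
  have 3: "fc p (AllIn B (\<lambda>y. ExIn A (\<lambda>x. Conj (Maps f x y) (All (\<lambda>x'. Impl (Maps f x' y) (Eq x' x))))))"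
    unfolding fc_AllIn
  proof (intro ballI impI)
    fix y q assume y: "y \<in> Pn" and q: "q \<in> P" "le q p" "fc q (Mem y B)"
    show "fc q (ExIn A (\<lambda>x. Conj (Maps f x y) (All (\<lambda>x'. Impl (Maps f x' y) (Eq x' x)))))"
      unfolding fc_ExIn
    proof (rule dnI)
      fix r assume r: "r \<in> P" "le r q"
      obtain r' d i j where r': "r' \<in> P" "le r' r" "(d, i, j) \<in> G" "le r' d" "feq r' (t j) y"
        using sur[OF r(1) le_trans[OF r(2) q(2)] y fc_le[OF q(3) r(2)]] by blast
      have r'p: "le r' p"
        using r'(2) r(2) q(2) le_trans by blast
      have "feq q' x' (s i)" if q': "x' \<in> Pn" "q' \<in> P" "le q' r'" "fc q' (Maps f x' y)" for x' q'
      proof (rule feq_dn, rule dnI)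
        fix r1 assume r1: "r1 \<in> P" "le r1 q'"
        have r1p: "le r1 p"
          using r1 q' r'p le_trans by blast
        obtain r2 d2 i2 j2 where r2: "r2 \<in> P" "le r2 r1" "(d2, i2, j2) \<in> G" "le r2 d2" "feq r2 (s i2) x'" "feq r2 (t j2) y"
          using fE[OF fc_le[OF q'(4) r1(2)] r1(1) q'(1) y] by blast
        have r2': "le r2 r'"
          using r2(2) r1(2) q'(3) le_trans by blast
        have "feq r2 (t j) (t j2)"
          using feq_le[OF r'(5) r2'] r2(6) feq_sym feq_trans by blast
        then have "i = i2"
          using inj[OF r'(3) r2(3) r2(1)] r'(4) r'p r2(4) r2' le_trans by blast
        then show "\<exists>r\<in>P. le r r1 \<and> feq r x' (s i)"
          using r2 feq_sym by blast
      qed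
      then show "\<exists>r'\<in>P. le r' r \<and> (\<exists>x\<in>Pn. fc r' (Mem x A) \<and>
          fc r' (Conj (Maps f x y) (All (\<lambda>x'. Impl (Maps f x' y) (Eq x' x)))))"
        using r' maps[OF r'(3,1,4) feq_refl r'(5)] mem[OF r'(3,1) r'p r'(4)] G[OF r'(3)]
        by (intro bexI[of _ r'] conjI bexI[of _ "s i"]) (auto simp: fc_Impl)
    qed
  qed
  show ?thesis
    unfolding Bij_def Fun_def forces.simps using 1 2 3 by blast
qed

end

section \<open>Check names of well-orders and of their successors\<close>

lemma wo_rel_underS_cases:
  assumes "Well_order r" "a \<in> Field r" "b \<in> Field r"
  shows "a = b \<or> a \<in> underS r b \<or> b \<in> underS r a"
  using assms wo_rel.TOTALS[of r] by (auto simp: wo_rel_def underS_def)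

lemma underS_trans:
  assumes "Well_order r" "a \<in> underS r b" "b \<in> underS r c"
  shows "a \<in> underS r c"
  using assms wo_rel.TRANS[of r] wo_rel.ANTISYM[of r]
  by (auto simp: wo_rel_def underS_def dest: transD antisymD)

lemma underS_asym:
  assumes "Well_order r" "a \<in> underS r b"
  shows "b \<notin> underS r a"
  using assms wo_rel.ANTISYM[of r] by (auto simp: wo_rel_def underS_def dest: antisymD)

lemma wfp_underS:
  assumes "Well_order r"
  shows "wfP (\<lambda>a b. a \<in> underS r b)"
proof -
  have "wf (r - Id)"
    using assms by (simp add: well_order_on_def)
  then show ?thesis
    unfolding wfp_def by (rule wf_subset) (auto simp: underS_def)
qed

lemma elt_name_unfold:
  assumes "Well_order r"
  shows "elt_name one r a = mk_name ((\<lambda>b. (one, elt_name one r b)) ` underS r a)"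
proof -
  have wo: "wo_rel r"
    using assms by (simp add: wo_rel_def)
  have "wo_rel.adm_wo r (\<lambda>f a. mk_name ((\<lambda>b. (one, f b)) ` underS r a))"
    unfolding wo_rel.adm_wo_def[OF wo] by (auto cong: image_cong)
  from fun_cong[OF wo_rel.worec_fixpoint[OF wo this], of a] show ?thesis
    unfolding elt_name_def .
qed

text \<open>The order of type \<open>r\<close> plus one, with \<open>None\<close> as its new last
  point: the index order of the green sets.\<close>

definition succ_less :: "'a rel \<Rightarrow> 'a option \<Rightarrow> 'a option \<Rightarrow> bool" where
  "succ_less r x y \<longleftrightarrow> (\<exists>a. x = Some a \<and> (case y of Some b \<Rightarrow> a \<in> underS r b | None \<Rightarrow> a \<in> Field r))"

definition succ_field :: "'a rel \<Rightarrow> 'a option set" where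
  "succ_field r = insert None (Some ` Field r)"

context forcing_names
begin

lemma elems_elt_name:
  assumes "Well_order r" "|Field r| \<le>o |UNIV :: 'i set|"
  shows "elems (elt_name one r a :: ('i, 'p) pname) = (\<lambda>b. (one, elt_name one r b)) ` underS r a"
proof -
  have "|(\<lambda>b. (one, elt_name one r b :: ('i, 'p) pname)) ` underS r a| \<le>o |underS r a|"
    by (rule card_of_image)
  also have "|underS r a| \<le>o |Field r|"
    by (rule card_of_mono1) (auto simp: underS_def Field_def)
  also note assms(2)
  finally show ?thesis
    by (subst elt_name_unfold[OF assms(1)]) (rule elems_mk_name)
qed

lemma elt_name_Pn:
  assumes "Well_order r" "|Field r| \<le>o |UNIV :: 'i set|"
  shows "(elt_name one r a :: ('i, 'p) pname) \<in> Pn"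
proof (induction a rule: wfp_induct_rule[OF wfp_underS[OF assms(1)]])
  case (1 a)
  show ?case
    by (rule P_names.intros) (use 1 in \<open>auto simp: elems_elt_name[OF assms]\<close>)
qed

lemma elems_ord_name:
  assumes "|Field r| \<le>o |UNIV :: 'i set|"
  shows "elems (ord_name one r :: ('i, 'p) pname) = (\<lambda>b. (one, elt_name one r b)) ` Field r"
  unfolding ord_name_def
  by (rule elems_mk_name) (rule ordLeq_transitive[OF card_of_image assms])

lemma ord_name_Pn:
  assumes "Well_order r" "|Field r| \<le>o |UNIV :: 'i set|"
  shows "(ord_name one r :: ('i, 'p) pname) \<in> Pn"
  by (rule P_names.intros) (auto simp: elems_ord_name[OF assms(2)] elt_name_Pn[OF assms])

lemma elt_name_feq:
  assumes "Well_order r" "|Field r| \<le>o |UNIV :: 'i set|" "a \<in> Field r" "b \<in> Field r" "p \<in> P"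
  shows "feq p (elt_name one r a :: ('i, 'p) pname) (elt_name one r b) \<longleftrightarrow> a = b"
    "fc p (Mem (elt_name one r a :: ('i, 'p) pname) (elt_name one r b)) \<longleftrightarrow> a \<in> underS r b"
proof -
  have el: "elems (elt_name one r b :: ('i, 'p) pname) =
      (\<lambda>a. (one, elt_name one r a)) ` {a \<in> Field r. a \<in> underS r b}" for b
  proof -
    have "{a \<in> Field r. a \<in> underS r b} = underS r b"
      by (auto simp: underS_def Field_def)
    then show ?thesis
      by (simp add: elems_elt_name[OF assms(1,2)])
  qed
  note chk = check_name_system[where I = "Field r" and n = "elt_name one r",
      OF el wfp_underS[OF assms(1)] wo_rel_underS_cases[OF assms(1)] assms(3-5)]
  from chk show "feq p (elt_name one r a :: ('i, 'p) pname) (elt_name one r b) \<longleftrightarrow> a = b"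
    "fc p (Mem (elt_name one r a :: ('i, 'p) pname) (elt_name one r b)) \<longleftrightarrow> a \<in> underS r b"
    by simp_all
qed

definition succ_elt :: "'a rel \<Rightarrow> 'a option \<Rightarrow> ('i, 'p) pname" where
  "succ_elt r x = (case x of Some a \<Rightarrow> elt_name one r a | None \<Rightarrow> ord_name one r)"

lemma succ_simps:
  assumes "Well_order r" "|Field r| \<le>o |UNIV :: 'i set|"
  shows "x \<in> succ_field r \<Longrightarrow> elems (succ_elt r x) = (\<lambda>y. (one, succ_elt r y)) ` {y \<in> succ_field r. succ_less r y x}"
    and "succ_elt r x \<in> Pn"
    and "wfP (succ_less r)"
    and "x \<in> succ_field r \<Longrightarrow> y \<in> succ_field r \<Longrightarrow> x = y \<or> succ_less r x y \<or> succ_less r y x"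
    and "elems (succ_name one (ord_name one r) :: ('i, 'p) pname) = (\<lambda>y. (one, succ_elt r y)) ` succ_field r"
proof -
  show "elems (succ_elt r x) = (\<lambda>y. (one, succ_elt r y)) ` {y \<in> succ_field r. succ_less r y x}"
    if "x \<in> succ_field r"
  proof (cases x)
    case None
    have "{y \<in> succ_field r. succ_less r y x} = Some ` Field r"
      by (auto simp: succ_field_def succ_less_def None)
    then show ?thesis
      by (simp add: None succ_elt_def elems_ord_name[OF assms(2)] image_image)
  next
    case (Some a)
    have "{y \<in> succ_field r. succ_less r y x} = Some ` underS r a"
      by (auto simp: succ_field_def succ_less_def Some underS_def Field_def)
    then show ?thesis
      by (simp add: Some succ_elt_def elems_elt_name[OF assms] image_image)
  qed
  show "succ_elt r x \<in> Pn"
    by (auto simp: succ_elt_def elt_name_Pn[OF assms] ord_name_Pn[OF assms] split: option.splits)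
  show "wfP (succ_less r)"
  proof (rule wfpUNIVI)
    fix Q x assume *: "\<forall>x. (\<forall>y. succ_less r y x \<longrightarrow> Q y) \<longrightarrow> Q x"
    have "Q (Some a)" for a
    proof (induction a rule: wfp_induct_rule[OF wfp_underS[OF assms(1)]])
      case (1 a)
      then show ?case
        by (intro *[THEN spec, THEN mp]) (auto simp: succ_less_def)
    qed
    then show "Q x"
      by (intro *[THEN spec, THEN mp]) (auto simp: succ_less_def)
  qed
  show "x = y \<or> succ_less r x y \<or> succ_less r y x" if "x \<in> succ_field r" "y \<in> succ_field r"
    using that by (auto simp: succ_field_def succ_less_def dest: wo_rel_underS_cases[OF assms(1)])
  have "|insert (one, ord_name one r :: ('i, 'p) pname) (elems (ord_name one r))| \<le>o |UNIV :: 'i set|"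
    unfolding elems_ord_name[OF assms(2)]
  proof -
    let ?A = "(\<lambda>b. (one, elt_name one r b :: ('i, 'p) pname)) ` Field r"
    have "|{(one, ord_name one r)} \<union> ?A| \<le>o |UNIV :: 'i set|"
      by (rule card_of_Un_ordLeq_infinite_Field)
         (auto simp: Field_card_of infinite_i card_of_card_order_on
           intro: ordLeq_transitive[OF card_of_image assms(2)] finite_ordLeq_infinite)
    then show "|insert (one, ord_name one r) ?A| \<le>o |UNIV :: 'i set|"
      by simp
  qed
  from elems_mk_name[OF this] show
    "elems (succ_name one (ord_name one r) :: ('i, 'p) pname) = (\<lambda>y. (one, succ_elt r y)) ` succ_field r"
    unfolding succ_name_def
    by (simp add: elems_ord_name[OF assms(2)] succ_field_def succ_elt_def image_image)
qed

lemma PairsE: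
  fixes d :: "('i, 'p) pname"
  assumes "fc p (Pairs d A)" "s \<in> Pn" "q \<in> P" "le q p" "fc q (Mem s d)"
  obtains r x y where "r \<in> P" "le r q" "x \<in> Pn" "y \<in> Pn" "fc r (Mem x A)" "fc r (Mem y A)"
    "fc r (Neg (Eq x y))" "fc r (UPair s x y)"
proof -
  have "fc q (ExIn A (\<lambda>x. ExIn A (\<lambda>y. Conj (Neg (Eq x y)) (UPair s x y))))"
    using assms unfolding Pairs_def forces.simps(5) fc_Iff by blast
  then obtain r x where r: "r \<in> P" "le r q" "x \<in> Pn" "fc r (Mem x A)"
    "fc r (ExIn A (\<lambda>y. Conj (Neg (Eq x y)) (UPair s x y)))"
    unfolding fc_ExIn[of q] using assms(3) by (elim dnE[OF _ _ le_refl]) blast+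
  from r(5) obtain r' y where r': "r' \<in> P" "le r' r" "y \<in> Pn" "fc r' (Mem y A)"
    "fc r' (Neg (Eq x y))" "fc r' (UPair s x y)"
    unfolding fc_ExIn[of r] forces.simps(4) using r(1) by (elim dnE[OF _ _ le_refl]) blast+
  show thesis
    by (rule that[OF r'(1) le_trans[OF r'(2) r(2)] r(3) r'(3) fc_le[OF r(4) r'(2)] r'(4-6)])
qed

lemma PairsI:
  assumes "fc p (Pairs d A)" "s \<in> Pn" "q \<in> P" "le q p" "x \<in> Pn" "y \<in> Pn"
    "fc q (Mem x A)" "fc q (Mem y A)" "fc q (Neg (Eq x y))" "fc q (UPair s x y)"
  shows "fc q (Mem s d)"
proof -
  have "fc q (ExIn A (\<lambda>x. ExIn A (\<lambda>y. Conj (Neg (Eq x y)) (UPair s x y))))"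
    unfolding fc_ExIn forces.simps(4)
    by (intro dn_all bexI[OF _ assms(5)] bexI[OF _ assms(6)] conjI
        fc_le[OF assms(7)] fc_le[OF assms(8)] fc_le[OF assms(9)] fc_le[OF assms(10)])
       (assumption | rule le_trans)+
  then show ?thesis
    using assms unfolding Pairs_def forces.simps(5) fc_Iff by blast
qed

lemma fc_Homogeneous:
  fixes A :: "('i, 'p) pname"
  assumes "\<And>s q x y. s \<in> Pn \<Longrightarrow> q \<in> P \<Longrightarrow> le q p \<Longrightarrow> x \<in> Pn \<Longrightarrow> y \<in> Pn \<Longrightarrow> fc q (Mem x A) \<Longrightarrow>
    fc q (Mem y A) \<Longrightarrow> fc q (Neg (Eq x y)) \<Longrightarrow> fc q (UPair s x y) \<Longrightarrow> \<exists>r\<in>P. le r q \<and> fc r (Maps c s i)"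
  shows "fc p (Homogeneous c A i)"
  unfolding Homogeneous_def forces.simps(5) fc_Impl fc_AllIn
proof (intro ballI impI)
  fix d q s q' assume a: "d \<in> Pn" "q \<in> P" "le q p" "fc q (Pairs d A)" "s \<in> Pn" "q' \<in> P" "le q' q" "fc q' (Mem s d)"
  show "fc q' (Maps c s i)"
  proof (rule fcI)
    fix r assume r: "r \<in> P" "le r q'"
    have rq: "le r q"
      using r(2) a(7) by (rule le_trans)
    obtain r' x y where r': "r' \<in> P" "le r' r" "x \<in> Pn" "y \<in> Pn" "fc r' (Mem x A)" "fc r' (Mem y A)"
      "fc r' (Neg (Eq x y))" "fc r' (UPair s x y)"
      using PairsE[OF a(4,5) r(1) rq fc_le[OF a(8) r(2)]] .
    have "le r' p"
      using r'(2) rq a(3) le_trans by blast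
    from assms[OF a(5) r'(1) this r'(3-8)] show "\<exists>r'\<in>P. le r' r \<and> fc r' (Maps c s i)"
      using r'(2) le_trans by blast
  qed
qed

end

section \<open>Reduction of the partition relation to a dichotomy in the ground model\<close>

context forcing_names
begin

text \<open>Both alternatives of \<open>dichotomy\<close> are statements of the ground model. The
  green set is the range of \<open>h\<close>. The red set consists of points \<open>x\<close> with
  \<open>c x\<close> in the generic filter; its size is secured by \<open>\<phi>\<close>, which has
  one fibre for each point of \<open>l\<close>, and every fibre is met by each generic filter
  containing \<open>q\<close>. As there are only two colours, a pair is red as soon as no condition
  below \<open>c x\<close> and \<open>c y\<close> makes it green.\<close>

lemma forced_Arrow:
  fixes l :: "'d rel" and r :: "'a rel"
  assumes l: "Well_order l" "|Field l| \<le>o |UNIV :: 'i set|"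
    and r: "Well_order r" "|Field r| \<le>o |UNIV :: 'i set|"
    and dichotomy: "\<And>(g :: 'd \<Rightarrow> 'd \<Rightarrow> 'p \<Rightarrow> bool) p. p \<in> P \<Longrightarrow>
      \<forall>a b q. \<forall>q'\<in>P. g a b q \<longrightarrow> le q' q \<longrightarrow> g a b q' \<Longrightarrow>
      (\<exists>q\<in>P. le q p \<and> (\<exists>h. (\<forall>x\<in>succ_field r. h x \<in> Field l) \<and>
         (\<forall>x\<in>succ_field r. \<forall>y\<in>succ_field r. succ_less r x y \<longrightarrow> h x \<in> underS l (h y) \<and> g (h x) (h y) q))) \<or>
      (\<exists>q\<in>P. le q p \<and> (\<exists>C \<phi> c. C \<subseteq> Field l \<and> (\<forall>x\<in>C. \<phi> x \<in> Field l \<and> c x \<in> P) \<and>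
         (\<forall>z\<in>Field l. \<forall>q'\<in>P. le q' q \<longrightarrow> (\<exists>x\<in>C. \<phi> x = z \<and> (\<exists>q''\<in>P. le q'' q' \<and> le q'' (c x)))) \<and>
         (\<forall>x\<in>C. \<forall>y\<in>C. x \<in> underS l y \<longrightarrow> \<not> (\<exists>q\<in>P. le q (c x) \<and> le q (c y) \<and> g x y q))))"
    and p: "p \<in> P"
  shows "fc p (Arrow (ord_name one l :: ('i, 'p) pname) (succ_name one (ord_name one r)))"
proof -
  define v :: "'d \<Rightarrow> ('i, 'p) pname" where "v = elt_name one l"
  define L :: "('i, 'p) pname" where "L = ord_name one l"
  define Z :: "('i, 'p) pname" where "Z = succ_name one (ord_name one r)"
  define n :: "'a option \<Rightarrow> ('i, 'p) pname" where "n = succ_elt r"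
  have v_Pn: "v a \<in> Pn" for a
    unfolding v_def by (rule elt_name_Pn[OF l])
  have n_Pn: "n a \<in> Pn" for a
    unfolding n_def by (rule succ_simps(2)[OF r])
  have v_eq: "feq q (v a) (v b) \<longleftrightarrow> a = b" and v_mem: "fc q (Mem (v a) (v b)) \<longleftrightarrow> a \<in> underS l b"
    if "a \<in> Field l" "b \<in> Field l" "q \<in> P" for a b q
    unfolding v_def using elt_name_feq[OF l that] by simp_all
  have n_eq: "feq q (n x) (n y) \<longleftrightarrow> x = y" and n_mem: "fc q (Mem (n x) (n y)) \<longleftrightarrow> succ_less r x y"
    if "x \<in> succ_field r" "y \<in> succ_field r" "q \<in> P" for x y q
    using check_name_system[where n = "succ_elt r" and I = "succ_field r",
        OF succ_simps(1)[OF r] succ_simps(3)[OF r] succ_simps(4)[OF r] that]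
    by (simp_all add: n_def)
  have L_elems: "elems L = (\<lambda>a. (one, v a)) ` Field l"
    unfolding L_def v_def by (rule elems_ord_name[OF l(2)])
  have Z_elems: "elems Z = (\<lambda>x. (one, n x)) ` succ_field r"
    unfolding Z_def n_def by (rule succ_simps(5)[OF r])
  have L_mem: "fc q (Mem (v a) L)" if "a \<in> Field l" "q \<in> P" for a q
    using that by (intro fc_Mem_elem[of one]) (auto simp: L_elems)
  have Z_mem: "fc q (Mem (n x) Z)" if "x \<in> succ_field r" "q \<in> P" for x q
    using that by (intro fc_Mem_elem[of one]) (auto simp: Z_elems)
  have L_memE: "\<exists>q'\<in>P. le q' q \<and> (\<exists>a\<in>Field l. feq q' (v a) w)" if *: "fc q (Mem w L)" "q \<in> P" for q w
  proof -
    obtain q' c s where q': "q' \<in> P" "le q' q" "(c, s) \<in> elems L" "feq q' s w"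
      using fc_MemE[OF * le_refl] .
    then show ?thesis
      unfolding L_elems by blast
  qed
  have Z_memE: "\<exists>q'\<in>P. le q' q \<and> (\<exists>a\<in>succ_field r. feq q' (n a) w)" if *: "fc q (Mem w Z)" "q \<in> P" for q w
  proof -
    obtain q' c s where q': "q' \<in> P" "le q' q" "(c, s) \<in> elems Z" "feq q' s w"
      using fc_MemE[OF * le_refl] .
    then show ?thesis
      unfolding Z_elems by blast
  qed
  have goal: "fc p1 (Disj
        (Ex (\<lambda>x. Conj (Subset x L) (Conj (Equinumerous x L) (Homogeneous c x red))))
        (Ex (\<lambda>y. Conj (Subset y L) (Conj (OrderType y Z) (Homogeneous c y green)))))"
    if nam: "red \<in> Pn" "green \<in> Pn" "cols \<in> Pn" "dd \<in> Pn" "c \<in> Pn" and p1: "p1 \<in> P"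
      and cols: "fc p1 (UPair cols red green)" and dd: "fc p1 (Pairs dd L)" and fn: "fc p1 (Fun c dd cols)"
    for p1 red green cols dd c
    unfolding fc_Disj
  proof (rule dnI)
    fix p2 assume p2: "p2 \<in> P" "le p2 p1"
    define g where "g a b q \<longleftrightarrow> fc q (Maps c (up (v a) (v b)) green)" for a b q
    have g_mono: "\<forall>a b q. \<forall>q'\<in>P. g a b q \<longrightarrow> le q' q \<longrightarrow> g a b q'"
      unfolding g_def by (blast intro: fc_le)
    have pair: "feq q s (up (v a) (v b))"
      if "s \<in> Pn" "q \<in> P" "fc q (UPair s x y)" "feq q (v a) x" "feq q (v b) y" for s q x y a b
    proof -
      have "fc q (UPair s (v a) (v b))"
        using respD[OF resp_UPair(2) that(2) feq_sym[OF that(4)]]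
          respD[OF resp_UPair(3) that(2) feq_sym[OF that(5)]] that(3) by blast
      from UPair_unique[OF this UPair_up[OF v_Pn v_Pn] that(1)] show ?thesis
        using v_Pn by blast
    qed
    have sym: "feq q (up (v a) (v b)) (up (v b) (v a))" for a b q
      by (rule UPair_unique[OF UPair_up UPair_sym[OF UPair_up]]) (auto intro: v_Pn)
    show "\<exists>q\<in>P. le q p2 \<and>
        (fc q (Ex (\<lambda>x. Conj (Subset x L) (Conj (Equinumerous x L) (Homogeneous c x red)))) \<or>
         fc q (Ex (\<lambda>y. Conj (Subset y L) (Conj (OrderType y Z) (Homogeneous c y green)))))"
      using dichotomy[of p2 g, OF p2(1) g_mono]
    proof (elim disjE)
      assume "\<exists>q\<in>P. le q p2 \<and> (\<exists>h. (\<forall>x\<in>succ_field r. h x \<in> Field l) \<and>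
         (\<forall>x\<in>succ_field r. \<forall>y\<in>succ_field r. succ_less r x y \<longrightarrow> h x \<in> underS l (h y) \<and> g (h x) (h y) q))"
      then obtain q h where q: "q \<in> P" "le q p2" and h: "\<And>x. x \<in> succ_field r \<Longrightarrow> h x \<in> Field l"
        and less: "\<And>x y. x \<in> succ_field r \<Longrightarrow> y \<in> succ_field r \<Longrightarrow> succ_less r x y \<Longrightarrow>
          h x \<in> underS l (h y) \<and> g (h x) (h y) q"
        by blast
      have less_iff: "succ_less r x y \<longleftrightarrow> h x \<in> underS l (h y)" if "x \<in> succ_field r" "y \<in> succ_field r" for x y
        using less that succ_simps(4)[OF r that] underS_asym[OF l(1)] by (metis underS_notIn)
      have h_inj: "x = y" if "x \<in> succ_field r" "y \<in> succ_field r" "h x = h y" for x y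
        using succ_simps(4)[OF r that(1,2)] less_iff that by (metis underS_notIn)
      have small: "|succ_field r| \<le>o |UNIV :: 'i set|"
      proof -
        have "|{None} \<union> Some ` Field r| \<le>o |UNIV :: 'i set|"
          by (rule card_of_Un_ordLeq_infinite_Field)
             (auto simp: Field_card_of infinite_i card_of_card_order_on
               intro: ordLeq_transitive[OF card_of_image r(2)] finite_ordLeq_infinite)
        then show ?thesis
          by (simp add: succ_field_def)
      qed
      define Y where "Y = mk_name ((\<lambda>x. (one, v (h x))) ` succ_field r)"
      have Y: "elems Y = (\<lambda>x. (one, v (h x))) ` succ_field r"
        unfolding Y_def by (rule elems_mk_name) (rule ordLeq_transitive[OF card_of_image small])
      have Y_Pn: "Y \<in> Pn"
        by (rule P_names.intros) (auto simp: Y v_Pn)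
      define G where "G = (\<lambda>x. (one, x, x)) ` succ_field r"
      define f where "f = mk_name ((\<lambda>(c, x, y). (c, op (n x) ((v \<circ> h) y))) ` G)"
      have f: "elems f = (\<lambda>(c, x, y). (c, op (n x) ((v \<circ> h) y))) ` G"
        unfolding f_def G_def
        by (rule elems_mk_name) (rule ordLeq_transitive[OF card_of_image ordLeq_transitive[OF card_of_image small]])
      have f_Pn: "f \<in> Pn"
        by (rule P_names.intros) (auto simp: f G_def intro!: op_Pn n_Pn v_Pn)
      have Y_memE: "\<exists>q'\<in>P. le q' q1 \<and> (\<exists>a\<in>succ_field r. feq q' (v (h a)) w)"
        if *: "fc q1 (Mem w Y)" "q1 \<in> P" for q1 w
      proof -
        obtain q' c s where q': "q' \<in> P" "le q' q1" "(c, s) \<in> elems Y" "feq q' s w"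
          using fc_MemE[OF * le_refl] .
        then show ?thesis
          unfolding Y by blast
      qed
      have Y_mem: "fc q' (Mem (v (h x)) Y)" if "x \<in> succ_field r" "q' \<in> P" for x q'
        using that by (intro fc_Mem_elem[of one]) (auto simp: Y)
      have bij: "fc q (Bij f Z Y)"
      proof (rule fc_Bij[OF f _ q(1)])
        fix c i j assume "(c, i, j) \<in> G"
        then show "c \<in> P \<and> n i \<in> Pn \<and> (v \<circ> h) j \<in> Pn"
          by (auto simp: G_def n_Pn v_Pn)
      next
        fix q1 w assume "q1 \<in> P" "fc q1 (Mem w Z)"
        then show "\<exists>r\<in>P. le r q1 \<and> (\<exists>(r', i, j)\<in>G. le r r' \<and> feq r (n i) w)"
          using Z_memE unfolding G_def by fastforce
      next
        fix q1 w assume "q1 \<in> P" "fc q1 (Mem w Y)"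
        then show "\<exists>r\<in>P. le r q1 \<and> (\<exists>(r', i, j)\<in>G. le r r' \<and> feq r ((v \<circ> h) j) w)"
          using Y_memE unfolding G_def by fastforce
      next
        fix q1 c i j assume "(c, i, j) \<in> G" "q1 \<in> P"
        then show "fc q1 (Mem (n i) Z) \<and> fc q1 (Mem ((v \<circ> h) j) Y)"
          by (auto simp: G_def intro: Z_mem Y_mem)
      next
        fix q1 c i j c' i' j' assume "(c, i, j) \<in> G" "(c', i', j') \<in> G" "q1 \<in> P"
        then show "(feq q1 (n i) (n i') \<longrightarrow> j = j') \<and> (feq q1 ((v \<circ> h) j) ((v \<circ> h) j') \<longrightarrow> i = i')"
          by (auto simp: G_def n_eq v_eq h intro: h_inj)
      qed
      have order: "fc q1 (Iff (Mem x y) (Mem x' y'))"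
        if nm: "x \<in> Pn" "y \<in> Pn" "x' \<in> Pn" "y' \<in> Pn" and q1: "q1 \<in> P"
          and maps: "fc q1 (Maps f x x')" "fc q1 (Maps f y y')" for q1 x y x' y'
      proof (rule fcI)
        fix q2 assume q2: "q2 \<in> P" "le q2 q1"
        have G: "c \<in> P \<and> n i \<in> Pn \<and> (v \<circ> h) j \<in> Pn" if "(c, i, j) \<in> G" for c i j
          using that by (auto simp: G_def n_Pn v_Pn)
        obtain q3 i where q3: "q3 \<in> P" "le q3 q2" "i \<in> succ_field r" "feq q3 (n i) x" "feq q3 (v (h i)) x'"
          using fc_Maps_graph[OF f G fc_le[OF maps(1) q2(2)] q2(1) nm(1,3)] by (auto simp: G_def)
        have q31: "le q3 q1"
          using q3(2) q2(2) by (rule le_trans)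
        obtain q4 j where q4: "q4 \<in> P" "le q4 q3" "j \<in> succ_field r" "feq q4 (n j) y" "feq q4 (v (h j)) y'"
          using fc_Maps_graph[OF f G fc_le[OF maps(2) q31] q3(1) nm(2,4)] by (auto simp: G_def)
        have "fc q5 (Mem x y) \<longleftrightarrow> fc q5 (Mem x' y')" if q5: "q5 \<in> P" "le q5 q4" for q5
        proof -
          have q53: "le q5 q3"
            using q5(2) q4(2) by (rule le_trans)
          have "fc q5 (Mem x y) \<longleftrightarrow> fc q5 (Mem (n i) (n j))"
            using feq_le[OF q3(4) q53] feq_le[OF q4(4) q5(2)] by (meson fc_Mem_cong1 fc_Mem_cong2 feq_sym)
          also have "\<dots> \<longleftrightarrow> fc q5 (Mem (v (h i)) (v (h j)))"
            using n_mem[OF q3(3) q4(3) q5(1)] v_mem[OF h[OF q3(3)] h[OF q4(3)] q5(1)]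
              less_iff[OF q3(3) q4(3)] by simp
          also have "\<dots> \<longleftrightarrow> fc q5 (Mem x' y')"
            using feq_le[OF q3(5) q53] feq_le[OF q4(5) q5(2)] by (meson fc_Mem_cong1 fc_Mem_cong2 feq_sym)
          finally show ?thesis .
        qed
        then have "fc q4 (Iff (Mem x y) (Mem x' y'))"
          by (simp add: fc_Iff)
        then show "\<exists>q'\<in>P. le q' q2 \<and> fc q' (Iff (Mem x y) (Mem x' y'))"
          using q4(1,2) q3(2) le_trans by blast
      qed
      have otype: "fc q (OrderType Y Z)"
        unfolding OrderType_def fc_Ex forces.simps(4)
      proof (rule dn_all, rule bexI[OF _ f_Pn], rule conjI)
        fix q1 assume q1: "q1 \<in> P" "le q1 q"
        show "fc q1 (Bij f Z Y)"
          by (rule fc_le[OF bij q1(2)])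
        show "fc q1 (AllIn Z (\<lambda>u. AllIn Z (\<lambda>v. AllIn Y (\<lambda>u'. AllIn Y (\<lambda>v'.
            Impl (Conj (Maps f u u') (Maps f v v')) (Iff (Mem u v) (Mem u' v')))))))"
          unfolding fc_AllIn fc_Impl forces.simps(4) by (intro ballI impI order) blast+
      qed
      have sub: "fc q (Subset Y L)"
        unfolding Subset_def fc_AllIn
      proof (intro ballI impI)
        fix w q1 assume w: "w \<in> Pn" "q1 \<in> P" "le q1 q" "fc q1 (Mem w Y)"
        show "fc q1 (Mem w L)"
        proof (rule fcI)
          fix q2 assume q2: "q2 \<in> P" "le q2 q1"
          obtain q3 a where q3: "q3 \<in> P" "le q3 q2" "a \<in> succ_field r" "feq q3 (v (h a)) w"
            using Y_memE[OF fc_le[OF w(4) q2(2)] q2(1)] by blast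
          then show "\<exists>r\<in>P. le r q2 \<and> fc r (Mem w L)"
            using fc_Mem_cong1[OF q3(4) L_mem[OF h[OF q3(3)] q3(1)]] by blast
        qed
      qed
      have hom: "fc q (Homogeneous c Y green)"
      proof (rule fc_Homogeneous)
        fix s q1 x y
        assume s: "s \<in> Pn" and q1: "q1 \<in> P" "le q1 q"
          and xy: "x \<in> Pn" "y \<in> Pn" "fc q1 (Mem x Y)" "fc q1 (Mem y Y)" "fc q1 (Neg (Eq x y))" "fc q1 (UPair s x y)"
        obtain q2 i where q2: "q2 \<in> P" "le q2 q1" "i \<in> succ_field r" "feq q2 (v (h i)) x"
          using Y_memE[OF xy(3) q1(1)] by blast
        obtain q3 j where q3: "q3 \<in> P" "le q3 q2" "j \<in> succ_field r" "feq q3 (v (h j)) y"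
          using Y_memE[OF fc_le[OF xy(4) q2(2)] q2(1)] by blast
        have q31: "le q3 q1"
          using q3(2) q2(2) by (rule le_trans)
        have q3q: "le q3 q"
          using q31 q1(2) by (rule le_trans)
        note x = feq_le[OF q2(4) q3(2)]
        have "i \<noteq> j"
          using x q3(1,4) q31 xy(5) feq_sym feq_trans by (auto simp: forces.simps(3)) blast
        have s_eq: "feq q3 s (up (v (h i)) (v (h j)))"
          by (rule pair[OF s q3(1) fc_le[OF xy(6) q31] x q3(4)])
        \<comment> \<open>\<open>g\<close> is known only for pairs with the smaller index first,
          while the elements of \<open>s\<close> come in no order; \<open>sym\<close> settles the
          other case.\<close>
        have "fc q3 (Maps c (up (v (h i)) (v (h j))) green)"
          using succ_simps(4)[OF r q2(3) q3(3)] \<open>i \<noteq> j\<close>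
        proof (elim disjE)
          assume "succ_less r i j"
          then show ?thesis
            using less[OF q2(3) q3(3)] fc_le[OF _ q3q] by (auto simp: g_def)
        next
          assume "succ_less r j i"
          then have "fc q3 (Maps c (up (v (h j)) (v (h i))) green)"
            using less[OF q3(3) q2(3)] fc_le[OF _ q3q] by (auto simp: g_def)
          then show ?thesis
            by (rule respD[OF resp_Maps(1) q3(1) sym])
        qed simp
        then have "fc q3 (Maps c s green)"
          by (rule respD[OF resp_Maps(1) q3(1) feq_sym[OF s_eq]])
        then show "\<exists>r\<in>P. le r q1 \<and> fc r (Maps c s green)"
          using q3(1) q31 by blast
      qed
      have "fc q (Ex (\<lambda>y. Conj (Subset y L) (Conj (OrderType y Z) (Homogeneous c y green))))"
        unfolding fc_Ex forces.simps(4)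
        using sub otype hom by (intro dn_all bexI[OF _ Y_Pn]) (blast intro: fc_le)
      then show ?thesis
        using q by blast
    next
      assume "\<exists>q\<in>P. le q p2 \<and> (\<exists>C \<phi> pc. C \<subseteq> Field l \<and> (\<forall>x\<in>C. \<phi> x \<in> Field l \<and> pc x \<in> P) \<and>
         (\<forall>z\<in>Field l. \<forall>q'\<in>P. le q' q \<longrightarrow> (\<exists>x\<in>C. \<phi> x = z \<and> (\<exists>q''\<in>P. le q'' q' \<and> le q'' (pc x)))) \<and>
         (\<forall>x\<in>C. \<forall>y\<in>C. x \<in> underS l y \<longrightarrow> \<not> (\<exists>q\<in>P. le q (pc x) \<and> le q (pc y) \<and> g x y q)))"
      then obtain q C \<phi> pc where q: "q \<in> P" "le q p2" and C0: "C \<subseteq> Field l"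
        and \<phi>0: "\<forall>x\<in>C. \<phi> x \<in> Field l \<and> pc x \<in> P"
        and dense0: "\<forall>z\<in>Field l. \<forall>q'\<in>P. le q' q \<longrightarrow>
          (\<exists>x\<in>C. \<phi> x = z \<and> (\<exists>q''\<in>P. le q'' q' \<and> le q'' (pc x)))"
        and red0: "\<forall>x\<in>C. \<forall>y\<in>C. x \<in> underS l y \<longrightarrow> \<not> (\<exists>q\<in>P. le q (pc x) \<and> le q (pc y) \<and> g x y q)"
        by (elim bexE conjE exE) (rule that)
      note C = subsetD[OF C0]
      have \<phi>: "\<phi> x \<in> Field l" and pc: "pc x \<in> P" if "x \<in> C" for x
        using \<phi>0 that by blast+
      have dense: "\<exists>x\<in>C. \<phi> x = z \<and> (\<exists>q''\<in>P. le q'' q' \<and> le q'' (pc x))"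
        if "z \<in> Field l" "q' \<in> P" "le q' q" for z q'
        using dense0 that by blast
      have red: "\<not> g x y q" if "x \<in> C" "y \<in> C" "x \<in> underS l y" "q \<in> P" "le q (pc x)" "le q (pc y)" for x y q
        using red0 that by blast
      \<comment> \<open>\<open>sel x q'\<close>: \<open>q'\<close> puts the condition of \<open>x\<close> into the generic filter, and no condition of
        a smaller \<open>y\<close> in the same fibre of \<open>\<phi>\<close>; so each fibre has exactly one selected element.\<close>
      define sel where "sel x q' \<longleftrightarrow> le q' (pc x) \<and>
        (\<forall>y\<in>C. y \<in> underS l x \<and> \<phi> y = \<phi> x \<longrightarrow> \<not> (\<exists>q''\<in>P. le q'' q' \<and> le q'' (pc y)))" for x q'
      define S where "S = {(q', x). q' \<in> P \<and> x \<in> C \<and> sel x q'}"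
      have small: "|S| \<le>o |UNIV :: 'i set|"
      proof -
        have "|S| \<le>o |P \<times> C|"
          by (rule card_of_mono1) (auto simp: S_def)
        also have "|P \<times> C| \<le>o |UNIV :: 'i set|"
          by (rule card_of_Times_ordLeq_infinite_Field)
             (use C P_small in \<open>auto simp: Field_card_of infinite_i card_of_card_order_on
               intro: ordLeq_transitive[OF card_of_mono1 l(2)]\<close>)
        finally show ?thesis .
      qed
      define X where "X = mk_name ((\<lambda>(c, x). (c, v x)) ` S)"
      have X: "elems X = (\<lambda>(c, x). (c, v x)) ` S"
        unfolding X_def by (rule elems_mk_name) (rule ordLeq_transitive[OF card_of_image small])
      have X_Pn: "X \<in> Pn"
        by (rule P_names.intros) (auto simp: X S_def v_Pn)
      define G where "G = (\<lambda>(c, x). (c, x, \<phi> x)) ` S"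
      define f where "f = mk_name ((\<lambda>(c, x, y). (c, op (v x) (v y))) ` G)"
      have f: "elems f = (\<lambda>(c, x, y). (c, op (v x) (v y))) ` G"
        unfolding f_def G_def
        by (rule elems_mk_name) (rule ordLeq_transitive[OF card_of_image ordLeq_transitive[OF card_of_image small]])
      have f_Pn: "f \<in> Pn"
        by (rule P_names.intros) (auto simp: f G_def S_def intro!: op_Pn v_Pn)
      have X_memE: "\<exists>q'\<in>P. le q' q1 \<and> (\<exists>(d, a)\<in>S. le q' d \<and> feq q' (v a) w)"
        if *: "fc q1 (Mem w X)" "q1 \<in> P" for q1 w
      proof -
        obtain q' d s where q': "q' \<in> P" "le q' q1" "(d, s) \<in> elems X" "le q' d" "feq q' s w"
          using fc_MemE[OF * le_refl] .
        obtain a where "(d, a) \<in> S" "s = v a"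
          using q'(3) unfolding X by auto
        then show ?thesis
          using q' by blast
      qed
      have bij: "fc q (Bij f X L)"
      proof (rule fc_Bij[OF f _ q(1)])
        fix c i j assume "(c, i, j) \<in> G"
        then show "c \<in> P \<and> v i \<in> Pn \<and> v j \<in> Pn"
          by (auto simp: G_def S_def v_Pn)
      next
        fix q1 w assume "q1 \<in> P" "fc q1 (Mem w X)"
        then show "\<exists>r\<in>P. le r q1 \<and> (\<exists>(r', i, j)\<in>G. le r r' \<and> feq r (v i) w)"
          using X_memE unfolding G_def by fastforce
      next
        fix q1 w assume q1: "q1 \<in> P" "le q1 q" "fc q1 (Mem w L)"
        obtain q2 z where q2: "q2 \<in> P" "le q2 q1" "z \<in> Field l" "feq q2 (v z) w"
          using L_memE[OF q1(3,1)] by blast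
        \<comment> \<open>The least point of the fibre over \<open>z\<close> whose condition is
          compatible with \<open>q2\<close> can be selected below \<open>q2\<close>: smaller points
          of the fibre are incompatible with \<open>q2\<close>, hence with all its
          extensions.\<close>
        define K where "K = {x \<in> C. \<phi> x = z \<and> (\<exists>q''\<in>P. le q'' q2 \<and> le q'' (pc x))}"
        have "K \<noteq> {}"
          using dense[OF q2(3,1) le_trans[OF q2(2) q1(2)]] by (auto simp: K_def)
        then obtain x where x: "x \<in> K" "\<And>y. y \<in> underS l x \<Longrightarrow> y \<notin> K"
          using wfp_underS[OF l(1)] unfolding wfp_eq_minimal by blast
        then obtain q3 where q3: "q3 \<in> P" "le q3 q2" "le q3 (pc x)"
          by (auto simp: K_def)
        have "sel x q3"
          unfolding sel_def using q3 x le_trans[OF _ q3(2)] by (auto simp: K_def)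
        then have "(q3, x, z) \<in> G"
          using x(1) q3(1) by (force simp: G_def S_def K_def)
        then show "\<exists>r\<in>P. le r q1 \<and> (\<exists>(r', i, j)\<in>G. le r r' \<and> feq r (v j) w)"
          using q3 q2 feq_le[OF q2(4) q3(2)] le_trans[OF q3(2) q2(2)] le_refl by blast
      next
        fix q1 c i j assume *: "(c, i, j) \<in> G" "q1 \<in> P" "le q1 c"
        then have "(c, i) \<in> S" "j = \<phi> i"
          by (auto simp: G_def)
        then show "fc q1 (Mem (v i) X) \<and> fc q1 (Mem (v j) L)"
          using * by (intro conjI[OF fc_Mem_elem[of c] L_mem]) (auto simp: S_def X intro!: \<phi> image_eqI[of _ _ "(c, i)"])
      next
        fix q1 c i j c' i' j' assume *: "(c, i, j) \<in> G" "(c', i', j') \<in> G" "q1 \<in> P" "le q1 c" "le q1 c'"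
        then have ij: "i \<in> C" "i' \<in> C" "sel i c" "sel i' c'" "j = \<phi> i" "j' = \<phi> i'"
          by (auto simp: G_def S_def)
        have "i = i'" if "\<phi> i = \<phi> i'"
        proof (rule ccontr)
          assume "i \<noteq> i'"
          then consider "i \<in> underS l i'" | "i' \<in> underS l i"
            using wo_rel_underS_cases[OF l(1) C[OF ij(1)] C[OF ij(2)]] by blast
          then show False
            using ij(1-4) that *(3-5) le_trans[OF *(4)] le_trans[OF *(5)] unfolding sel_def
            by cases metis+
        qed
        then show "(feq q1 (v i) (v i') \<longrightarrow> j = j') \<and> (feq q1 (v j) (v j') \<longrightarrow> i = i')"
          using ij *(3) by (auto simp: v_eq C \<phi>)
      qed
      have sub: "fc q (Subset X L)"
        unfolding Subset_def fc_AllIn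
      proof (intro ballI impI)
        fix w q1 assume w: "w \<in> Pn" "q1 \<in> P" "le q1 q" "fc q1 (Mem w X)"
        show "fc q1 (Mem w L)"
        proof (rule fcI)
          fix q2 assume q2: "q2 \<in> P" "le q2 q1"
          obtain q3 d a where q3: "q3 \<in> P" "le q3 q2" "(d, a) \<in> S" "feq q3 (v a) w"
            using X_memE[OF fc_le[OF w(4) q2(2)] q2(1)] by blast
          then have "a \<in> Field l"
            by (auto simp: S_def C)
          then show "\<exists>r\<in>P. le r q2 \<and> fc r (Mem w L)"
            using q3(1,2) fc_Mem_cong1[OF q3(4) L_mem[OF _ q3(1)]] by blast
        qed
      qed
      have hom: "fc q (Homogeneous c X red)"
      proof (rule fc_Homogeneous)
        fix s q1 x y
        assume s: "s \<in> Pn" and q1: "q1 \<in> P" "le q1 q"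
          and xy: "x \<in> Pn" "y \<in> Pn" "fc q1 (Mem x X)" "fc q1 (Mem y X)" "fc q1 (Neg (Eq x y))" "fc q1 (UPair s x y)"
        have q1p1: "le q1 p1"
          using q1(2) q(2) p2(2) le_trans by blast
        obtain q2 d i where q2: "q2 \<in> P" "le q2 q1" "(d, i) \<in> S" "le q2 d" "feq q2 (v i) x"
          using X_memE[OF xy(3) q1(1)] by blast
        obtain q3 e j where q3: "q3 \<in> P" "le q3 q2" "(e, j) \<in> S" "le q3 e" "feq q3 (v j) y"
          using X_memE[OF fc_le[OF xy(4) q2(2)] q2(1)] by blast
        have q31: "le q3 q1"
          using q3(2) q2(2) by (rule le_trans)
        have q3p1: "le q3 p1"
          using q31 q1p1 by (rule le_trans)
        note x = feq_le[OF q2(5) q3(2)]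
        have ij: "i \<in> C" "j \<in> C" "le q3 (pc i)" "le q3 (pc j)"
          using q2(3) q3(3) le_trans[OF le_trans[OF q3(2) q2(4)]] le_trans[OF q3(4)]
          unfolding S_def sel_def by blast+
        have "i \<noteq> j"
          using x q3(1,5) q31 xy(5) feq_sym feq_trans by (auto simp: forces.simps(3)) blast
        have s_eq: "feq q3 s (up (v i) (v j))"
          by (rule pair[OF s q3(1) fc_le[OF xy(6) q31] x q3(5)])
        have mem_L: "fc q3 (Mem x L)" "fc q3 (Mem y L)"
          using sub xy(1-4) q1 fc_le[OF _ q31] unfolding Subset_def fc_AllIn by blast+
        have "fc q3 (Mem s dd)"
          by (rule PairsI[OF dd s q3(1) q3p1 xy(1,2) mem_L fc_le[OF xy(5) q31] fc_le[OF xy(6) q31]])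
        then have "fc q3 (ExIn cols (\<lambda>y. Conj (Maps c s y) (All (\<lambda>y'. Impl (Maps c s y') (Eq y' y)))))"
          using fn s q3(1) q3p1 unfolding Fun_def forces.simps(4) fc_AllIn by blast
        then obtain q4 k where q4: "q4 \<in> P" "le q4 q3" "k \<in> Pn" "fc q4 (Mem k cols)" "fc q4 (Maps c s k)"
          using q3(1) unfolding fc_ExIn forces.simps(4) by (elim dnE[OF _ _ le_refl]) blast+
        have q4p1: "le q4 p1"
          using q4(2) q3p1 by (rule le_trans)
        obtain q5 where q5: "q5 \<in> P" "le q5 q4" "feq q5 k red \<or> feq q5 k green"
          using UPair_MemE[OF cols q4(3,4,1) q4p1] .
        have q53: "le q5 q3"
          using q5(2) q4(2) by (rule le_trans)
        \<comment> \<open>The colour of \<open>s\<close> is red or green, and green is impossible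
          below the conditions of \<open>i\<close> and \<open>j\<close>, whichever of the two is
          smaller.\<close>
        have "\<not> feq q5 k green"
        proof
          assume "feq q5 k green"
          then have *: "fc q5 (Maps c s green)"
            using respD[OF resp_Maps(2) q5(1)] fc_le[OF q4(5) q5(2)] by blast
          have **: "fc q5 (Maps c (up (v i) (v j)) green)"
            by (rule respD[OF resp_Maps(1) q5(1) feq_le[OF s_eq q53] *])
          then have "fc q5 (Maps c (up (v j) (v i)) green)"
            by (rule respD[OF resp_Maps(1) q5(1) sym])
          with ** show False
            using wo_rel_underS_cases[OF l(1) C[OF ij(1)] C[OF ij(2)]] \<open>i \<noteq> j\<close>
              red[OF ij(1,2) _ q5(1) le_trans[OF q53 ij(3)] le_trans[OF q53 ij(4)]]
              red[OF ij(2,1) _ q5(1) le_trans[OF q53 ij(4)] le_trans[OF q53 ij(3)]]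
            unfolding g_def by blast
        qed
        then have "fc q5 (Maps c s red)"
          using q5(3) respD[OF resp_Maps(2) q5(1)] fc_le[OF q4(5) q5(2)] by blast
        then show "\<exists>r\<in>P. le r q1 \<and> fc r (Maps c s red)"
          using q5(1) le_trans[OF q53 q31] by blast
      qed
      have equi: "fc q (Equinumerous X L)"
        unfolding Equinumerous_def fc_Ex
        using bij by (intro dn_all bexI[OF _ f_Pn]) (blast intro: fc_le)
      have "fc q (Ex (\<lambda>x. Conj (Subset x L) (Conj (Equinumerous x L) (Homogeneous c x red))))"
        unfolding fc_Ex forces.simps(4)
        using sub equi hom by (intro dn_all bexI[OF _ X_Pn]) (blast intro: fc_le)
      then show ?thesis
        using q by blast
    qed
  qed
  show ?thesis
    unfolding Arrow_def forces.simps(5) fc_Impl forces.simps(4)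
    unfolding L_def[symmetric] Z_def[symmetric]
    by (intro ballI impI goal) blast+
qed

end

section \<open>Partition trees\<close>

lemma underS_subset: "Well_order r \<Longrightarrow> a \<in> underS r b \<Longrightarrow> underS r a \<subseteq> underS r b"
  using underS_trans by fast

text \<open>The tree argument of Erdos and Rado. A node is a sequence of pairs of a point and a
  condition, of length below \<open>th\<close>; each node gets a greedily chosen red set of
  continuations. If all red sets are smaller than \<open>r\<close>, then by regularity and
  \<open>seqs\<close> so is the union of the red sets of all nodes, and some \<open>x\<close> in
  \<open>A\<close> is never chosen. That \<open>x\<close> is rejected at a node means that a point
  chosen there before can be made green with it. Following these witnesses through \<open>th\<close>
  levels, with \<open>closed\<close> at limits, gives a green sequence with \<open>x\<close> on top.
  The lemma is used with Cohen conditions inside a block and with a trivial condition for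
  \<kappa>.\<close>

lemma ramsey_tree:
  fixes th :: "'a rel" and W :: "'x rel" and r :: "'k rel" and P :: "'p set"
  assumes th: "Well_order th"
    and r: "Cinfinite r" "regularCard r"
    and th_small: "|Field th| <o r"
    and seqs: "\<And>Lab :: ('x \<times> 'p) set. |Lab| <o r \<Longrightarrow>
      |{f. (\<exists>b\<in>Field th. dom f = underS th b) \<and> ran f \<subseteq> Lab}| <o r"
    and W: "Well_order W" and A: "A \<subseteq> Field W" "\<not> |A| <o r"
    and le_refl: "\<And>p. le p p" and le_trans: "\<And>p q s. le p q \<Longrightarrow> le q s \<Longrightarrow> le p s"
    and closed: "\<And>B h p. B \<subseteq> Field th \<Longrightarrow> (\<And>b. b \<in> B \<Longrightarrow> h b \<in> P) \<Longrightarrow>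
      (\<And>b c. b \<in> B \<Longrightarrow> c \<in> B \<Longrightarrow> b \<in> underS th c \<Longrightarrow> le (h c) (h b)) \<Longrightarrow> p \<in> P \<Longrightarrow>
      (\<And>b. b \<in> B \<Longrightarrow> le (h b) p) \<Longrightarrow> \<exists>q\<in>P. le q p \<and> (\<forall>b\<in>B. le q (h b))"
    and p0: "\<And>x. x \<in> A \<Longrightarrow> p0 x \<in> P"
    and g_mono: "\<And>x y p q. g x y p \<Longrightarrow> q \<in> P \<Longrightarrow> le q p \<Longrightarrow> g x y q"
  shows "(\<exists>h. \<exists>q\<in>P. (\<forall>x\<in>succ_field th. h x \<in> A \<and> le q (p0 (h x))) \<and>
      (\<forall>x\<in>succ_field th. \<forall>y\<in>succ_field th. succ_less th x y \<longrightarrow> h x \<in> underS W (h y) \<and> g (h x) (h y) q)) \<or>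
    (\<exists>Z p. Z \<subseteq> A \<and> \<not> |Z| <o r \<and> (\<forall>x\<in>Z. p x \<in> P \<and> le (p x) (p0 x)) \<and>
      (\<forall>x\<in>Z. \<forall>y\<in>Z. x \<in> underS W y \<longrightarrow> \<not> (\<exists>q\<in>P. le q (p x) \<and> le q (p y) \<and> g x y q)))"
proof (rule disjCI)
  define comp where "comp x p y p' \<longleftrightarrow> (\<exists>q\<in>P. le q p \<and> le q p' \<and> g x y q)" for x p y p'
  \<comment> \<open>\<open>T f x p\<close>: with condition \<open>p\<close> the point
    \<open>x\<close> may follow the node \<open>f\<close>, as \<open>p\<close> extends the
    conditions in \<open>f\<close> and makes \<open>x\<close> green with all its points.\<close>
  define T where "T f x p \<longleftrightarrow> p \<in> P \<and> le p (p0 x) \<and>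
    (\<forall>b y p'. f b = Some (y, p') \<longrightarrow> y \<in> underS W x \<and> le p p' \<and> g y x p)" for f :: "'a \<rightharpoonup> 'x \<times> 'p" and x p
  assume "\<not> (\<exists>Z p. Z \<subseteq> A \<and> \<not> |Z| <o r \<and> (\<forall>x\<in>Z. p x \<in> P \<and> le (p x) (p0 x)) \<and>
      (\<forall>x\<in>Z. \<forall>y\<in>Z. x \<in> underS W y \<longrightarrow> \<not> (\<exists>q\<in>P. le q (p x) \<and> le q (p y) \<and> g x y q)))"
  then have no_red: "|Z| <o r" if "Z \<subseteq> A" "\<And>x. x \<in> Z \<Longrightarrow> p x \<in> P \<and> le (p x) (p0 x)"
      "\<And>x y. x \<in> Z \<Longrightarrow> y \<in> Z \<Longrightarrow> x \<in> underS W y \<Longrightarrow> \<not> comp x (p x) y (p y)" for Z p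
    using that unfolding comp_def by blast
  \<comment> \<open>\<open>Z f\<close> is the greedily chosen red set of points that continue the green sequence \<open>f\<close>.\<close>
  define greedy where "greedy f Z x v \<longleftrightarrow> (case v of
      Some p \<Rightarrow> T f x p \<and> (\<forall>y\<in>underS W x \<inter> A. \<forall>p'. Z y = Some p' \<longrightarrow> \<not> comp y p' x p)
    | None \<Rightarrow> (\<forall>p. T f x p \<longrightarrow> (\<exists>y\<in>underS W x \<inter> A. \<exists>p'. Z y = Some p' \<and> comp y p' x p)))"
    for f x v and Z :: "'x \<rightharpoonup> 'p"
  have "\<exists>Z. \<forall>x. greedy f Z x (Z x)" for f
  proof (rule dependent_wf_choice)
    show "wf {(y, x). y \<in> underS W x}"
      using wfp_underS[OF W] by (simp add: wfp_def)
    show "greedy f Z x v = greedy f Z' x v" if "\<And>y. (y, x) \<in> {(y, x). y \<in> underS W x} \<Longrightarrow> Z y = Z' y" for Z Z' x v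
      using that by (auto simp: greedy_def split: option.splits)
    show "\<exists>v. greedy f Z x v" for x Z
    proof (cases "\<exists>p. T f x p \<and> (\<forall>y\<in>underS W x \<inter> A. \<forall>p'. Z y = Some p' \<longrightarrow> \<not> comp y p' x p)")
      case True
      then obtain p where "greedy f Z x (Some p)"
        by (auto simp: greedy_def)
      then show ?thesis ..
    next
      case False
      then have "greedy f Z x None"
        by (auto simp: greedy_def)
      then show ?thesis ..
    qed
  qed
  then obtain Z where Z: "\<And>f x. greedy f (Z f) x (Z f x)"
    by metis
  have Z_Some: "T f x p" if "Z f x = Some p" for f x p
    using Z[of f x] that by (simp add: greedy_def)
  have Z_red: "\<not> comp y p' x p" if "Z f x = Some p" "Z f y = Some p'" "y \<in> underS W x" "y \<in> A" for f x y p p'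
    using Z[of f x] that by (simp add: greedy_def)
  have Z_None: "\<exists>y p'. y \<in> underS W x \<and> y \<in> A \<and> Z f y = Some p' \<and> comp y p' x p"
    if "Z f x = None" "T f x p" for f x p
    using Z[of f x] that unfolding greedy_def by fastforce
  define D where "D f = {x \<in> A. Z f x \<noteq> None}" for f
  have D_small: "|D f| <o r" for f
    by (rule no_red[of _ "\<lambda>x. the (Z f x)"]) (use Z_Some Z_red in \<open>auto simp: D_def T_def\<close>)
  \<comment> \<open>Level \<open>b\<close> of the tree: every entry of \<open>f\<close> is taken
    from the red set of the initial segment of \<open>f\<close> before it.\<close>
  define N where "N b = {f. dom f = underS th b \<and>
      (\<forall>c\<in>underS th b. \<exists>x p. f c = Some (x, p) \<and> x \<in> A \<and> Z (f |` underS th c) x = Some p)}" for b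
  have N_small: "|N b| <o r" if "b \<in> Field th" for b
    using that
  proof (induction b rule: wfp_induct_rule[OF wfp_underS[OF th]])
    case (1 b)
    \<comment> \<open>The entries of the nodes of level \<open>b\<close> come from the red sets of
      lower levels, which are few by induction.\<close>
    define Lab where "Lab = (\<Union>c\<in>underS th b. \<Union>f\<in>N c. (\<lambda>x. (x, the (Z f x))) ` D f)"
    have sub: "underS th b \<subseteq> Field th"
      by (auto simp: underS_def Field_def)
    have "|Lab| <o r"
      unfolding Lab_def
    proof (intro card_of_UNION_ordLess_infinite_Field_regularCard[OF r(2,1)] ballI)
      show "|underS th b| <o r"
        by (rule ordLeq_ordLess_trans[OF card_of_mono1[OF sub] th_small])
      show "|N c| <o r" if "c \<in> underS th b" for c
        using 1 that sub by blast
      show "|(\<lambda>x. (x, the (Z f x))) ` D f| <o r" for f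
        by (rule ordLeq_ordLess_trans[OF card_of_image D_small])
    qed
    from seqs[OF this] have small: "|{f. (\<exists>b\<in>Field th. dom f = underS th b) \<and> ran f \<subseteq> Lab}| <o r" .
    have "N b \<subseteq> {f. (\<exists>b\<in>Field th. dom f = underS th b) \<and> ran f \<subseteq> Lab}"
    proof safe
      fix f assume f: "f \<in> N b"
      then show "\<exists>b\<in>Field th. dom f = underS th b"
        using 1(2) by (auto simp: N_def)
      fix x p assume "(x, p) \<in> ran f"
      then obtain c where c: "f c = Some (x, p)"
        by (auto simp: ran_def)
      then have cb: "c \<in> underS th b"
        using f by (auto simp: N_def)
      then have xp: "x \<in> A" "Z (f |` underS th c) x = Some p"
        using f c by (force simp: N_def)+
      have "f |` underS th c \<in> N c"
      proof -
        have "f |` underS th c |` underS th e = f |` underS th e" if "e \<in> underS th c" for e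
          using underS_subset[OF th that] by (simp add: Int_absorb1)
        moreover have "dom (f |` underS th c) = underS th c"
          using f underS_subset[OF th cb] by (auto simp: N_def)
        ultimately show ?thesis
          using f underS_subset[OF th cb] by (auto simp: N_def subset_iff)
      qed
      then show "(x, p) \<in> Lab"
        unfolding Lab_def using cb xp by (force simp: D_def)
    qed
    then show ?case
      by (rule ordLeq_ordLess_trans[OF card_of_mono1 small])
  qed
  have "|\<Union>b\<in>Field th. \<Union>f\<in>N b. D f| <o r"
    by (intro card_of_UNION_ordLess_infinite_Field_regularCard[OF r(2,1)] ballI th_small N_small D_small)
  then have "\<not> A \<subseteq> (\<Union>b\<in>Field th. \<Union>f\<in>N b. D f)"
    using A(2) card_of_mono1 ordLeq_ordLess_trans by blast
  then obtain x where xA: "x \<in> A" and "x \<notin> (\<Union>b\<in>Field th. \<Union>f\<in>N b. D f)"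
    by blast
  then have "Z f x = None" if "b \<in> Field th" "f \<in> N b" for b f
    using that by (auto simp: D_def)
  note x = xA this
  define node where "node h b = (\<lambda>c. if c \<in> underS th b then Some (fst (h c)) else None)"
    for h :: "'a \<Rightarrow> ('x \<times> 'p) \<times> 'p" and b
  \<comment> \<open>The state \<open>((y, p), q)\<close> at level \<open>b\<close> consists of the
    next entry \<open>(y, p)\<close> of the branch and a condition \<open>q\<close> for
    \<open>x\<close>, which extends \<open>p\<close> and all earlier conditions for \<open>x\<close>
    and makes {y, x} green.\<close>
  define step where "step h b v \<longleftrightarrow> (b \<in> Field th \<longrightarrow> (case v of ((y, p), q) \<Rightarrow>
      y \<in> A \<and> y \<in> underS W x \<and> Z (node h b) y = Some p \<and> q \<in> P \<and> le q p \<and> le q (p0 x) \<and> g y x q \<and>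
      (\<forall>c\<in>underS th b. le q (snd (h c)))))"
    for h b and v :: "('x \<times> 'p) \<times> 'p"
  have "\<exists>h. \<forall>b. step h b (h b)"
  proof (rule dependent_wf_choice)
    show "wf {(c, b). c \<in> underS th b}"
      using wfp_underS[OF th] by (simp add: wfp_def)
    show "step h b v = step h' b v" if "\<And>c. (c, b) \<in> {(c, b). c \<in> underS th b} \<Longrightarrow> h c = h' c" for h h' b v
    proof -
      have "node h b = node h' b"
        using that by (auto simp: node_def)
      then show ?thesis
        using that by (auto simp: step_def)
    qed
    show "\<exists>v. step h b v" if prev: "\<And>c. (c, b) \<in> {(c, b). c \<in> underS th b} \<Longrightarrow> step h c (h c)" for b h
    proof (cases "b \<in> Field th")
      case True
      have sub: "underS th b \<subseteq> Field th"
        by (auto simp: underS_def Field_def)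
      have st: "fst (fst (h c)) \<in> A \<and> fst (fst (h c)) \<in> underS W x \<and>
          Z (node h c) (fst (fst (h c))) = Some (snd (fst (h c))) \<and> snd (h c) \<in> P \<and>
          le (snd (h c)) (snd (fst (h c))) \<and> le (snd (h c)) (p0 x) \<and> g (fst (fst (h c))) x (snd (h c)) \<and>
          (\<forall>e\<in>underS th c. le (snd (h c)) (snd (h e)))"
        if "c \<in> underS th b" for c
        using prev[of c] that sub by (auto simp: step_def case_prod_beta)
      obtain q where q: "q \<in> P" "le q (p0 x)" "\<And>c. c \<in> underS th b \<Longrightarrow> le q (snd (h c))"
        using closed[of "underS th b" "\<lambda>c. snd (h c)" "p0 x"] st sub p0[OF x(1)] by blast
      have "node h b \<in> N b"
      proof -
        have "node h b |` underS th c = node h c" if "c \<in> underS th b" for c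
          using underS_subset[OF th that] by (auto simp: node_def restrict_map_def fun_eq_iff)
        moreover have "dom (node h b) = underS th b"
          by (auto simp: node_def split: if_splits)
        moreover have "\<exists>y p. node h b c = Some (y, p) \<and> y \<in> A \<and> Z (node h c) y = Some p"
          if "c \<in> underS th b" for c
          using st[OF that] that by (cases "fst (h c)") (simp add: node_def)
        ultimately show ?thesis
          by (simp add: N_def)
      qed
      \<comment> \<open>\<open>x\<close> is not chosen at this node although it is admissible with
        \<open>q\<close>; the greedy choice then provides the witness \<open>y\<close>.\<close>
      then have "Z (node h b) x = None"
        by (rule x(2)[OF True])
      moreover have "T (node h b) x q"
        unfolding T_def
      proof (intro conjI allI impI q(1,2))
        fix c y p assume "node h b c = Some (y, p)"
        then have c: "c \<in> underS th b" "fst (h c) = (y, p)"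
          by (auto simp: node_def split: if_splits)
        show "y \<in> underS W x" "g y x q" "le q p"
          using st[OF c(1)] c(2) g_mono[OF _ q(1) q(3)[OF c(1)]] le_trans[OF q(3)[OF c(1)]] by auto
      qed
      ultimately obtain y p' where y: "y \<in> underS W x" "y \<in> A" "Z (node h b) y = Some p'" "comp y p' x q"
        using Z_None by blast
      then obtain q' where "q' \<in> P" "le q' p'" "le q' q" "g y x q'"
        by (auto simp: comp_def)
      moreover from this have "le q' (p0 x)" "\<And>c. c \<in> underS th b \<Longrightarrow> le q' (snd (h c))"
        using le_trans[OF _ q(2)] le_trans[OF _ q(3)] by blast+
      ultimately have "step h b ((y, p'), q')"
        using y by (simp add: step_def)
      then show ?thesis ..
    qed (auto simp: step_def)
  qed
  then obtain h where h: "\<And>b. step h b (h b)"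
    by blast
  define pt where "pt b = fst (fst (h b))" for b
  define cn where "cn b = snd (fst (h b))" for b
  define cx where "cx b = snd (h b)" for b
  have st: "pt b \<in> A \<and> pt b \<in> underS W x \<and> Z (node h b) (pt b) = Some (cn b) \<and> cx b \<in> P \<and>
      le (cx b) (cn b) \<and> le (cx b) (p0 x) \<and> g (pt b) x (cx b) \<and> (\<forall>c\<in>underS th b. le (cx b) (cx c))"
    if "b \<in> Field th" for b
    using h[of b] that by (auto simp: step_def case_prod_beta pt_def cn_def cx_def)
  obtain q where q: "q \<in> P" "le q (p0 x)" "\<And>b. b \<in> Field th \<Longrightarrow> le q (cx b)"
    using closed[of "Field th" cx "p0 x"] st p0[OF x(1)] by blast
  have T: "T (node h b) (pt b) (cn b)" if "b \<in> Field th" for b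
    using st[OF that] Z_Some by blast
  \<comment> \<open>The branch has length \<theta>; the additional last point, of index
    \<open>None\<close>, is \<open>x\<close> itself.\<close>
  define hh where "hh = case_option x pt"
  have le_cn: "le q (cn b)" if "b \<in> Field th" for b
    by (rule le_trans[OF q(3)[OF that]]) (use st[OF that] in blast)
  have "le q (p0 (pt b))" if "b \<in> Field th" for b
    using that le_cn[OF that] T[OF that] le_trans[of q "cn b"] by (simp add: T_def)
  then have "\<forall>y\<in>succ_field th. hh y \<in> A \<and> le q (p0 (hh y))"
    using x(1) q(2) st by (auto simp: succ_field_def hh_def)
  moreover have "hh y \<in> underS W (hh z) \<and> g (hh y) (hh z) q"
    if yz: "y \<in> succ_field th" "z \<in> succ_field th" "succ_less th y z" for y z
  proof -
    obtain c where c: "y = Some c" "c \<in> Field th"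
      using yz by (auto simp: succ_field_def succ_less_def)
    show ?thesis
    proof (cases z)
      case None
      then show ?thesis
        using st[OF c(2)] q(3)[OF c(2)] g_mono q(1) by (auto simp: hh_def c)
    next
      case (Some b)
      then have b: "b \<in> Field th" "c \<in> underS th b"
        using yz by (auto simp: succ_field_def succ_less_def c)
      then have "node h b c = Some (pt c, cn c)"
        by (simp add: node_def pt_def cn_def)
      then have "pt c \<in> underS W (pt b) \<and> g (pt c) (pt b) (cn b)"
        using T[OF b(1)] unfolding T_def by blast
      then show ?thesis
        using g_mono[OF _ q(1) le_cn[OF b(1)]] by (simp add: hh_def c Some)
    qed
  qed
  ultimately show "\<exists>h. \<exists>q\<in>P. (\<forall>x\<in>succ_field th. h x \<in> A \<and> le q (p0 (h x))) \<and>
      (\<forall>x\<in>succ_field th. \<forall>y\<in>succ_field th. succ_less th x y \<longrightarrow> h x \<in> underS W (h y) \<and> g (h x) (h y) q)"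
    using q(1) by blast
qed

section \<open>Uniformization of large families\<close>

lemma not_card_less: "\<not> |A| <o |B| \<longleftrightarrow> |B| \<le>o |A|"
  by (simp add: card_of_Well_order not_ordLess_iff_ordLeq)

lemma card_of_Pow_mono:
  assumes "|A| \<le>o |B|"
  shows "|Pow A| \<le>o |Pow B|"
proof -
  obtain f where f: "inj_on f A" "f ` A \<subseteq> B"
    using assms card_of_ordLeq[of A B] by auto
  have "inj_on ((`) f) (Pow A)"
    using f(1) by (rule inj_on_image_Pow)
  moreover have "(`) f ` Pow A \<subseteq> Pow B"
    using f(2) by auto
  ultimately show ?thesis
    using card_of_ordLeq by blast
qed

lemma card_of_Times_le:
  assumes "infinite C" "|A| \<le>o |C|" "|B| \<le>o |C|"
  shows "|A \<times> B| \<le>o |C|"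
  by (rule card_of_Times_ordLeq_infinite_Field)
     (use assms in \<open>auto simp: Field_card_of card_of_card_order_on\<close>)

lemma card_of_Un_le:
  assumes "infinite C" "|A| \<le>o |C|" "|B| \<le>o |C|"
  shows "|A \<union> B| \<le>o |C|"
  by (rule card_of_Un_ordLeq_infinite_Field)
     (use assms in \<open>auto simp: Field_card_of card_of_card_order_on\<close>)

lemma infinite_Pow: "infinite T \<Longrightarrow> infinite (Pow T)"
  by simp

lemma card_le_Pow: "|A| \<le>o |T| \<Longrightarrow> |A| \<le>o |Pow T|"
  using ordLeq_transitive ordLess_imp_ordLeq[OF card_of_Pow] by blast

text \<open>The map \<open>j\<close> turns points of \<open>X\<close> into subsets of
  \<open>T\<close>, so an enumeration of \<open>r\<close> along \<open>T\<close> becomes a subset of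
  \<open>T \<times> T\<close>, from which \<open>r\<close> is recovered section by section.\<close>

lemma card_small_subsets:
  fixes T :: "'t set" and X :: "'m set"
  assumes T: "infinite T" and X: "|X| \<le>o |Pow T|"
  shows "|{r. r \<subseteq> X \<and> |r| \<le>o |T|}| \<le>o |Pow T|"
proof -
  obtain j where j: "inj_on j X" "j ` X \<subseteq> Pow T"
    using X card_of_ordLeq[of X "Pow T"] by auto
  have "\<exists>e. e ` T = r" if "r \<noteq> {}" "|r| \<le>o |T|" for r :: "'m set"
    using card_of_ordLeq2[OF that(1)] that(2) by blast
  then obtain e where e: "\<And>r :: 'm set. r \<noteq> {} \<Longrightarrow> |r| \<le>o |T| \<Longrightarrow> e r ` T = r"
    by metis
  define code where "code r = (SIGMA t:T. j (e r t))" for r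
  let ?S = "{r. r \<subseteq> X \<and> |r| \<le>o |T| \<and> r \<noteq> {}}"
  have "inj_on code ?S"
  proof (rule inj_onI)
    fix r r' assume r: "r \<in> ?S" and r': "r' \<in> ?S" and eq: "code r = code r'"
    have "j ` r = (\<lambda>t. code r `` {t}) ` T"
      unfolding code_def by (subst e[symmetric]) (use r in \<open>auto simp: image_iff\<close>)
    moreover have "j ` r' = (\<lambda>t. code r' `` {t}) ` T"
      unfolding code_def by (subst e[symmetric]) (use r' in \<open>auto simp: image_iff\<close>)
    ultimately have "j ` r = j ` r'"
      using eq by simp
    then show "r = r'"
      using inj_on_image_eq_iff[OF j(1)] r r' by blast
  qed
  moreover have "code ` ?S \<subseteq> Pow (T \<times> T)"
  proof (intro image_subsetI PowI)
    fix r assume r: "r \<in> ?S"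
    have "j (e r t) \<subseteq> T" if "t \<in> T" for t
    proof -
      have "e r t \<in> e r ` T"
        using that by blast
      then have "e r t \<in> X"
        using e[of r] r by auto
      then show ?thesis
        using j(2) by blast
    qed
    then show "code r \<subseteq> T \<times> T"
      by (auto simp: code_def)
  qed
  ultimately have "|?S| \<le>o |Pow (T \<times> T)|"
    using card_of_ordLeq by blast
  also have "|Pow (T \<times> T)| \<le>o |Pow T|"
    by (intro card_of_Pow_mono card_of_Times_le T card_of_refl[THEN ordIso_imp_ordLeq])
  finally have le: "|?S| \<le>o |Pow T|" .
  \<comment> \<open>The empty set is not the image of \<open>T\<close> under an enumeration and is
    added separately.\<close>
  have "|?S \<union> {{}}| \<le>o |Pow T|"
    by (rule card_of_Un_le[OF _ le finite_ordLeq_infinite]) (use T in auto)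
  then show ?thesis
    by (rule ordLeq_transitive[OF card_of_mono1, rotated]) auto
qed

lemma pigeonhole_large:
  assumes X: "infinite X" and B: "|X| <o |B|" and f: "|f ` B| \<le>o |X|"
  obtains y where "|X| <o |{x \<in> B. f x = y}|"
proof (rule ccontr)
  assume "\<not> thesis"
  then have "|{x \<in> B. f x = y}| \<le>o |X|" for y
    using that not_card_less by blast
  then have "|\<Union>y\<in>f ` B. {x \<in> B. f x = y}| \<le>o |X|"
    by (intro card_of_UNION_ordLeq_infinite[OF X f] ballI)
  moreover have "(\<Union>y\<in>f ` B. {x \<in> B. f x = y}) = B"
    by auto
  ultimately show False
    using B not_card_less by metis
qed

text \<open>The closure is reached after |T|^+ rounds: by regularity of |T|^+, a subset of size at
  most |T| of the union is contained in an earlier stage, and the next stage contains its value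
  under \<open>F\<close>. The size stays below 2^|T|, or equal to it, because |T|^+ is at most
  2^|T|.\<close>

lemma closure_exists:
  fixes T :: "'t set" and F :: "'m set \<Rightarrow> 'm set"
  assumes T: "infinite T" and F: "\<And>r. |r| \<le>o |T| \<Longrightarrow> |F r| \<le>o |Pow T|"
  obtains C where "|C| \<le>o |Pow T|" "\<And>r. r \<subseteq> C \<Longrightarrow> |r| \<le>o |T| \<Longrightarrow> F r \<subseteq> C"
proof -
  define W where "W = cardSuc |T|"
  have CT: "Card_order |T|" "infinite (Field |T| )"
    using T by (simp_all add: Field_card_of card_of_card_order_on)
  have W: "Well_order W" "Card_order W" "infinite (Field W)"
    unfolding W_def using cardSuc_Card_order[OF CT(1)] CT cardSuc_finite[OF CT(1)] cardSuc_Well_order by auto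
  define next_set where "next_set D = D \<union> \<Union> (F ` {r. r \<subseteq> D \<and> |r| \<le>o |T|})" for D
  have "\<exists>D. \<forall>b. D b = (\<Union>c\<in>underS W b. next_set (D c))"
  proof (rule dependent_wf_choice)
    show "wf {(c, b). c \<in> underS W b}"
      using wfp_underS[OF W(1)] by (simp add: wfp_def)
  qed auto
  then obtain D where D: "\<And>b. D b = (\<Union>c\<in>underS W b. next_set (D c))"
    by blast
  have inf: "infinite (Pow T)"
    using T by simp
  have next_le: "|next_set X| \<le>o |Pow T|" if "|X| \<le>o |Pow T|" for X
    unfolding next_set_def
    by (intro card_of_Un_le inf that card_of_UNION_ordLeq_infinite card_small_subsets T) (auto intro: F)
  have D_le: "|D b| \<le>o |Pow T|" for b
  proof (induction b rule: wfp_induct_rule[OF wfp_underS[OF W(1)]])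
    case (1 b)
    have "|underS W b| \<le>o |T|"
    proof (cases "b \<in> Field W")
      case True
      then have "|underS W b| <o W"
        using W by (intro card_of_underS)
      then show ?thesis
        unfolding W_def by (simp add: cardSuc_ordLeq_ordLess[OF CT(1) card_of_Card_order])
    next
      case False
      then have "underS W b = {}"
        by (auto simp: underS_def Field_def)
      then show ?thesis
        by (simp add: card_of_empty)
    qed
    then show ?case
      by (subst D, intro card_of_UNION_ordLeq_infinite inf card_le_Pow) (auto intro: next_le 1)
  qed
  have "W =o |Field W|"
    using W(2) card_of_Field_ordIso ordIso_symmetric by blast
  moreover have "W \<le>o |Pow T|"
    unfolding W_def by (rule cardSuc_least[OF CT(1) card_of_Card_order card_of_Pow])
  ultimately have "|Field W| \<le>o |Pow T|"
    using ordIso_ordLeq_trans ordIso_symmetric by blast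
  then have small: "|\<Union>b\<in>Field W. D b| \<le>o |Pow T|"
    by (intro card_of_UNION_ordLeq_infinite inf) (auto intro: D_le)
  have chain: "relChain W D"
    unfolding relChain_def
  proof (intro allI impI)
    fix b c assume bc: "(b, c) \<in> W"
    show "D b \<subseteq> D c"
    proof (cases "b = c")
      case False
      then have "b \<in> underS W c"
        using bc by (simp add: underS_def)
      then show ?thesis
        by (subst (2) D) (auto simp: next_set_def)
    qed simp
  qed
  have "F r \<subseteq> (\<Union>b\<in>Field W. D b)" if r: "r \<subseteq> (\<Union>b\<in>Field W. D b)" "|r| \<le>o |T|" for r
  proof -
    obtain b where b: "b \<in> Field W" "r \<subseteq> D b"
      using cardSuc_UNION[OF CT chain[unfolded W_def] r(1)[unfolded W_def] r(2)] unfolding W_def by blast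
    obtain c where c: "c \<in> Field W" "b \<noteq> c" "(b, c) \<in> W"
      using infinite_Card_order_limit[OF W(2,3) b(1)] by blast
    have "F r \<subseteq> next_set (D b)"
      unfolding next_set_def using b(2) r(2) by blast
    also have "\<dots> \<subseteq> D c"
      by (subst (2) D) (use c in \<open>auto simp: underS_def\<close>)
    finally show ?thesis
      using c(1) by blast
  qed
  with small that show thesis
    by blast
qed

text \<open>For every \<open>R\<close> take a maximal family \<open>Z R\<close> with pairwise
  intersections \<open>R\<close>. If none is large, there is a \<open>C\<close> of size at most
  2^|T| that contains the union of the sets of \<open>Z r\<close> for each small
  \<open>r \<subseteq> C\<close>, and some \<open>x\<close> outside all these \<open>Z r\<close>.
  With \<open>r = S x \<inter> C\<close>, the set \<open>S x\<close> meets the sets of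
  \<open>Z r\<close>, which lie in \<open>C\<close>, exactly in \<open>r\<close>; so
  \<open>x\<close> could be added to \<open>Z r\<close>.\<close>

lemma delta_system:
  fixes T :: "'t set" and S :: "'x \<Rightarrow> 'm set"
  assumes T: "infinite T" and B: "|Pow T| <o |B|" and S: "\<And>x. x \<in> B \<Longrightarrow> |S x| \<le>o |T|"
  obtains R B' where "B' \<subseteq> B" "|Pow T| <o |B'|" "\<forall>x\<in>B'. \<forall>y\<in>B'. x \<noteq> y \<longrightarrow> S x \<inter> S y = R"
proof (rule ccontr)
  note result = that
  assume neg: "\<not> thesis"
  define adm where "adm R = {Z. Z \<subseteq> {x \<in> B. R \<subseteq> S x} \<and> (\<forall>x\<in>Z. \<forall>y\<in>Z. x \<noteq> y \<longrightarrow> S x \<inter> S y = R)}" for R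
  have adm_small: "|Z| \<le>o |Pow T|" if Z: "Z \<in> adm R" for Z R
  proof (rule ccontr)
    assume "\<not> |Z| \<le>o |Pow T|"
    then have large: "|Pow T| <o |Z|"
      using not_card_less by blast
    have "Z \<subseteq> B" "\<forall>x\<in>Z. \<forall>y\<in>Z. x \<noteq> y \<longrightarrow> S x \<inter> S y = R"
      using Z unfolding adm_def by blast+
    from result[OF this(1) large this(2)] neg show False
      by blast
  qed
  have "\<exists>M\<in>adm R. \<forall>X\<in>adm R. M \<subseteq> X \<longrightarrow> X = M" for R
  proof (rule subset_Zorn_nonempty)
    show "adm R \<noteq> {}"
      unfolding adm_def by blast
    fix C assume C: "C \<noteq> {}" "subset.chain (adm R) C"
    show "\<Union>C \<in> adm R"
      unfolding adm_def mem_Collect_eq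
    proof (intro conjI ballI impI)
      show "\<Union>C \<subseteq> {x \<in> B. R \<subseteq> S x}"
        using C(2) unfolding subset.chain_def adm_def by blast
      fix x y assume "x \<in> \<Union>C" "y \<in> \<Union>C" "x \<noteq> y"
      then obtain X where "X \<in> C" "x \<in> X" "y \<in> X"
        using C(2) by (meson UnionE subset_chain_def subset_iff)
      with \<open>x \<noteq> y\<close> show "S x \<inter> S y = R"
        using C(2) unfolding subset.chain_def adm_def by blast
    qed
  qed
  then obtain Z where Z: "\<And>R. Z R \<in> adm R" "\<And>R X. X \<in> adm R \<Longrightarrow> Z R \<subseteq> X \<Longrightarrow> X = Z R"
    by metis
  have inf: "infinite (Pow T)"
    using T by simp
  define F where "F R = (\<Union>x\<in>Z R. S x)" for R
  have F_small: "|F R| \<le>o |Pow T|" for R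
    unfolding F_def
    by (intro card_of_UNION_ordLeq_infinite inf adm_small[OF Z(1)])
       (use Z(1)[of R] S in \<open>auto simp: adm_def intro!: card_le_Pow\<close>)
  obtain C where C: "|C| \<le>o |Pow T|" "\<And>r. r \<subseteq> C \<Longrightarrow> |r| \<le>o |T| \<Longrightarrow> F r \<subseteq> C"
    using closure_exists[OF T, of F] F_small by blast
  have "|\<Union>r\<in>{r. r \<subseteq> C \<and> |r| \<le>o |T|}. Z r| \<le>o |Pow T|"
    by (intro card_of_UNION_ordLeq_infinite inf card_small_subsets T C(1)) (auto intro: adm_small Z(1))
  note Z_le = this
  have "\<not> B \<subseteq> (\<Union>r\<in>{r. r \<subseteq> C \<and> |r| \<le>o |T|}. Z r)"
  proof
    assume "B \<subseteq> (\<Union>r\<in>{r. r \<subseteq> C \<and> |r| \<le>o |T|}. Z r)"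
    from ordLeq_transitive[OF card_of_mono1[OF this] Z_le] show False
      using B not_card_less by blast
  qed
  then obtain x where x: "x \<in> B" "\<And>r. r \<subseteq> C \<Longrightarrow> |r| \<le>o |T| \<Longrightarrow> x \<notin> Z r"
    by blast
  define r where "r = S x \<inter> C"
  have r: "r \<subseteq> C" "|r| \<le>o |T|"
    unfolding r_def using ordLeq_transitive[OF card_of_mono1 S[OF x(1)]] by auto
  have Fr: "S y \<subseteq> C" "r \<subseteq> S y" "y \<in> B" if "y \<in> Z r" for y
    using C(2)[OF r] Z(1)[of r] that unfolding F_def adm_def by blast+
  have "S x \<inter> S y = r" if "y \<in> Z r" for y
    using Fr[OF that] by (auto simp: r_def)
  then have "insert x (Z r) \<in> adm r"
    using Z(1)[of r] x(1) unfolding adm_def r_def by (auto simp: Int_commute)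
  from Z(2)[OF this] have "x \<in> Z r"
    by blast
  with x(2)[OF r] show False
    by blast
qed

text \<open>Families of partial functions are coded as sets of triples, so that power sets bound the
  number of codes; \<open>decode\<close> recovers the functions from a code shared by many
  points.\<close>

definition decode :: "('k \<times> 'z \<times> bool) set \<Rightarrow> 'k \<Rightarrow> 'z \<rightharpoonup> bool" where
  "decode C k z = (if (k, z, True) \<in> C then Some True else if (k, z, False) \<in> C then Some False else None)"

lemma decode_eq: "(\<And>v. (k, z, v) \<in> C \<longleftrightarrow> w = Some v) \<Longrightarrow> decode C k z = w"
  by (cases w) (auto simp: decode_def)

text \<open>
  A large family of objects with little data consists, after thinning, of isomorphic objects: each
  \<open>x\<close> owns private coordinates \<open>S x\<close>, which \<open>\<psi> x\<close> identifies with a common set \<open>T\<^sub>0\<close> of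
  positions, and in terms of these positions the data do not depend on \<open>x\<close>.
\<close>

definition uniform_family ::
  "'t set \<Rightarrow> 'k set \<Rightarrow> ('x \<Rightarrow> 'k \<Rightarrow> 'm \<rightharpoonup> bool) \<Rightarrow> ('x \<Rightarrow> 'k set) \<Rightarrow> 'x set \<Rightarrow> ('x \<Rightarrow> 'm set) \<Rightarrow>
    ('x \<Rightarrow> 'm \<Rightarrow> 't) \<Rightarrow> 't set \<Rightarrow> ('k \<Rightarrow> 'm \<rightharpoonup> bool) \<Rightarrow> ('k \<Rightarrow> 't \<rightharpoonup> bool) \<Rightarrow> 'k set \<Rightarrow> bool" where
  "uniform_family T K f h B S \<psi> T0 b d h0 \<longleftrightarrow>
    |Pow T| <o |B| \<and>
    (\<forall>x\<in>B. \<forall>y\<in>B. x \<noteq> y \<longrightarrow> S x \<inter> S y = {}) \<and>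
    (\<forall>x\<in>B. S x \<subseteq> (\<Union>k\<in>K. dom (f x k))) \<and>
    (\<forall>x\<in>B. inj_on (\<psi> x) (S x)) \<and>
    (\<forall>x\<in>B. \<psi> x ` S x = T0) \<and> T0 \<subseteq> T \<and>
    (\<forall>x\<in>B. \<forall>k\<in>K. \<forall>m. f x k m = (if m \<in> S x then d k (\<psi> x m) else b k m)) \<and>
    (\<forall>x\<in>B. \<forall>k\<in>K. dom (b k) \<inter> S x = {}) \<and>
    (\<forall>k. dom (d k) \<subseteq> T0) \<and>
    (\<forall>x\<in>B. h x \<inter> K = h0)"

text \<open>A delta system isolates the root \<open>R\<close>, and what lies outside it is private.
  The type of \<open>x\<close> records the data on \<open>R\<close> literally and those on
  \<open>S x\<close> through positions in \<open>T\<close>. This gives at most 2^|T| types, so more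
  than 2^|T| points share one.\<close>

lemma uniformize:
  fixes T :: "'t set" and K :: "'k set" and f :: "'x \<Rightarrow> 'k \<Rightarrow> 'm \<rightharpoonup> bool" and h :: "'x \<Rightarrow> 'k set"
  assumes T: "infinite T" and K: "|K| \<le>o |T|" and B: "|Pow T| <o |B|"
    and f: "\<And>x k. x \<in> B \<Longrightarrow> k \<in> K \<Longrightarrow> |dom (f x k)| \<le>o |T|"
  shows "\<exists>B' S \<psi> T0 b d h0. B' \<subseteq> B \<and> uniform_family T K f h B' S \<psi> T0 b d h0"
proof -
  define S' where "S' x = (\<Union>k\<in>K. dom (f x k))" for x
  have S'_le: "|S' x| \<le>o |T|" if "x \<in> B" for x
    unfolding S'_def using f that by (intro card_of_UNION_ordLeq_infinite T K) auto
  obtain R B1 where B1: "B1 \<subseteq> B" "|Pow T| <o |B1|"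
    and R0: "\<forall>x\<in>B1. \<forall>y\<in>B1. x \<noteq> y \<longrightarrow> S' x \<inter> S' y = R"
    by (rule delta_system[OF T B, of S']) (erule S'_le, rule that)
  have R: "S' x \<inter> S' y = R" if "x \<in> B1" "y \<in> B1" "x \<noteq> y" for x y
    using R0 that by blast
  define S where "S x = S' x - R" for x
  have "\<exists>g. inj_on g (S x) \<and> g ` S x \<subseteq> T" if "x \<in> B1" for x
  proof -
    have "|S x| \<le>o |T|"
      by (rule ordLeq_transitive[OF card_of_mono1 S'_le]) (use B1(1) that in \<open>auto simp: S_def\<close>)
    then show ?thesis
      using card_of_ordLeq by blast
  qed
  then obtain \<psi> where \<psi>: "\<And>x. x \<in> B1 \<Longrightarrow> inj_on (\<psi> x) (S x)" "\<And>x. x \<in> B1 \<Longrightarrow> \<psi> x ` S x \<subseteq> T"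
    by metis
  have R_le: "|R| \<le>o |T|"
  proof -
    have "infinite B1"
      by (rule card_of_ordLeq_infinite[OF ordLess_imp_ordLeq[OF B1(2)] infinite_Pow[OF T]])
    then obtain x y where "x \<in> B1" "y \<in> B1" "x \<noteq> y"
      by (metis finite.simps finite_subset insertCI subsetI)
    then have "R \<subseteq> S' x" "x \<in> B"
      using R B1(1) by blast+
    then show ?thesis
      using ordLeq_transitive[OF card_of_mono1 S'_le] by blast
  qed
  define c1 where "c1 x = {(k, m, v). k \<in> K \<and> m \<in> R \<and> f x k m = Some v}" for x
  define c2 where "c2 x = {(k, t, v). k \<in> K \<and> (\<exists>m\<in>S x. \<psi> x m = t \<and> f x k m = Some v)}" for x
  define type where "type x = (\<psi> x ` S x, c1 x, c2 x, h x \<inter> K)" for x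
  have inf: "infinite (Pow T)"
    using T by simp
  have "type ` B1 \<subseteq> Pow T \<times> Pow (K \<times> R \<times> UNIV) \<times> Pow (K \<times> T \<times> UNIV) \<times> Pow K"
    using \<psi>(2) by (auto simp: type_def c1_def c2_def)
  then have "|type ` B1| \<le>o |Pow T \<times> Pow (K \<times> R \<times> (UNIV :: bool set)) \<times> Pow (K \<times> T \<times> (UNIV :: bool set)) \<times> Pow K|"
    by (rule card_of_mono1)
  also have "|Pow T \<times> Pow (K \<times> R \<times> (UNIV :: bool set)) \<times> Pow (K \<times> T \<times> (UNIV :: bool set)) \<times> Pow K| \<le>o |Pow T|"
    by (intro card_of_Times_le inf card_of_Pow_mono T K R_le card_of_refl[THEN ordIso_imp_ordLeq]
        finite_ordLeq_infinite) auto
  finally have "|type ` B1| \<le>o |Pow T|" .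
  from pigeonhole_large[OF inf B1(2) this] obtain \<tau> where \<tau>: "|Pow T| <o |{x \<in> B1. type x = \<tau>}|" .
  define B' where "B' = {x \<in> B1. type x = \<tau>}"
  obtain T0 C1 C2 h0 where \<tau>_eq: "\<tau> = (T0, C1, C2, h0)"
    by (cases \<tau>) auto
  have ty: "x \<in> B1" "\<psi> x ` S x = T0" "c1 x = C1" "c2 x = C2" "h x \<inter> K = h0" if "x \<in> B'" for x
    using that by (auto simp: B'_def type_def \<tau>_eq)
  have C1: "decode C1 k m = f x k m" if "x \<in> B'" "k \<in> K" "m \<in> R" for x k m
    by (rule decode_eq) (use ty(3)[OF that(1)] that in \<open>auto simp: c1_def\<close>)
  have C1_dom: "decode C1 k m = None" if "x \<in> B'" "m \<notin> R" for x k m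
    by (rule decode_eq) (use ty(3)[OF that(1)] that in \<open>auto simp: c1_def\<close>)
  have C2: "decode C2 k (\<psi> x m) = f x k m" if "x \<in> B'" "k \<in> K" "m \<in> S x" for x k m
    by (rule decode_eq)
       (use ty(4)[OF that(1)] that inj_onD[OF \<psi>(1)[OF ty(1)[OF that(1)]]] in \<open>auto simp: c2_def\<close>)
  have C2_dom: "decode C2 k t = None" if "x \<in> B'" "t \<notin> T0" for x k t
    by (rule decode_eq) (use ty(2,4)[OF that(1)] that in \<open>auto simp: c2_def\<close>)
  have "B' \<noteq> {}"
    using \<tau> not_card_less card_of_empty unfolding B'_def by metis
  then obtain x0 where x0: "x0 \<in> B'"
    by blast
  have "uniform_family T K f h B' S \<psi> T0 (decode C1) (decode C2) h0"
    unfolding uniform_family_def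
  proof (intro conjI)
    show "|Pow T| <o |B'|"
      using \<tau> by (simp add: B'_def)
    show "\<forall>x\<in>B'. \<forall>y\<in>B'. x \<noteq> y \<longrightarrow> S x \<inter> S y = {}"
    proof (intro ballI impI)
      fix x y assume "x \<in> B'" "y \<in> B'" "x \<noteq> y"
      then show "S x \<inter> S y = {}"
        using R[OF ty(1) ty(1)] by (auto simp: S_def)
    qed
    show "\<forall>x\<in>B'. S x \<subseteq> (\<Union>k\<in>K. dom (f x k))"
      by (auto simp: S_def S'_def)
    show "\<forall>x\<in>B'. inj_on (\<psi> x) (S x)" "\<forall>x\<in>B'. \<psi> x ` S x = T0"
      using \<psi>(1)[OF ty(1)] ty(2) by blast+
    show "T0 \<subseteq> T"
      using \<psi>(2)[OF ty(1)[OF x0]] ty(2)[OF x0] by simp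
    show "\<forall>x\<in>B'. \<forall>k\<in>K. \<forall>m. f x k m = (if m \<in> S x then decode C2 k (\<psi> x m) else decode C1 k m)"
    proof (intro ballI allI)
      fix x k m assume x: "x \<in> B'" "k \<in> K"
      consider "m \<in> S x" | "m \<in> R" "m \<notin> S x" | "m \<notin> R" "m \<notin> S' x"
        by (auto simp: S_def)
      then show "f x k m = (if m \<in> S x then decode C2 k (\<psi> x m) else decode C1 k m)"
      proof cases
        case 3
        then have "f x k m = None" "m \<notin> S x"
          using x(2) by (auto simp: S'_def S_def domIff)
        with C1_dom[OF x(1) 3(1)] show ?thesis
          by simp
      qed (use C1[OF x] C2[OF x] in simp_all)
    qed
    show "\<forall>x\<in>B'. \<forall>k\<in>K. dom (decode C1 k) \<inter> S x = {}"
      using C1_dom[OF x0] by (fastforce simp: S_def)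
    show "\<forall>k. dom (decode C2 k) \<subseteq> T0"
      using C2_dom[OF x0] by fastforce
    show "\<forall>x\<in>B'. h x \<inter> K = h0"
      using ty(5) by blast
  qed
  moreover have "B' \<subseteq> B"
    using B1(1) by (auto simp: B'_def)
  ultimately show ?thesis
    by blast
qed

section \<open>Cardinal arithmetic\<close>

lemma card_less_underS:
  assumes r: "Card_order r" and X: "|X| <o r"
  obtains b where "b \<in> Field r" "|X| =o |underS r b|"
proof -
  have wo: "Well_order r"
    using r by (simp add: card_order_on_def)
  obtain b where b: "b \<in> Field r" "|X| =o Restr r (underS r b)"
    using X ordLess_iff_ordIso_Restr[OF wo card_of_Well_order] by blast
  have "Field (Restr r (underS r b)) = underS r b"
    using wo wo_rel.underS_ofilter[of r b] Field_Restr_ofilter[OF wo] by (simp add: wo_rel_def)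
  then have "|X| =o |underS r b|"
    using card_of_cong[OF b(2)] by (simp add: Field_card_of)
  with b(1) show thesis
    by (rule that)
qed

text \<open>Diagonalization as in the theorem of Koenig. All functions are enumerated as
  \<open>G y\<close>. If \<open>K\<close> were cofinal and smaller than \<open>s\<close>, a function
  could be built that at the place \<open>x\<close> differs from all \<open>G y\<close> with
  \<open>y\<close> below \<open>e x\<close>; by cofinality it would differ from every
  \<open>G y\<close>.\<close>

lemma regularCard_of_cless_exp:
  fixes s :: "'c rel"
  assumes s: "Card_order s" "infinite (Field s)" and eq: "s =o cless_exp s s"
  shows "regularCard s"
  unfolding regularCard_def
proof (intro allI impI, elim conjE, rule ccontr)
  fix K assume K: "K \<subseteq> Field s" "cofinal K s" "\<not> |K| =o s"
  have "|K| \<le>o s"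
    by (rule ordLeq_ordIso_trans[OF card_of_mono1[OF K(1)] card_of_Field_ordIso[OF s(1)]])
  then have "|K| <o s"
    using K(3) ordLeq_iff_ordLess_or_ordIso by blast
  then obtain b where b: "b \<in> Field s" "|K| =o |underS s b|"
    using card_less_underS[OF s(1)] by blast
  then obtain e where e: "bij_betw e (underS s b) K"
    using card_of_ordIso[of "underS s b" K] ordIso_symmetric by blast
  define FF where "FF = {f. (\<exists>b\<in>Field s. dom f = underS s b) \<and> ran f \<subseteq> Field s}"
  have "|Field s| =o |FF|"
    using ordIso_transitive[OF card_of_Field_ordIso[OF s(1)] eq] by (simp add: cless_exp_def FF_def)
  then obtain G where G: "bij_betw G (Field s) FF"
    using card_of_ordIso by blast
  have "\<exists>v. v \<in> Field s \<and> (\<forall>y\<in>underS s (e x). G y x \<noteq> Some v)" if x: "x \<in> underS s b" for x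
  proof (rule ccontr)
    assume "\<not> ?thesis"
    then have "Field s \<subseteq> (\<lambda>y. the (G y x)) ` underS s (e x)"
      by (force simp: image_iff)
    then have "|Field s| \<le>o |underS s (e x)|"
      using ordLeq_transitive[OF card_of_mono1 card_of_image] by blast
    moreover have "e x \<in> Field s"
      using e x K(1) by (auto simp: bij_betw_def)
    then have "|underS s (e x)| <o s"
      by (rule card_of_underS[OF s(1)])
    then have "|underS s (e x)| <o |Field s|"
      using ordLess_ordIso_trans[OF _ ordIso_symmetric[OF card_of_Field_ordIso[OF s(1)]]] by blast
    ultimately show False
      using not_card_less by blast
  qed
  then obtain v where v: "\<And>x. x \<in> underS s b \<Longrightarrow> v x \<in> Field s"
    "\<And>x y. x \<in> underS s b \<Longrightarrow> y \<in> underS s (e x) \<Longrightarrow> G y x \<noteq> Some (v x)"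
    by metis
  define f where "f x = (if x \<in> underS s b then Some (v x) else None)" for x
  have "f \<in> FF"
    using b(1) v(1) by (auto simp: FF_def f_def ran_def split: if_splits intro!: bexI[of _ b])
  then obtain y where y: "y \<in> Field s" "G y = f"
    using G by (auto simp: bij_betw_def)
  obtain c where c: "c \<in> K" "y \<noteq> c" "(y, c) \<in> s"
    using K(2) y(1) unfolding cofinal_def by blast
  obtain x where x: "x \<in> underS s b" "e x = c"
    using e c(1) by (auto simp: bij_betw_def)
  have "G y x \<noteq> Some (v x)"
    using v(2)[OF x(1)] x(2) c by (simp add: underS_def)
  then show False
    using x(1) y(2) by (simp add: f_def)
qed

lemma not_cofinal_bounded:
  assumes "Well_order l" "S \<subseteq> Field l" "\<not> cofinal S l"
  obtains c where "c \<in> Field l" "\<And>x. x \<in> S \<Longrightarrow> x = c \<or> x \<in> underS l c"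
proof -
  obtain c where c: "c \<in> Field l" "\<And>x. x \<in> S \<Longrightarrow> \<not> (c \<noteq> x \<and> (c, x) \<in> l)"
    using assms(3) unfolding cofinal_def by blast
  show thesis
  proof (rule that[OF c(1)])
    fix x assume "x \<in> S"
    then show "x = c \<or> x \<in> underS l c"
      using wo_rel_underS_cases[OF assms(1) _ c(1), of x] c(2)[of x] assms(2) by (auto simp: underS_def)
  qed
qed

text \<open>A cofinal \<open>K\<close> in \<open>k\<close> yields a cofinal set in \<open>l\<close>
  of no larger size: for each \<open>y\<close> in \<open>K\<close> bound the image of the initial
  segment of \<open>y\<close>, which is too small to be cofinal.\<close>

lemma regularCard_cofinality:
  assumes l: "Well_order l" and k: "is_cofinality k l"
  shows "regularCard k"
  unfolding regularCard_def
proof (intro allI impI, elim conjE)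
  fix K assume K: "K \<subseteq> Field k" "cofinal K k"
  have co: "Card_order k" and least: "\<And>A. A \<subseteq> Field l \<Longrightarrow> cofinal A l \<Longrightarrow> k \<le>o |A|"
    using k by (auto simp: is_cofinality_def)
  obtain A where A: "A \<subseteq> Field l" "cofinal A l" "|A| =o k"
    using k by (auto simp: is_cofinality_def)
  have "|Field k| =o |A|"
    using ordIso_transitive[OF card_of_Field_ordIso[OF co] ordIso_symmetric[OF A(3)]] .
  then obtain f where f: "bij_betw f (Field k) A"
    using card_of_ordIso by blast
  have sub: "f ` underS k y \<subseteq> Field l" for y
  proof -
    have "underS k y \<subseteq> Field k"
      by (auto simp: underS_def Field_def)
    then show ?thesis
      using f A(1) by (auto simp: bij_betw_def)
  qed
  have "\<exists>c\<in>Field l. \<forall>x\<in>underS k y. f x = c \<or> f x \<in> underS l c" if y: "y \<in> K" for y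
  proof -
    have "|f ` underS k y| <o k"
      using ordLeq_ordLess_trans[OF card_of_image card_of_underS[OF co]] K(1) y by blast
    then have "\<not> cofinal (f ` underS k y) l"
      using least[OF sub] not_ordLess_ordLeq by blast
    then show ?thesis
      using not_cofinal_bounded[OF l sub] by (metis imageI)
  qed
  then obtain c where c: "\<And>y. y \<in> K \<Longrightarrow> c y \<in> Field l"
    "\<And>y x. y \<in> K \<Longrightarrow> x \<in> underS k y \<Longrightarrow> f x = c y \<or> f x \<in> underS l (c y)"
    by metis
  have "cofinal (c ` K) l"
    unfolding cofinal_def
  proof
    fix a assume "a \<in> Field l"
    then obtain b where b: "b \<in> A" "a \<noteq> b" "(a, b) \<in> l"
      using A(2) unfolding cofinal_def by blast
    then obtain x where x: "x \<in> Field k" "f x = b"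
      using f by (auto simp: bij_betw_def)
    obtain y where y: "y \<in> K" "x \<noteq> y" "(x, y) \<in> k"
      using K(2) x(1) unfolding cofinal_def by blast
    have ab: "a \<in> underS l b"
      using b by (simp add: underS_def)
    have "x \<in> underS k y"
      using y by (simp add: underS_def)
    then have "b = c y \<or> b \<in> underS l (c y)"
      using c(2)[OF y(1)] x(2) by blast
    then have "a \<in> underS l (c y)"
      using ab underS_trans[OF l ab] by blast
    then show "\<exists>b\<in>c ` K. a \<noteq> b \<and> (a, b) \<in> l"
      using y(1) by (auto simp: underS_def)
  qed
  moreover have "c ` K \<subseteq> Field l"
    using c(1) by blast
  ultimately have "k \<le>o |K|"
    using ordLeq_transitive[OF least card_of_image] by blast
  moreover have "|K| \<le>o k"
    by (rule ordLeq_ordIso_trans[OF card_of_mono1[OF K(1)] card_of_Field_ordIso[OF co]])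
  ultimately show "|K| =o k"
    by (simp add: ordIso_iff_ordLeq)
qed

text \<open>\<open>strong_limit\<close> speaks of cardinals on the type of \<open>l\<close>, so
  \<open>X\<close> is first replaced by an initial segment of \<open>l\<close> of the same
  size.\<close>

lemma strong_limit_Pow:
  fixes l :: "'d rel" and X :: "'x set"
  assumes l: "Card_order l" "strong_limit l" and X: "|X| <o l"
  shows "|Pow X| <o l"
proof -
  obtain b where b: "|X| =o |underS l b|"
    using card_less_underS[OF l(1) X] by blast
  have "|underS l b| <o l"
    by (rule ordIso_ordLess_trans[OF ordIso_symmetric[OF b] X])
  then have "ctwo ^c |underS l b| <o l"
    using l(2) unfolding strong_limit_def by (simp add: card_of_Card_order)
  moreover have "|Pow X| \<le>o |Pow (underS l b)|"
    by (rule card_of_Pow_mono[OF ordIso_imp_ordLeq[OF b]])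
  moreover have "|Pow (underS l b)| =o ctwo ^c |underS l b|"
    unfolding cexp_def ctwo_def Field_card_of by (rule card_of_Pow_Func)
  ultimately show ?thesis
    using ordLeq_ordLess_trans ordIso_ordLess_trans by metis
qed

lemma strong_limit_underS:
  fixes l :: "'d rel" and X :: "'x set"
  assumes l: "Card_order l" "strong_limit l" and X: "|X| <o l"
  obtains c where "c \<in> Field l" "|X| <o |underS l c|"
proof -
  obtain c where c: "c \<in> Field l" "|Pow X| =o |underS l c|"
    using card_less_underS[OF l(1) strong_limit_Pow[OF assms]] by blast
  show thesis
    by (rule that[OF c(1) ordLess_ordIso_trans[OF card_of_Pow c(2)]])
qed

lemma card_underS_mono:
  assumes "Well_order l" "a = b \<or> a \<in> underS l b"
  shows "underS l a \<subseteq> underS l b"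
  using assms(2) underS_subset[OF assms(1), of a b] by auto

text \<open>At stage \<open>i\<close> fewer than cf(l) points have to be bounded by
  \<open>a i\<close>: the point \<open>m0\<close>, the ends \<open>b j\<close> of the earlier
  blocks, and the earlier values of an enumeration \<open>f\<close> of a cofinal set, which make the
  \<open>a i\<close> unbounded. The strong limit property then provides \<open>b i\<close>.\<close>

lemma block_sequence:
  fixes l :: "'d rel" and k :: "'b rel" and M :: "'m set"
  assumes l: "Card_order l" "infinite (Field l)" "strong_limit l"
    and k: "is_cofinality k l" "infinite (Field k)" and M: "|M| <o l"
  obtains a b where "\<And>i. i \<in> Field k \<Longrightarrow> a i \<in> Field l \<and> b i \<in> Field l \<and> |M| <o |underS l (a i)| \<and>
      |Pow (underS l (a i))| <o |underS l (b i)| \<and> (\<forall>j\<in>underS k i. b j = a i \<or> b j \<in> underS l (a i))"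
    "\<And>x. x \<in> Field l \<Longrightarrow> \<exists>j\<in>Field k. \<forall>i\<in>Field k. j \<in> underS k i \<longrightarrow> x \<in> underS l (a i)"
proof -
  have wl: "Well_order l"
    using l(1) by (simp add: card_order_on_def)
  have co: "Card_order k" and least: "\<And>A. A \<subseteq> Field l \<Longrightarrow> cofinal A l \<Longrightarrow> k \<le>o |A|"
    using k by (auto simp: is_cofinality_def)
  have wk: "Well_order k"
    using co by (simp add: card_order_on_def)
  obtain A where A: "A \<subseteq> Field l" "cofinal A l" "|A| =o k"
    using k by (auto simp: is_cofinality_def)
  have "|Field k| =o |A|"
    using ordIso_transitive[OF card_of_Field_ordIso[OF co] ordIso_symmetric[OF A(3)]] .
  then obtain f where f: "bij_betw f (Field k) A"
    using card_of_ordIso by blast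
  obtain m0 where m0: "m0 \<in> Field l" "|M| <o |underS l m0|"
    using strong_limit_underS[OF l(1,3) M] .
  define ok where "ok h i v \<longleftrightarrow> (i \<in> Field k \<longrightarrow> fst v \<in> Field l \<and> snd v \<in> Field l \<and> |M| <o |underS l (fst v)| \<and>
      |Pow (underS l (fst v))| <o |underS l (snd v)| \<and>
      (\<forall>j\<in>underS k i. snd (h j) = fst v \<or> snd (h j) \<in> underS l (fst v)) \<and>
      (\<forall>j\<in>underS k i. f j = fst v \<or> f j \<in> underS l (fst v)))"
    for h :: "'b \<Rightarrow> 'd \<times> 'd" and i v
  have "\<exists>h. \<forall>i. ok h i (h i)"
  proof (rule dependent_wf_choice)
    show "wf {(c, b). c \<in> underS k b}"
      using wfp_underS[OF wk] by (simp add: wfp_def)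
    show "ok h i v = ok h' i v" if "\<And>j. (j, i) \<in> {(c, b). c \<in> underS k b} \<Longrightarrow> h j = h' j" for h h' i v
      using that by (auto simp: ok_def)
    show "\<exists>v. ok h i v" if prev: "\<And>j. (j, i) \<in> {(c, b). c \<in> underS k b} \<Longrightarrow> ok h j (h j)" for i h
    proof (cases "i \<in> Field k")
      case True
      have sub: "underS k i \<subseteq> Field k"
        by (auto simp: underS_def Field_def)
      let ?S = "insert m0 ((\<lambda>j. snd (h j)) ` underS k i \<union> f ` underS k i)"
      have S: "?S \<subseteq> Field l"
      proof -
        have "f ` underS k i \<subseteq> Field l"
          using sub f A(1) by (auto simp: bij_betw_def)
        moreover have "snd (h j) \<in> Field l" if "j \<in> underS k i" for j
          using prev[of j] that sub by (auto simp: ok_def)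
        ultimately show ?thesis
          using m0(1) by blast
      qed
      have inf: "infinite (Field k)"
        by (rule k(2))
      have less: "|g ` underS k i| <o k" for g :: "'b \<Rightarrow> 'd"
        by (rule ordLeq_ordLess_trans[OF card_of_image card_of_underS[OF co True]])
      have m0_less: "|{m0}| <o k"
        by (rule finite_ordLess_infinite[OF card_of_Well_order wk]) (use inf in \<open>simp_all add: Field_card_of\<close>)
      have "|{m0} \<union> ((\<lambda>j. snd (h j)) ` underS k i \<union> f ` underS k i)| <o k"
        by (intro card_of_Un_ordLess_infinite_Field[OF inf co] less m0_less)
      then have "\<not> cofinal ?S l"
        using least[OF S] not_ordLess_ordLeq by auto
      then obtain c where c: "c \<in> Field l" "\<And>x. x \<in> ?S \<Longrightarrow> x = c \<or> x \<in> underS l c"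
        using not_cofinal_bounded[OF wl S] by blast
      have Mc: "|M| <o |underS l c|"
        using ordLess_ordLeq_trans[OF m0(2) card_of_mono1[OF card_underS_mono[OF wl c(2)]]] by blast
      have "|Pow (underS l c)| <o l"
        by (rule strong_limit_Pow[OF l(1,3) card_of_underS[OF l(1) c(1)]])
      then obtain c' where c': "c' \<in> Field l" "|Pow (underS l c)| <o |underS l c'|"
        using strong_limit_underS[OF l(1,3)] by blast
      have "ok h i (c, c')"
        unfolding ok_def using c c' Mc by auto
      then show ?thesis ..
    qed (simp add: ok_def)
  qed
  then obtain h where h: "\<And>i. ok h i (h i)"
    by blast
  show thesis
  proof (rule that[of "\<lambda>i. fst (h i)" "\<lambda>i. snd (h i)"])
    fix i assume "i \<in> Field k"
    then show "fst (h i) \<in> Field l \<and> snd (h i) \<in> Field l \<and> |M| <o |underS l (fst (h i))| \<and>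
      |Pow (underS l (fst (h i)))| <o |underS l (snd (h i))| \<and>
      (\<forall>j\<in>underS k i. snd (h j) = fst (h i) \<or> snd (h j) \<in> underS l (fst (h i)))"
      using h[of i] by (simp add: ok_def)
  next
    fix x assume "x \<in> Field l"
    then obtain c where c: "c \<in> A" "x \<noteq> c" "(x, c) \<in> l"
      using A(2) unfolding cofinal_def by blast
    then obtain j where j: "j \<in> Field k" "f j = c"
      using f by (auto simp: bij_betw_def)
    have x: "x \<in> underS l c"
      using c by (simp add: underS_def)
    have "x \<in> underS l (fst (h i))" if "i \<in> Field k" "j \<in> underS k i" for i
    proof -
      have "c = fst (h i) \<or> c \<in> underS l (fst (h i))"
        using h[of i] that j(2) by (auto simp: ok_def)
      then show ?thesis
        using x underS_trans[OF wl] by blast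
    qed
    then show "\<exists>j\<in>Field k. \<forall>i\<in>Field k. j \<in> underS k i \<longrightarrow> x \<in> underS l (fst (h i))"
      using j(1) by blast
  qed
qed

lemma uniform_familyD:
  assumes "uniform_family T K f h B S \<psi> T0 b d h0"
  shows "|Pow T| <o |B|"
    and "x \<in> B \<Longrightarrow> y \<in> B \<Longrightarrow> x \<noteq> y \<Longrightarrow> S x \<inter> S y = {}"
    and "x \<in> B \<Longrightarrow> S x \<subseteq> (\<Union>k\<in>K. dom (f x k))"
    and "x \<in> B \<Longrightarrow> inj_on (\<psi> x) (S x)"
    and "x \<in> B \<Longrightarrow> \<psi> x ` S x = T0" and "T0 \<subseteq> T"
    and "x \<in> B \<Longrightarrow> k \<in> K \<Longrightarrow> f x k m = (if m \<in> S x then d k (\<psi> x m) else b k m)"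
    and "x \<in> B \<Longrightarrow> k \<in> K \<Longrightarrow> dom (b k) \<inter> S x = {}"
    and "dom (d k) \<subseteq> T0"
    and "x \<in> B \<Longrightarrow> h x \<inter> K = h0"
proof -
  note * = assms[unfolded uniform_family_def]
  show "|Pow T| <o |B|" "T0 \<subseteq> T" "dom (d k) \<subseteq> T0"
    using * by simp_all
  show "x \<in> B \<Longrightarrow> y \<in> B \<Longrightarrow> x \<noteq> y \<Longrightarrow> S x \<inter> S y = {}"
    using *[THEN conjunct2, THEN conjunct1] by blast
  show "x \<in> B \<Longrightarrow> S x \<subseteq> (\<Union>k\<in>K. dom (f x k))" "x \<in> B \<Longrightarrow> inj_on (\<psi> x) (S x)"
    "x \<in> B \<Longrightarrow> \<psi> x ` S x = T0" "x \<in> B \<Longrightarrow> h x \<inter> K = h0"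
    using * by simp_all
  show "x \<in> B \<Longrightarrow> k \<in> K \<Longrightarrow> f x k m = (if m \<in> S x then d k (\<psi> x m) else b k m)"
    using * by simp
  show "x \<in> B \<Longrightarrow> k \<in> K \<Longrightarrow> dom (b k) \<inter> S x = {}"
    using * by simp
qed

section \<open>Partial functions of small domain\<close>

definition Fn :: "'c rel \<Rightarrow> 'm set \<Rightarrow> ('m \<rightharpoonup> bool) set" where
  "Fn s N = {p. dom p \<subseteq> N \<and> |dom p| <o s}"

definition agree :: "('m \<rightharpoonup> 'v) \<Rightarrow> ('m \<rightharpoonup> 'v) \<Rightarrow> bool" where
  "agree p q \<longleftrightarrow> (\<forall>m v w. p m = Some v \<longrightarrow> q m = Some w \<longrightarrow> v = w)"

text \<open>The union of a pairwise agreeing family. For other families the choice is arbitrary, but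
  it is still a value of a member, so the bound on the domain holds in any case.\<close>

definition mUnion :: "('m \<rightharpoonup> 'v) set \<Rightarrow> ('m \<rightharpoonup> 'v)" where
  "mUnion F m = (if \<exists>p\<in>F. p m \<noteq> None then Some (SOME v. \<exists>p\<in>F. p m = Some v) else None)"

lemma map_leD: "p \<subseteq>\<^sub>m q \<Longrightarrow> p m = Some v \<Longrightarrow> q m = Some v"
  by (metis domI map_le_def)

lemma map_leI: "(\<And>m v. p m = Some v \<Longrightarrow> q m = Some v) \<Longrightarrow> p \<subseteq>\<^sub>m q"
  by (auto simp: map_le_def)

lemma agree_map_le: "p \<subseteq>\<^sub>m r \<Longrightarrow> q \<subseteq>\<^sub>m r \<Longrightarrow> agree p q"
  unfolding agree_def by (metis map_leD option.inject)

lemma agree_sym: "agree p q \<Longrightarrow> agree q p"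
  unfolding agree_def by metis

lemma agree_mono: "agree p q \<Longrightarrow> p' \<subseteq>\<^sub>m p \<Longrightarrow> q' \<subseteq>\<^sub>m q \<Longrightarrow> agree p' q'"
  unfolding agree_def by (meson map_leD)

lemma mUnion_SomeD: "mUnion F m = Some v \<Longrightarrow> \<exists>p\<in>F. p m = Some v"
proof -
  assume *: "mUnion F m = Some v"
  then have "\<exists>v. \<exists>p\<in>F. p m = Some v"
    by (auto simp: mUnion_def split: if_splits)
  from someI_ex[OF this] * show ?thesis
    by (auto simp: mUnion_def split: if_splits)
qed

lemma mUnion_upper:
  assumes "\<And>p q. p \<in> F \<Longrightarrow> q \<in> F \<Longrightarrow> agree p q" "p \<in> F"
  shows "p \<subseteq>\<^sub>m mUnion F"
proof (rule map_leI)
  fix m v assume v: "p m = Some v"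
  then have "mUnion F m \<noteq> None"
    using assms(2) by (auto simp: mUnion_def)
  then obtain w where w: "mUnion F m = Some w"
    by blast
  with mUnion_SomeD[OF w] assms v show "mUnion F m = Some v"
    unfolding agree_def by metis
qed

lemma dom_mUnion: "dom (mUnion F) \<subseteq> (\<Union>p\<in>F. dom p)"
  by (auto dest!: mUnion_SomeD)

lemma Fn_mUnion:
  assumes "Cinfinite s" "regularCard s" "|F| <o s" "F \<subseteq> Fn s N"
  shows "mUnion F \<in> Fn s N"
proof -
  have "|\<Union>p\<in>F. dom p| <o s"
    by (rule card_of_UNION_ordLess_infinite_Field_regularCard[OF assms(2,1,3)])
       (use assms(4) in \<open>auto simp: Fn_def\<close>)
  then have "|dom (mUnion F)| <o s"
    by (rule ordLeq_ordLess_trans[OF card_of_mono1[OF dom_mUnion]])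
  moreover have "dom (mUnion F) \<subseteq> N"
    using dom_mUnion[of F] assms(4) unfolding Fn_def by blast
  ultimately show ?thesis
    by (simp add: Fn_def)
qed

lemma finite_less: "Cinfinite s \<Longrightarrow> finite A \<Longrightarrow> |A| <o s"
  by (rule finite_ordLess_infinite[OF card_of_Well_order])
     (auto simp: cinfinite_def Field_card_of card_order_on_def)

text \<open>Closure of the forcing under increasing sequences of length below \<open>s\<close>;
  regularity keeps the domain of the union small. \<open>p\<close> joins the family because
  \<open>B\<close> may be empty.\<close>

lemma Fn_chain:
  assumes s: "Cinfinite s" "regularCard s" and W: "Well_order W" and B: "B \<subseteq> Field W" "|B| <o s"
    and h: "\<And>b. b \<in> B \<Longrightarrow> h b \<in> Fn s N"
    and mono: "\<And>b c. b \<in> B \<Longrightarrow> c \<in> B \<Longrightarrow> b \<in> underS W c \<Longrightarrow> h b \<subseteq>\<^sub>m h c"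
    and p: "p \<in> Fn s N" "\<And>b. b \<in> B \<Longrightarrow> p \<subseteq>\<^sub>m h b"
  shows "\<exists>q\<in>Fn s N. p \<subseteq>\<^sub>m q \<and> (\<forall>b\<in>B. h b \<subseteq>\<^sub>m q)"
proof -
  let ?F = "{p} \<union> h ` B"
  have hh: "agree (h b) (h c)" if "b \<in> B" "c \<in> B" for b c
    using wo_rel_underS_cases[OF W, of b c] B(1) that mono[of b c] mono[of c b]
    by (metis agree_map_le map_le_refl subsetD)
  have "agree p' q'" if "p' \<in> ?F" "q' \<in> ?F" for p' q'
    using that hh agree_map_le[OF p(2) map_le_refl] agree_map_le[OF map_le_refl p(2)]
    by (auto simp: agree_map_le[OF map_le_refl map_le_refl])
  note up = mUnion_upper[OF this]
  have "|?F| <o s"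
    by (rule Un_Cinfinite_bound_strict[OF finite_less[OF s(1)] ordLeq_ordLess_trans[OF card_of_image B(2)] s(1)]) simp
  then have "mUnion ?F \<in> Fn s N"
    by (rule Fn_mUnion[OF s]) (use h p in auto)
  then show ?thesis
    using up by blast
qed

lemma Fn_Un:
  assumes s: "Cinfinite s" and pq: "p \<in> Fn s N" "q \<in> Fn s N" "agree p q"
  shows "\<exists>r\<in>Fn s N. p \<subseteq>\<^sub>m r \<and> q \<subseteq>\<^sub>m r"
proof (intro bexI[of _ "p ++ q"] conjI)
  show "q \<subseteq>\<^sub>m p ++ q"
    by simp
  show "p \<subseteq>\<^sub>m p ++ q"
  proof (rule map_leI)
    fix m v assume "p m = Some v"
    moreover from this have "w = v" if "q m = Some w" for w
      using pq(3) that unfolding agree_def by blast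
    ultimately show "(p ++ q) m = Some v"
      by (cases "q m") (simp_all add: map_add_def)
  qed
  have "|dom q \<union> dom p| <o s"
    using pq by (intro Un_Cinfinite_bound_strict s) (auto simp: Fn_def)
  then show "p ++ q \<in> Fn s N"
    using pq by (auto simp: Fn_def)
qed

text \<open>To decide \<open>i\<close> is either to absorb a member of \<open>C i\<close> or to be
  incompatible with all of them. One of the two can always be reached and both persist under
  extension, so a recursion along \<open>I\<close> decides everything.\<close>

lemma Fn_decide:
  fixes I :: "'i set" and N :: "'m set"
  assumes s: "Cinfinite s" "regularCard s" and I: "|I| <o s"
    and C: "\<And>i. i \<in> I \<Longrightarrow> C i \<subseteq> Fn s N" and z0: "z0 \<in> Fn s N"
  shows "\<exists>z\<in>Fn s N. z0 \<subseteq>\<^sub>m z \<and> (\<forall>i\<in>I. (\<exists>c\<in>C i. c \<subseteq>\<^sub>m z) \<or> (\<forall>c\<in>C i. \<not> agree z c))"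
proof -
  define W where "W = |I|"
  have W: "Well_order W" "Field W = I"
    unfolding W_def by (rule card_of_Well_order, simp add: Field_card_of)
  define dec where "dec i z \<longleftrightarrow> (\<exists>c\<in>C i. c \<subseteq>\<^sub>m z) \<or> (\<forall>c\<in>C i. \<not> agree z c)" for i z
  have dec_mono: "dec i z'" if "dec i z" "z \<subseteq>\<^sub>m z'" for i z z'
    using that unfolding dec_def by (meson agree_mono map_le_refl map_le_trans)
  have ext: "\<exists>z'\<in>Fn s N. z \<subseteq>\<^sub>m z' \<and> dec i z'" if "z \<in> Fn s N" "i \<in> I" for z i
  proof (cases "\<exists>c\<in>C i. agree z c")
    case True
    then obtain c where c: "c \<in> C i" "agree z c"
      by blast
    then have "c \<in> Fn s N"
      using C[OF that(2)] by blast
    from Fn_Un[OF s(1) that(1) this c(2)] show ?thesis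
      using c(1) unfolding dec_def by blast
  next
    case False
    then show ?thesis
      unfolding dec_def by (intro bexI[OF _ that(1)]) auto
  qed
  define step where "step h i v \<longleftrightarrow> (i \<in> I \<longrightarrow> v \<in> Fn s N \<and> z0 \<subseteq>\<^sub>m v \<and> (\<forall>j\<in>underS W i. h j \<subseteq>\<^sub>m v) \<and> dec i v)"
    for h :: "'i \<Rightarrow> 'm \<rightharpoonup> bool" and i v
  have sub: "underS W i \<subseteq> I" for i
    using W(2) by (auto simp: underS_def Field_def)
  have "\<exists>h. \<forall>i. step h i (h i)"
  proof (rule dependent_wf_choice)
    show "wf {(c, b). c \<in> underS W b}"
      using wfp_underS[OF W(1)] by (simp add: wfp_def)
    show "step h i v = step h' i v" if "\<And>j. (j, i) \<in> {(c, b). c \<in> underS W b} \<Longrightarrow> h j = h' j" for h h' i v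
      using that by (auto simp: step_def)
    show "\<exists>v. step h i v" if prev: "\<And>j. (j, i) \<in> {(c, b). c \<in> underS W b} \<Longrightarrow> step h j (h j)" for i h
    proof (cases "i \<in> I")
      case True
      have st: "h j \<in> Fn s N \<and> z0 \<subseteq>\<^sub>m h j \<and> (\<forall>j'\<in>underS W j. h j' \<subseteq>\<^sub>m h j)" if "j \<in> underS W i" for j
        using prev[of j] that sub by (auto simp: step_def)
      have "\<exists>q\<in>Fn s N. z0 \<subseteq>\<^sub>m q \<and> (\<forall>b\<in>underS W i. h b \<subseteq>\<^sub>m q)"
      proof (rule Fn_chain[OF s W(1)])
        show "underS W i \<subseteq> Field W"
          using sub W(2) by simp
        show "|underS W i| <o s"
          by (rule ordLeq_ordLess_trans[OF card_of_mono1[OF sub] I])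
      qed (use st z0 in auto)
      then obtain q where q: "q \<in> Fn s N" "z0 \<subseteq>\<^sub>m q" "\<forall>b\<in>underS W i. h b \<subseteq>\<^sub>m q"
        by blast
      obtain z' where "z' \<in> Fn s N" "q \<subseteq>\<^sub>m z'" "dec i z'"
        using ext[OF q(1) True] by blast
      then have "step h i z'"
        unfolding step_def using q map_le_trans by blast
      then show ?thesis
        by (rule exI[of _ z'])
    qed (simp add: step_def)
  qed
  then obtain h where h: "\<And>i. step h i (h i)"
    by blast
  have "\<exists>q\<in>Fn s N. z0 \<subseteq>\<^sub>m q \<and> (\<forall>b\<in>I. h b \<subseteq>\<^sub>m q)"
    by (rule Fn_chain[OF s W(1)]) (use h W(2) I z0 in \<open>auto simp: step_def\<close>)
  then obtain q where q: "q \<in> Fn s N" "z0 \<subseteq>\<^sub>m q" "\<forall>b\<in>I. h b \<subseteq>\<^sub>m q"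
    by blast
  then have "dec i q" if "i \<in> I" for i
    using h[of i] that dec_mono by (auto simp: step_def)
  then show ?thesis
    using q(1,2) unfolding dec_def by blast
qed

lemma Fn_dom_le:
  assumes "Card_order s" "p \<in> Fn s N" "|Field s| \<le>o |T|"
  shows "|dom p| \<le>o |T|"
proof -
  have "|dom p| \<le>o |Field s|"
    using assms(2) ordLess_imp_ordLeq[OF ordLess_ordIso_trans[OF _ ordIso_symmetric[OF card_of_Field_ordIso[OF assms(1)]]]]
    by (auto simp: Fn_def)
  then show ?thesis
    using assms(3) ordLeq_transitive by blast
qed

text \<open>
  Maximal antichains suffice: among more than \<open>2\<^sup>s\<close> conditions there are isomorphic ones that
  overlap only in a common part and are therefore compatible.
\<close>

lemma Fn_predense:
  fixes s :: "'c rel" and N :: "'m set"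
  assumes s: "Cinfinite s" and G: "G \<subseteq> Fn s N"
  shows "\<exists>(a :: 'c set \<Rightarrow> 'm \<rightharpoonup> bool) V. V \<subseteq> Pow (Field s) \<and> (\<forall>u\<in>V. a u \<in> G) \<and> (\<forall>r\<in>G. \<exists>u\<in>V. agree (a u) r)"
proof -
  define adm where "adm = {Z. Z \<subseteq> G \<and> (\<forall>p\<in>Z. \<forall>q\<in>Z. p \<noteq> q \<longrightarrow> \<not> agree p q)}"
  have "\<exists>M\<in>adm. \<forall>X\<in>adm. M \<subseteq> X \<longrightarrow> X = M"
  proof (rule subset_Zorn_nonempty)
    show "adm \<noteq> {}"
      unfolding adm_def by blast
    fix C assume C: "C \<noteq> {}" "subset.chain adm C"
    show "\<Union>C \<in> adm"
      unfolding adm_def mem_Collect_eq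
    proof (intro conjI ballI impI)
      show "\<Union>C \<subseteq> G"
        using C(2) unfolding subset.chain_def adm_def by blast
      fix x y assume "x \<in> \<Union>C" "y \<in> \<Union>C" "x \<noteq> y"
      then obtain X where "X \<in> C" "x \<in> X" "y \<in> X"
        using C(2) by (meson UnionE subset_chain_def subset_iff)
      with \<open>x \<noteq> y\<close> show "\<not> agree x y"
        using C(2) unfolding subset.chain_def adm_def by blast
    qed
  qed
  then obtain Z where Z: "Z \<in> adm" "\<And>X. X \<in> adm \<Longrightarrow> Z \<subseteq> X \<Longrightarrow> X = Z"
    by blast
  have inf: "infinite (Field s)"
    using s by (simp add: cinfinite_def)
  have "|Z| \<le>o |Pow (Field s)|"
  proof (rule ccontr)
    assume "\<not> |Z| \<le>o |Pow (Field s)|"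
    then have large: "|Pow (Field s)| <o |Z|"
      using not_card_less by blast
    have "\<exists>B' S \<psi> T0 b d h0. B' \<subseteq> Z \<and> uniform_family (Field s) {()} (\<lambda>p _. p) (\<lambda>_. {}) B' S \<psi> T0 b d h0"
    proof (rule uniformize[OF inf _ large])
      show "|{()}| \<le>o |Field s|"
        by (rule finite_ordLeq_infinite[OF _ inf]) simp
      show "|dom p| \<le>o |Field s|" if "p \<in> Z" for p
      proof (rule Fn_dom_le[OF conjunct2[OF s] _ ordIso_imp_ordLeq[OF card_of_refl]])
        show "p \<in> Fn s N"
          using that Z(1) G by (auto simp: adm_def)
      qed
    qed
    then obtain B' S \<psi> T0 b d h0 where B': "B' \<subseteq> Z"
      "uniform_family (Field s) {()} (\<lambda>p _. p) (\<lambda>_. {}) B' S \<psi> T0 b d h0"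
      by (elim exE conjE) (rule that)
    note uf = uniform_familyD(1,2,7,8)[OF B'(2)]
    have "infinite B'"
      by (rule card_of_ordLeq_infinite[OF ordLess_imp_ordLeq[OF uf(1)] infinite_Pow[OF inf]])
    then obtain p q where pq: "p \<in> B'" "q \<in> B'" "p \<noteq> q"
      by (metis finite.simps finite_subset insertCI subsetI)
    have "agree p q"
      unfolding agree_def
    proof (intro allI impI)
      fix m v w assume v: "p m = Some v" and w: "q m = Some w"
      have p: "p m = (if m \<in> S p then d () (\<psi> p m) else b () m)"
        and q: "q m = (if m \<in> S q then d () (\<psi> q m) else b () m)"
        using uf(3)[OF pq(1)] uf(3)[OF pq(2)] by blast+
      show "v = w"
        using v w p q uf(2)[OF pq] uf(4)[OF pq(1), of "()"] uf(4)[OF pq(2), of "()"] by (auto split: if_splits)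
    qed
    then show False
      using pq B'(1) Z(1) unfolding adm_def by blast
  qed
  \<comment> \<open>Renaming the antichain by subsets of \<open>Field s\<close> gives indices from a
    set that does not depend on the points concerned; only so can they be part of the keys of a
    uniformization.\<close>
  then obtain e where e: "inj_on e Z" "e ` Z \<subseteq> Pow (Field s)"
    using card_of_ordLeq[of Z "Pow (Field s)"] by auto
  have "\<exists>p\<in>Z. agree p r" if r: "r \<in> G" for r
  proof (rule ccontr)
    assume no: "\<not> (\<exists>p\<in>Z. agree p r)"
    then have "insert r Z \<in> adm"
      using Z(1) r unfolding adm_def by (auto dest: agree_sym)
    from Z(2)[OF this] have "r \<in> Z"
      by blast
    then show False
      using no by (meson agree_map_le map_le_refl)
  qed
  then have "\<forall>r\<in>G. \<exists>u\<in>e ` Z. agree (inv_into Z e u) r"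
    by (simp add: e(1))
  moreover have "\<forall>u\<in>e ` Z. inv_into Z e u \<in> G"
    using e(1) Z(1) by (auto simp: adm_def)
  ultimately show ?thesis
    using e(2) by blast
qed

section \<open>Homogeneous blocks\<close>

definition green_chain where
  "green_chain s N th l g q \<longleftrightarrow> (\<exists>h. \<exists>q'\<in>Fn s N. q \<subseteq>\<^sub>m q' \<and> (\<forall>x\<in>succ_field th. h x \<in> Field l) \<and>
    (\<forall>x\<in>succ_field th. \<forall>y\<in>succ_field th. succ_less th x y \<longrightarrow> h x \<in> underS l (h y) \<and> g (h x) (h y) q'))"

text \<open>Supplies the bound \<open>seqs\<close> of the tree argument for the successor of 2^|T|:
  a sequence is identified with its graph, a subset of size at most |T|.\<close>

lemma card_sequences:
  fixes th :: "'a rel" and Lab :: "'b set"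
  assumes T: "infinite T" and th: "|Field th| \<le>o |T|" and Lab: "|Lab| \<le>o |Pow T|"
  shows "|{f. (\<exists>b\<in>Field th. dom f = underS th b) \<and> ran f \<subseteq> Lab}| \<le>o |Pow T|"
proof -
  let ?S = "{f. (\<exists>b\<in>Field th. dom f = underS th b) \<and> ran f \<subseteq> Lab}"
  have "Map.graph ` ?S \<subseteq> {r. r \<subseteq> Field th \<times> Lab \<and> |r| \<le>o |T|}"
  proof safe
    fix f b assume f: "b \<in> Field th" "dom f = underS th b" "ran f \<subseteq> Lab"
    have dom: "dom f \<subseteq> Field th"
      using f(2) by (auto simp: underS_def Field_def)
    show "a \<in> Field th" "v \<in> Lab" if "(a, v) \<in> Map.graph f" for a v
      using that dom f(3) by (auto simp: Map.graph_def ran_def)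
    have "Map.graph f = (\<lambda>a. (a, the (f a))) ` dom f"
      by (force simp: Map.graph_def)
    then have "|Map.graph f| \<le>o |Field th|"
      using ordLeq_transitive[OF card_of_image card_of_mono1[OF dom]] by simp
    then show "|Map.graph f| \<le>o |T|"
      using th by (rule ordLeq_transitive)
  qed
  moreover have "inj_on Map.graph ?S"
  proof (rule inj_onI)
    fix f g :: "'a \<rightharpoonup> 'b" assume "Map.graph f = Map.graph g"
    then have "f a = Some v \<longleftrightarrow> g a = Some v" for a v
      by (auto simp: Map.graph_def set_eq_iff)
    then show "f = g"
      by (metis ext option.exhaust)
  qed
  ultimately have "|?S| \<le>o |{r. r \<subseteq> Field th \<times> Lab \<and> |r| \<le>o |T|}|"
    using card_of_ordLeq by blast
  also have "|{r. r \<subseteq> Field th \<times> Lab \<and> |r| \<le>o |T|}| \<le>o |Pow T|"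
    by (intro card_small_subsets T card_of_Times_le infinite_Pow Lab card_le_Pow th)
  finally show ?thesis .
qed

text \<open>The tree argument for the successor of 2^|T| gives a large red family. A uniformization
  of its conditions leaves a large subfamily in which they overlap only in their common part
  \<open>b ()\<close>, the new \<open>q'\<close>.\<close>

lemma block_step:
  fixes l :: "'d rel" and s :: "'c rel" and T :: "'t set" and th :: "'a rel" and N :: "'m set"
  assumes s: "Cinfinite s" "regularCard s" and l: "Well_order l" and th: "Well_order th" "|Field th| <o s"
    and T: "infinite T" "|Field s| \<le>o |T|" and B: "B \<subseteq> Field l" "|Pow T| <o |B|"
    and q: "q \<in> Fn s N"
    and g_mono: "\<forall>x y p. \<forall>q\<in>Fn s N. g x y p \<longrightarrow> p \<subseteq>\<^sub>m q \<longrightarrow> g x y q"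
    and no_green: "\<not> green_chain s N th l g q"
  shows "\<exists>B' p q'. B' \<subseteq> B \<and> |Pow T| <o |B'| \<and> q' \<in> Fn s N \<and> q \<subseteq>\<^sub>m q' \<and>
    (\<forall>x\<in>B'. p x \<in> Fn s N \<and> q' \<subseteq>\<^sub>m p x) \<and>
    (\<forall>x\<in>B'. \<forall>y\<in>B'. x \<noteq> y \<longrightarrow> dom (p x) \<inter> dom (p y) \<subseteq> dom q') \<and>
    (\<forall>x\<in>B'. \<forall>y\<in>B'. x \<in> underS l y \<longrightarrow> \<not> (\<exists>q\<in>Fn s N. p x \<subseteq>\<^sub>m q \<and> p y \<subseteq>\<^sub>m q \<and> g x y q))"
proof -
  have inf: "infinite (Pow T)"
    using T(1) by simp
  have CT: "Cinfinite |Pow T|"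
    using inf by (simp add: cinfinite_def Field_card_of card_of_card_order_on)
  have less_iff: "|A| <o cardSuc |Pow T| \<longleftrightarrow> |A| \<le>o |Pow T|" for A :: "'z set"
    by (rule cardSuc_ordLeq_ordLess[OF card_of_Card_order card_of_Card_order])
  have thT: "|Field th| \<le>o |T|"
    by (rule ordLeq_transitive[OF ordLess_imp_ordLeq[OF ordLess_ordIso_trans[OF th(2)
        ordIso_symmetric[OF card_of_Field_ordIso]]] T(2)]) (use s in simp)
  have "(\<exists>h. \<exists>q'\<in>Fn s N. (\<forall>x\<in>succ_field th. h x \<in> B \<and> q \<subseteq>\<^sub>m q') \<and>
      (\<forall>x\<in>succ_field th. \<forall>y\<in>succ_field th. succ_less th x y \<longrightarrow> h x \<in> underS l (h y) \<and> g (h x) (h y) q')) \<or>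
    (\<exists>Z p. Z \<subseteq> B \<and> \<not> |Z| <o cardSuc |Pow T| \<and> (\<forall>x\<in>Z. p x \<in> Fn s N \<and> q \<subseteq>\<^sub>m p x) \<and>
      (\<forall>x\<in>Z. \<forall>y\<in>Z. x \<in> underS l y \<longrightarrow> \<not> (\<exists>q\<in>Fn s N. p x \<subseteq>\<^sub>m q \<and> p y \<subseteq>\<^sub>m q \<and> g x y q)))"
  proof (rule ramsey_tree[OF th(1) _ _ _ _ l B(1), where le = "\<lambda>q p. p \<subseteq>\<^sub>m q"])
    show "Cinfinite (cardSuc |Pow T| )" "regularCard (cardSuc |Pow T| )"
      by (rule Cinfinite_cardSuc[OF CT], rule regularCard_cardSuc[OF CT])
    show "|Field th| <o cardSuc |Pow T|"
      unfolding less_iff by (rule card_le_Pow[OF thT])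
    show "|{f. (\<exists>b\<in>Field th. dom f = underS th b) \<and> ran f \<subseteq> Lab}| <o cardSuc |Pow T|"
      if "|Lab| <o cardSuc |Pow T|" for Lab :: "('d \<times> ('m \<rightharpoonup> bool)) set"
      using that unfolding less_iff by (rule card_sequences[OF T(1) thT])
    show "\<not> |B| <o cardSuc |Pow T|"
      unfolding less_iff using B(2) not_card_less by blast
    fix C h p
    assume C: "C \<subseteq> Field th" and "\<And>b. b \<in> C \<Longrightarrow> h b \<in> Fn s N"
      "\<And>b c. b \<in> C \<Longrightarrow> c \<in> C \<Longrightarrow> b \<in> underS th c \<Longrightarrow> h b \<subseteq>\<^sub>m h c" "p \<in> Fn s N" "\<And>b. b \<in> C \<Longrightarrow> p \<subseteq>\<^sub>m h b"
    then show "\<exists>q\<in>Fn s N. p \<subseteq>\<^sub>m q \<and> (\<forall>b\<in>C. h b \<subseteq>\<^sub>m q)"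
      using ordLeq_ordLess_trans[OF card_of_mono1[OF C] th(2)] by (intro Fn_chain[OF s th(1)])
  qed (use q g_mono map_le_trans in auto)
  then show ?thesis
  proof (elim disjE exE bexE conjE)
    fix h q'
    assume h: "q' \<in> Fn s N" "\<forall>x\<in>succ_field th. h x \<in> B \<and> q \<subseteq>\<^sub>m q'"
      "\<forall>x\<in>succ_field th. \<forall>y\<in>succ_field th. succ_less th x y \<longrightarrow> h x \<in> underS l (h y) \<and> g (h x) (h y) q'"
    have "q \<subseteq>\<^sub>m q'"
      using h(2) by (auto simp: succ_field_def)
    then have "green_chain s N th l g q"
      unfolding green_chain_def using h B(1) by blast
    with no_green show ?thesis
      by blast
  next
    fix Z p
    assume Z: "Z \<subseteq> B" "\<not> |Z| <o cardSuc |Pow T|" and p: "\<forall>x\<in>Z. p x \<in> Fn s N \<and> q \<subseteq>\<^sub>m p x"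
      and red: "\<forall>x\<in>Z. \<forall>y\<in>Z. x \<in> underS l y \<longrightarrow> \<not> (\<exists>q\<in>Fn s N. p x \<subseteq>\<^sub>m q \<and> p y \<subseteq>\<^sub>m q \<and> g x y q)"
    have large: "|Pow T| <o |Z|"
      using Z(2) not_card_less unfolding less_iff by blast
    have "\<exists>B' S \<psi> T0 b d h0. B' \<subseteq> Z \<and> uniform_family T {()} (\<lambda>x _. p x) (\<lambda>_. {}) B' S \<psi> T0 b d h0"
    proof (rule uniformize[OF T(1) _ large])
      show "|{()}| \<le>o |T|"
        by (rule finite_ordLeq_infinite[OF _ T(1)]) simp
      show "|dom (p x)| \<le>o |T|" if "x \<in> Z" for x
        by (rule Fn_dom_le[OF conjunct2[OF s(1)] _ T(2)]) (use that p in blast)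
    qed
    then obtain B' S \<psi> T0 b d h0 where B': "B' \<subseteq> Z"
      "uniform_family T {()} (\<lambda>x _. p x) (\<lambda>_. {}) B' S \<psi> T0 b d h0"
      by (elim exE conjE) (rule that)
    note uf = uniform_familyD(1,2,7,8)[OF B'(2)]
    have "infinite B'"
      by (rule card_of_ordLeq_infinite[OF ordLess_imp_ordLeq[OF uf(1)] inf])
    then obtain x y where xy: "x \<in> B'" "y \<in> B'" "x \<noteq> y"
      by (metis finite.simps finite_subset insertCI subsetI)
    have b_le: "b () \<subseteq>\<^sub>m p x" if "x \<in> B'" for x
      by (rule map_leI) (use uf(3)[OF that, of "()"] uf(4)[OF that, of "()"] in auto)
    have "b () \<in> Fn s N"
    proof -
      have "dom (b ()) \<subseteq> dom (p x)"
        using b_le[OF xy(1)] by (rule map_le_implies_dom_le)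
      then show ?thesis
        using p xy(1) B'(1) ordLeq_ordLess_trans[OF card_of_mono1] unfolding Fn_def by blast
    qed
    \<comment> \<open>\<open>q\<close> is contained in the conditions of two different points, so
      none of its coordinates is private.\<close>
    moreover have "q \<subseteq>\<^sub>m b ()"
    proof (rule map_leI)
      fix m v assume "q m = Some v"
      then have "p x m = Some v" "p y m = Some v"
        using p xy B'(1) by (blast intro: map_leD)+
      then show "b () m = Some v"
        using uf(3)[OF xy(1), of "()" m] uf(3)[OF xy(2), of "()" m] uf(2)[OF xy] by (auto split: if_splits)
    qed
    moreover have "dom (p x) \<inter> dom (p y) \<subseteq> dom (b ())" if "x \<in> B'" "y \<in> B'" "x \<noteq> y" for x y
    proof
      fix m assume "m \<in> dom (p x) \<inter> dom (p y)"
      then show "m \<in> dom (b ())"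
        using uf(3)[OF that(1), of "()" m] uf(3)[OF that(2), of "()" m] uf(2)[OF that] by (auto split: if_splits)
    qed
    moreover have "B' \<subseteq> B" "\<forall>x\<in>B'. p x \<in> Fn s N \<and> b () \<subseteq>\<^sub>m p x"
      "\<forall>x\<in>B'. \<forall>y\<in>B'. x \<in> underS l y \<longrightarrow> \<not> (\<exists>q\<in>Fn s N. p x \<subseteq>\<^sub>m q \<and> p y \<subseteq>\<^sub>m q \<and> g x y q)"
      using B'(1) Z(1) p red b_le by blast+
    ultimately show ?thesis
      using uf(1) by blast
  qed
qed

section \<open>Systems of blocks\<close>

text \<open>
  The data attached to a point \<open>x\<close> of a block: its initial condition, the names for the colours of
  the pairs \<open>{x, y}\<close> with \<open>y\<close> in the block \<open>i\<close>, the coordinates through which the colours of the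
  pairs \<open>{y, x}\<close> with smaller \<open>y\<close> depend on \<open>x\<close>, and which of all these coordinates are real.
\<close>

datatype ('b, 'c, 'd) key = Init | Green 'b "'c set" | Pos 'd | Kind

text \<open>The bound on \<open>Pow (Field s)\<close> makes room for antichain indices among the
  keys, and by \<open>B_T\<close> the points of a block can be keys for all larger blocks.
  \<open>Q\<close> contains every value common to two initial conditions of a block, for all blocks
  at once.\<close>

locale block_system =
  fixes k :: "'b rel" and s :: "'c rel" and N :: "'n set"
    and T :: "'b \<Rightarrow> 'd set" and B :: "'b \<Rightarrow> 'd set"
    and g :: "'d \<Rightarrow> 'd \<Rightarrow> ('n \<rightharpoonup> bool) \<Rightarrow> bool"
    and p :: "'b \<Rightarrow> 'd \<Rightarrow> 'n \<rightharpoonup> bool" and Q :: "'n \<rightharpoonup> bool"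
  assumes s: "Cinfinite s" "regularCard s"
    and k: "Well_order k" "|Field k| <o s" "infinite (Field k)"
    and T: "i \<in> Field k \<Longrightarrow> infinite (T i)" "i \<in> Field k \<Longrightarrow> |Pow (Field s)| \<le>o |T i|"
    and T_mono: "j \<in> underS k i \<Longrightarrow> T j \<subseteq> T i"
    and B_large: "i \<in> Field k \<Longrightarrow> |Pow (T i)| <o |B i|"
    and B_T: "j \<in> underS k i \<Longrightarrow> B j \<subseteq> T i"
    and g_mono: "g x y r \<Longrightarrow> r' \<in> Fn s N \<Longrightarrow> r \<subseteq>\<^sub>m r' \<Longrightarrow> g x y r'"
    and p: "i \<in> Field k \<Longrightarrow> x \<in> B i \<Longrightarrow> p i x \<in> Fn s N"
    and Q: "Q \<in> Fn s N"
    and pQ: "i \<in> Field k \<Longrightarrow> x \<in> B i \<Longrightarrow> y \<in> B i \<Longrightarrow> x \<noteq> y \<Longrightarrow> p i x m = Some v \<Longrightarrow> p i y m = Some v \<Longrightarrow> Q m = Some v"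
begin

lemma underS_Field: "j \<in> underS k i \<Longrightarrow> j \<in> Field k" "j \<in> underS k i \<Longrightarrow> i \<in> Field k" "j \<in> underS k i \<Longrightarrow> j \<noteq> i"
  by (auto simp: underS_def Field_def)

lemma s_T: "i \<in> Field k \<Longrightarrow> |Field s| \<le>o |T i|"
  using T(2) ordLeq_transitive ordLess_imp_ordLeq[OF card_of_Pow] by blast

lemma less_s_T: "|A| <o s \<Longrightarrow> i \<in> Field k \<Longrightarrow> |A| \<le>o |T i|"
  using ordLeq_transitive[OF ordLess_imp_ordLeq[OF ordLess_ordIso_trans[OF _
        ordIso_symmetric[OF card_of_Field_ordIso[OF conjunct2[OF s(1)]]]]] s_T] .

lemma T_T: "i \<in> Field k \<Longrightarrow> |T i| \<le>o |T i|"
  by (rule ordIso_imp_ordLeq[OF card_of_refl])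

end

text \<open>
  First uniformization: for fixed smaller \<open>y\<close>, the conditions \<open>a y x u\<close> deciding that \<open>{y, x}\<close> is
  green are the same for all \<open>x\<close> in a block, up to the private coordinates \<open>S\<^sub>1 i x\<close> of \<open>x\<close>.
\<close>

locale block_system1 = block_system k s N T B g p Q
  for k :: "'b rel" and s :: "'c rel" and N :: "'n set"
    and T :: "'b \<Rightarrow> 'd set" and B g p Q +
  fixes a :: "'d \<Rightarrow> 'd \<Rightarrow> 'c set \<Rightarrow> 'n \<rightharpoonup> bool" and V :: "'d \<Rightarrow> 'd \<Rightarrow> 'c set set"
    and B1 :: "'b \<Rightarrow> 'd set" and S1 :: "'b \<Rightarrow> 'd \<Rightarrow> 'n set" and \<psi>1 :: "'b \<Rightarrow> 'd \<Rightarrow> 'n \<Rightarrow> 'd"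
    and T1 :: "'b \<Rightarrow> 'd set" and b1 :: "'b \<Rightarrow> 'd \<times> 'c set \<Rightarrow> 'n \<rightharpoonup> bool"
    and d1 :: "'b \<Rightarrow> 'd \<times> 'c set \<Rightarrow> 'd \<rightharpoonup> bool" and h1 :: "'b \<Rightarrow> ('d \<times> 'c set) set"
  assumes V: "V y x \<subseteq> Pow (Field s)"
    and a: "u \<in> V y x \<Longrightarrow> a y x u \<in> Fn s N" "u \<in> V y x \<Longrightarrow> g y x (a y x u)"
    and V_dense: "r \<in> Fn s N \<Longrightarrow> g y x r \<Longrightarrow> \<exists>u\<in>V y x. agree (a y x u) r"
    and B1: "i \<in> Field k \<Longrightarrow> B1 i \<subseteq> B i"
    and U1: "i \<in> Field k \<Longrightarrow> uniform_family (T i) (T i \<times> Pow (Field s))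
      (\<lambda>x (y, u). if u \<in> V y x then a y x u else Map.empty) (\<lambda>x. {(y, u). u \<in> V y x})
      (B1 i) (S1 i) (\<psi>1 i) (T1 i) (b1 i) (d1 i) (h1 i)"

lemma (in block_system) ex_block_system1:
  "\<exists>a V B1 S1 \<psi>1 T1 b1 d1 h1. block_system1 k s N T B g p Q a V B1 S1 \<psi>1 T1 b1 d1 h1"
proof -
  define R where "R y x w \<longleftrightarrow> (case w of (a, V) \<Rightarrow> V \<subseteq> Pow (Field s) \<and> (\<forall>u\<in>V. a u \<in> {r \<in> Fn s N. g y x r}) \<and>
      (\<forall>r\<in>{r \<in> Fn s N. g y x r}. \<exists>u\<in>V. agree (a u) r))" for y x and w :: "('c set \<Rightarrow> 'n \<rightharpoonup> bool) \<times> 'c set set"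
  have "\<exists>w. R y x w" for y x
    using Fn_predense[OF s(1), of "{r \<in> Fn s N. g y x r}" N] unfolding R_def by fast
  then obtain w where w: "\<And>y x. R y x (w y x)"
    by metis
  define a where "a y x = fst (w y x)" for y x
  define V where "V y x = snd (w y x)" for y x
  have aV: "V y x \<subseteq> Pow (Field s)" "\<forall>u\<in>V y x. a y x u \<in> {r \<in> Fn s N. g y x r}"
    "\<forall>r\<in>{r \<in> Fn s N. g y x r}. \<exists>u\<in>V y x. agree (a y x u) r" for x y
    using w[of y x] by (simp_all add: R_def a_def V_def case_prod_beta)
  \<comment> \<open>Indices outside \<open>V y x\<close> get the empty condition, which makes
    \<open>f\<close> total on the keys; \<open>h\<close> records the genuine indices, so that these
    too become the same for all \<open>x\<close> of the block.\<close>
  define f where "f = (\<lambda>x (y, u). if u \<in> V y x then a y x u else Map.empty)"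
  define h where "h = (\<lambda>x. {(y, u). u \<in> V y x})"
  have ex: "\<exists>B' S \<psi> T0 b d h0. B' \<subseteq> B i \<and> uniform_family (T i) (T i \<times> Pow (Field s)) f h B' S \<psi> T0 b d h0"
    if i: "i \<in> Field k" for i
  proof (rule uniformize[OF T(1)[OF i] _ B_large[OF i]])
    show "|T i \<times> Pow (Field s)| \<le>o |T i|"
      by (intro card_of_Times_le T T_T i)
    show "|dom (f x key)| \<le>o |T i|" if "key \<in> T i \<times> Pow (Field s)" for x key
      using aV(2) i by (auto simp: f_def card_of_empty split: prod.splits intro!: Fn_dom_le[OF conjunct2[OF s(1)] _ s_T])
  qed
  obtain B1 S1 \<psi>1 T1 b1 d1 h1 where U: "\<And>i. i \<in> Field k \<Longrightarrow> B1 i \<subseteq> B i \<and>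
      uniform_family (T i) (T i \<times> Pow (Field s)) f h (B1 i) (S1 i) (\<psi>1 i) (T1 i) (b1 i) (d1 i) (h1 i)"
    using ex by metis
  have "block_system1 k s N T B g p Q a V B1 S1 \<psi>1 T1 b1 d1 h1"
    by unfold_locales (use aV U in \<open>simp_all add: f_def h_def\<close>)
  then show ?thesis
    by blast
qed

section \<open>Virtual coordinates and the data of the second uniformization\<close>

context block_system1
begin

lemma U1D:
  assumes "i \<in> Field k"
  shows "x \<in> B1 i \<Longrightarrow> y \<in> B1 i \<Longrightarrow> x \<noteq> y \<Longrightarrow> S1 i x \<inter> S1 i y = {}"
    and "x \<in> B1 i \<Longrightarrow> inj_on (\<psi>1 i x) (S1 i x)"
    and "x \<in> B1 i \<Longrightarrow> \<psi>1 i x ` S1 i x = T1 i" and "T1 i \<subseteq> T i"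
    and "dom (d1 i key) \<subseteq> T1 i"
  using uniform_familyD(2,4,5,6,9)[OF U1[OF assms]] by blast+

lemma U1_surj:
  assumes "i \<in> Field k" "x \<in> B1 i" "t \<in> T1 i"
  obtains m where "m \<in> S1 i x" "\<psi>1 i x m = t"
proof -
  have "t \<in> \<psi>1 i x ` S1 i x"
    using U1D(3)[OF assms(1,2)] assms(3) by simp
  then show thesis
    using that by blast
qed

lemma B1_ne: "i \<in> Field k \<Longrightarrow> B1 i \<noteq> {}"
  using uniform_familyD(1)[OF U1] not_card_less card_of_empty by metis

lemma h1_iff:
  assumes "i \<in> Field k" "x \<in> B1 i" "y \<in> T i"
  shows "(y, u) \<in> h1 i \<longleftrightarrow> u \<in> V y x"
  using uniform_familyD(10)[OF U1[OF assms(1)] assms(2)] assms(3) V by blast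

lemma a_eq:
  assumes "i \<in> Field k" "x \<in> B1 i" "y \<in> T i" "u \<in> V y x"
  shows "a y x u m = (if m \<in> S1 i x then d1 i (y, u) (\<psi>1 i x m) else b1 i (y, u) m)"
    and "dom (b1 i (y, u)) \<inter> S1 i x = {}"
proof -
  have key: "(y, u) \<in> T i \<times> Pow (Field s)"
    using assms V by blast
  show "a y x u m = (if m \<in> S1 i x then d1 i (y, u) (\<psi>1 i x m) else b1 i (y, u) m)"
    using uniform_familyD(7)[OF U1[OF assms(1)] assms(2) key] assms(4) by simp
  show "dom (b1 i (y, u)) \<inter> S1 i x = {}"
    by (rule uniform_familyD(8)[OF U1[OF assms(1)] assms(2) key])
qed

lemma S1_N:
  assumes "i \<in> Field k" "x \<in> B1 i"
  shows "S1 i x \<subseteq> N"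
proof
  fix m assume "m \<in> S1 i x"
  then obtain key where "m \<in> dom ((\<lambda>(y, u). if u \<in> V y x then a y x u else Map.empty) key)"
    using uniform_familyD(3)[OF U1[OF assms(1)] assms(2)] by blast
  moreover obtain y u where "key = (y, u)"
    by (cases key)
  ultimately show "m \<in> N"
    using a(1)[of u y x] by (auto simp: Fn_def split: if_splits)
qed

text \<open>Conditions with real coordinates in \<open>N\<close> and virtual coordinates \<open>(i, t)\<close>, which stand for
  the private coordinates of a generic element of the block \<open>i\<close>.\<close>

definition N2 :: "('n + 'b \<times> 'd) set" where
  "N2 = {w. \<forall>m. w = Inl m \<longrightarrow> m \<in> N}"

text \<open>The condition \<open>a y x u\<close> with the private coordinates of \<open>x\<close>
  replaced by virtual ones. By \<open>a_eq\<close> it is the same for all \<open>x\<close> in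
  \<open>B1 i\<close>, hence a datum of \<open>y\<close> and the block \<open>i\<close>.\<close>

definition F :: "'b \<Rightarrow> 'd \<Rightarrow> 'c set \<Rightarrow> 'n + 'b \<times> 'd \<rightharpoonup> bool" where
  "F i y u w = (case w of Inl m \<Rightarrow> b1 i (y, u) m | Inr (i', t) \<Rightarrow> if i' = i then d1 i (y, u) t else None)"

lemma less_s_Un: "|A| <o s \<Longrightarrow> |A'| <o s \<Longrightarrow> |A \<union> A'| <o s"
  by (rule Un_Cinfinite_bound_strict[OF _ _ s(1)])

lemma less_s_image: "|A| <o s \<Longrightarrow> |f ` A| <o s"
  by (rule ordLeq_ordLess_trans[OF card_of_image])

lemma less_s_mono: "A \<subseteq> A' \<Longrightarrow> |A'| <o s \<Longrightarrow> |A| <o s"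
  by (rule ordLeq_ordLess_trans[OF card_of_mono1])

lemma pairs_less:
  assumes "I \<subseteq> Field k \<times> Field k"
  shows "|I| <o s"
proof -
  have "|Field k \<times> Field k| \<le>o |Field k|"
    by (intro card_of_Times_le k ordIso_imp_ordLeq[OF card_of_refl])
  then show ?thesis
    using k(2) by (rule ordLeq_ordLess_trans[OF ordLeq_transitive[OF card_of_mono1[OF assms]]])
qed

lemma F_Fn:
  assumes "i \<in> Field k" "y \<in> T i" "(y, u) \<in> h1 i"
  shows "F i y u \<in> Fn s N2"
proof -
  obtain x where x: "x \<in> B1 i"
    using B1_ne[OF assms(1)] by blast
  have u: "u \<in> V y x"
    using h1_iff[OF assms(1) x assms(2)] assms(3) by blast
  note a_x = a_eq[OF assms(1) x assms(2) u]
  let ?D = "dom (a y x u)"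
  have dom: "dom (F i y u) \<subseteq> Inl ` ?D \<union> (\<lambda>m. Inr (i, \<psi>1 i x m)) ` ?D"
  proof
    fix w assume w: "w \<in> dom (F i y u)"
    show "w \<in> Inl ` ?D \<union> (\<lambda>m. Inr (i, \<psi>1 i x m)) ` ?D"
    proof (cases w)
      case (Inl m)
      then have b1: "m \<in> dom (b1 i (y, u))"
        using w by (simp add: F_def domIff)
      then have "m \<notin> S1 i x"
        using a_x(2) by blast
      then have "m \<in> ?D"
        using b1 a_x(1)[of m] by (simp add: domIff)
      then show ?thesis
        by (simp add: Inl)
    next
      case (Inr v)
      obtain i' t where v: "v = (i', t)"
        by (cases v)
      then have t: "i' = i" "t \<in> dom (d1 i (y, u))"
        using w by (auto simp: F_def Inr split: if_splits)
      then obtain m where "m \<in> S1 i x" "\<psi>1 i x m = t"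
        using U1_surj[OF assms(1) x] U1D(5)[OF assms(1)] by blast
      moreover from this have "m \<in> ?D"
        using a_x(1)[of m] t(2) by (simp add: domIff)
      ultimately show ?thesis
        using t(1) by (auto simp: Inr v)
    qed
  qed
  have D: "|?D| <o s" "?D \<subseteq> N"
    using a(1)[OF u] by (auto simp: Fn_def)
  have "|dom (F i y u)| <o s"
    by (intro less_s_mono[OF dom] less_s_Un less_s_image D)
  moreover have "Inl ` ?D \<union> (\<lambda>m. Inr (i, \<psi>1 i x m)) ` ?D \<subseteq> N2"
    using D(2) by (auto simp: N2_def)
  then have "dom (F i y u) \<subseteq> N2"
    using dom by (rule subset_trans[rotated])
  ultimately show ?thesis
    by (simp add: Fn_def)
qed

text \<open>A larger block \<open>i\<close> contributes one key for each index \<open>u\<close>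
  instead of one for each of its points and indices; this keeps the number of keys at most |T
  j|.\<close>

definition K2 :: "'b \<Rightarrow> ('b, 'c, 'd) key set" where
  "K2 j = {Init, Kind} \<union> {Green i u |i u. j \<in> underS k i \<and> u \<subseteq> Field s} \<union> Pos ` T1 j"

text \<open>For \<open>Pos\<close>, as for \<open>Kind\<close> in \<open>f2\<close>, the value
  \<open>True\<close> is a mere marker, the partial function standing for a set of coordinates.
  \<open>Pos t\<close> shows the second uniformization which coordinate the first one has put at
  position \<open>t\<close>.\<close>

definition f2' :: "'b \<Rightarrow> 'd \<Rightarrow> ('b, 'c, 'd) key \<Rightarrow> 'n + 'b \<times> 'd \<rightharpoonup> bool" where
  "f2' j x key = (case key of
      Init \<Rightarrow> case_sum (p j x) Map.empty
    | Green i u \<Rightarrow> if (x, u) \<in> h1 i then F i x u else Map.empty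
    | Pos t \<Rightarrow> [Inl (inv_into (S1 j x) (\<psi>1 j x) t) \<mapsto> True]
    | Kind \<Rightarrow> Map.empty)"

text \<open>\<open>Kind\<close> marks the real ones among the coordinates of all other keys; it is
  empty in \<open>f2'\<close>, so that their union can be formed first.\<close>

definition f2 :: "'b \<Rightarrow> 'd \<Rightarrow> ('b, 'c, 'd) key \<Rightarrow> 'n + 'b \<times> 'd \<rightharpoonup> bool" where
  "f2 j x key = (if key = Kind then (\<lambda>w. if isl w \<and> w \<in> (\<Union>key\<in>K2 j. dom (f2' j x key)) then Some True else None)
    else f2' j x key)"

definition h2' :: "'d \<Rightarrow> ('b, 'c, 'd) key set" where
  "h2' x = {Green i u |i u. (x, u) \<in> h1 i}"

lemma f2'_Fn:
  assumes "j \<in> Field k" "x \<in> B1 j" "key \<in> K2 j"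
  shows "f2' j x key \<in> Fn s N2"
proof -
  from assms(3) consider "key = Init" | "key = Kind" | i u where "key = Green i u" "j \<in> underS k i"
    | t where "key = Pos t" "t \<in> T1 j"
    by (auto simp: K2_def)
  then show ?thesis
  proof cases
    case 1
    have dom: "dom (case_sum (p j x) Map.empty) = Inl ` dom (p j x)"
    proof (rule set_eqI)
      fix w show "w \<in> dom (case_sum (p j x) Map.empty) \<longleftrightarrow> w \<in> Inl ` dom (p j x)"
        by (cases w) auto
    qed
    have "p j x \<in> Fn s N"
      by (rule p[OF assms(1)]) (use B1[OF assms(1)] assms(2) in blast)
    then have "Inl ` dom (p j x) \<subseteq> N2" "|Inl ` dom (p j x) :: ('n + 'b \<times> 'd) set| <o s"
      by (auto simp: Fn_def N2_def intro: less_s_image)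
    then show ?thesis
      by (simp add: 1 f2'_def Fn_def dom)
  next
    case (3 i u)
    have "x \<in> T i"
      using B_T[OF 3(2)] B1[OF assms(1)] assms(2) by blast
    then show ?thesis
      using F_Fn[of i x u] underS_Field(2)[OF 3(2)] finite_less[OF s(1), of "{}"]
      by (auto simp: 3 f2'_def Fn_def)
  next
    case (4 t)
    have "inv_into (S1 j x) (\<psi>1 j x) t \<in> N"
      using S1_N[OF assms(1,2)] inv_into_into[of t "\<psi>1 j x" "S1 j x"] U1D(3)[OF assms(1,2)] 4(2) by blast
    moreover have "|{Inl (inv_into (S1 j x) (\<psi>1 j x) t)} :: ('n + 'b \<times> 'd) set| <o s"
      by (rule finite_less[OF s(1)]) simp
    ultimately show ?thesis
      by (simp add: 4 f2'_def Fn_def N2_def)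
  qed (use finite_less[OF s(1), of "{}"] in \<open>auto simp: f2'_def Fn_def\<close>)
qed

lemma f2_dom:
  assumes "key \<in> K2 j"
  shows "dom (f2 j x key) \<subseteq> (\<Union>key\<in>K2 j. dom (f2' j x key))"
  using assms by (auto simp: f2_def split: if_splits)

lemma K2_le:
  assumes j: "j \<in> Field k"
  shows "|K2 j| \<le>o |T j|"
proof -
  have sub: "{Green i u |i u. j \<in> underS k i \<and> u \<subseteq> Field s} \<subseteq> (\<lambda>(i, u). Green i u :: ('b, 'c, 'd) key) ` (Field k \<times> Pow (Field s))"
    by (auto simp: underS_Field)
  have le: "|Field k \<times> Pow (Field s)| \<le>o |T j|"
    by (intro card_of_Times_le T j less_s_T k)
  have "|{Green i u |i u. j \<in> underS k i \<and> u \<subseteq> Field s} :: ('b, 'c, 'd) key set| \<le>o |T j|"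
    by (rule ordLeq_transitive[OF card_of_mono1[OF sub] ordLeq_transitive[OF card_of_image le]])
  moreover have "|Pos ` T1 j :: ('b, 'c, 'd) key set| \<le>o |T j|"
    by (rule ordLeq_transitive[OF card_of_image card_of_mono1[OF U1D(4)[OF j]]])
  moreover have "|{Init, Kind} :: ('b, 'c, 'd) key set| \<le>o |T j|"
    by (rule finite_ordLeq_infinite[OF _ T(1)[OF j]]) simp
  ultimately show ?thesis
    unfolding K2_def by (intro card_of_Un_le[OF T(1)[OF j]])
qed

end

text \<open>Second uniformization: the points of a block all look the same to the larger blocks.\<close>

locale block_system2 = block_system1 k s N T B g p Q a V B1 S1 \<psi>1 T1 b1 d1 h1
  for k :: "'b rel" and s :: "'c rel" and N :: "'n set"
    and T :: "'b \<Rightarrow> 'd set" and B g p Q a V B1 S1 \<psi>1 T1 b1 d1 h1 +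
  fixes B2 :: "'b \<Rightarrow> 'd set" and S2 :: "'b \<Rightarrow> 'd \<Rightarrow> ('n + 'b \<times> 'd) set"
    and \<psi>2 :: "'b \<Rightarrow> 'd \<Rightarrow> 'n + 'b \<times> 'd \<Rightarrow> 'd"
    and T2 :: "'b \<Rightarrow> 'd set" and b2 :: "'b \<Rightarrow> ('b, 'c, 'd) key \<Rightarrow> 'n + 'b \<times> 'd \<rightharpoonup> bool"
    and d2 :: "'b \<Rightarrow> ('b, 'c, 'd) key \<Rightarrow> 'd \<rightharpoonup> bool" and h2 :: "'b \<Rightarrow> ('b, 'c, 'd) key set"
  assumes B2: "i \<in> Field k \<Longrightarrow> B2 i \<subseteq> B1 i"
    and U2: "i \<in> Field k \<Longrightarrow> uniform_family (T i) (K2 i) (f2 i) h2'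
      (B2 i) (S2 i) (\<psi>2 i) (T2 i) (b2 i) (d2 i) (h2 i)"

lemma (in block_system1) ex_block_system2:
  "\<exists>B2 S2 \<psi>2 T2 b2 d2 h2. block_system2 k s N T B g p Q a V B1 S1 \<psi>1 T1 b1 d1 h1 B2 S2 \<psi>2 T2 b2 d2 h2"
proof -
  have ex: "\<exists>B' S \<psi> T0 b d h0. B' \<subseteq> B1 i \<and> uniform_family (T i) (K2 i) (f2 i) h2' B' S \<psi> T0 b d h0"
    if i: "i \<in> Field k" for i
  proof (rule uniformize[OF T(1)[OF i] K2_le[OF i] uniform_familyD(1)[OF U1[OF i]]])
    fix x key assume x: "x \<in> B1 i" and key: "key \<in> K2 i"
    have "|\<Union>key\<in>K2 i. dom (f2' i x key)| \<le>o |T i|"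
      by (intro card_of_UNION_ordLeq_infinite T K2_le i ballI Fn_dom_le[OF conjunct2[OF s(1)] f2'_Fn s_T] x)
    then show "|dom (f2 i x key)| \<le>o |T i|"
      by (rule ordLeq_transitive[OF card_of_mono1[OF f2_dom[OF key]]])
  qed
  obtain B2 S2 \<psi>2 T2 b2 d2 h2 where U: "\<And>i. i \<in> Field k \<Longrightarrow> B2 i \<subseteq> B1 i \<and>
      uniform_family (T i) (K2 i) (f2 i) h2' (B2 i) (S2 i) (\<psi>2 i) (T2 i) (b2 i) (d2 i) (h2 i)"
    using ex by metis
  have "block_system2 k s N T B g p Q a V B1 S1 \<psi>1 T1 b1 d1 h1 B2 S2 \<psi>2 T2 b2 d2 h2"
    by unfold_locales (use U in simp_all)
  then show ?thesis
    by blast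
qed

section \<open>Conditions in terms of positions, and their instances at points\<close>

context block_system2
begin

lemma U2D:
  assumes "i \<in> Field k"
  shows "x \<in> B2 i \<Longrightarrow> y \<in> B2 i \<Longrightarrow> x \<noteq> y \<Longrightarrow> S2 i x \<inter> S2 i y = {}"
    and "x \<in> B2 i \<Longrightarrow> inj_on (\<psi>2 i x) (S2 i x)"
    and "x \<in> B2 i \<Longrightarrow> \<psi>2 i x ` S2 i x = T2 i" and "T2 i \<subseteq> T i"
    and "dom (d2 i key) \<subseteq> T2 i"
  using uniform_familyD(2,4,5,6,9)[OF U2[OF assms]] by blast+

lemma U2_surj:
  assumes "i \<in> Field k" "x \<in> B2 i" "d2 i key \<tau> \<noteq> None"
  obtains w where "w \<in> S2 i x" "\<psi>2 i x w = \<tau>"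
proof -
  have "\<tau> \<in> T2 i"
    using U2D(5)[OF assms(1), of key] assms(3) by blast
  then have "\<tau> \<in> \<psi>2 i x ` S2 i x"
    using U2D(3)[OF assms(1,2)] by simp
  then show thesis
    using that by blast
qed

lemma f2_eq:
  assumes "i \<in> Field k" "x \<in> B2 i" "key \<in> K2 i"
  shows "f2 i x key w = (if w \<in> S2 i x then d2 i key (\<psi>2 i x w) else b2 i key w)"
    and "dom (b2 i key) \<inter> S2 i x = {}"
  by (rule uniform_familyD(7,8)[OF U2[OF assms(1)] assms(2,3)])+

lemma B2_other:
  assumes "i \<in> Field k"
  obtains y where "y \<in> B2 i" "y \<noteq> x"
proof -
  have "infinite (B2 i)"
    by (rule card_of_ordLeq_infinite[OF ordLess_imp_ordLeq[OF uniform_familyD(1)[OF U2[OF assms]]]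
        infinite_Pow[OF T(1)[OF assms]]])
  then have "\<not> B2 i \<subseteq> {x}"
    using finite_subset by blast
  then show thesis
    using that by blast
qed

lemma f2_key: "key \<noteq> Kind \<Longrightarrow> f2 i x key = f2' i x key"
  by (simp add: f2_def)

lemma Init_K2: "Init \<in> K2 i" and Kind_K2: "Kind \<in> K2 i" and Pos_K2: "t \<in> T1 i \<Longrightarrow> Pos t \<in> K2 i"
  and Green_K2: "j \<in> underS k i \<Longrightarrow> u \<subseteq> Field s \<Longrightarrow> Green i u \<in> K2 j"
  by (auto simp: K2_def)

lemma S2_dom:
  assumes "i \<in> Field k" "x \<in> B2 i" "w \<in> S2 i x"
  shows "\<exists>key\<in>K2 i. w \<in> dom (f2' i x key)"
proof -
  obtain key where key: "key \<in> K2 i" "w \<in> dom (f2 i x key)"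
    using uniform_familyD(3)[OF U2[OF assms(1)] assms(2)] assms(3) by blast
  then show ?thesis
    using subsetD[OF f2_dom[OF key(1)] key(2)] by blast
qed

lemma S2_N:
  assumes "i \<in> Field k" "x \<in> B2 i" "Inl m \<in> S2 i x"
  shows "m \<in> N"
proof -
  obtain key where key: "key \<in> K2 i" "Inl m \<in> dom (f2' i x key)"
    using S2_dom[OF assms] by blast
  have "x \<in> B1 i"
    using B2[OF assms(1)] assms(2) by blast
  from f2'_Fn[OF assms(1) this key(1)] have "dom (f2' i x key) \<subseteq> N2"
    by (simp add: Fn_def)
  then show ?thesis
    using key(2) by (auto simp: N2_def)
qed

lemma Kind_iff:
  assumes "i \<in> Field k" "x \<in> B2 i" "w \<in> S2 i x"
  shows "d2 i Kind (\<psi>2 i x w) \<noteq> None \<longleftrightarrow> isl w"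
  using f2_eq(1)[OF assms(1,2) Kind_K2, of w] S2_dom[OF assms] assms(3)
  by (cases "isl w") (auto simp: f2_def dest: sym)

text \<open>Takes a position of the first uniformization to the position of the same coordinate in
  the second; for \<open>t\<close> in \<open>T1 i\<close> the marker \<open>d2 i (Pos t)\<close> is
  defined at exactly one place.\<close>

definition \<eta> :: "'b \<Rightarrow> 'd \<Rightarrow> 'd" where
  "\<eta> i t = (THE \<tau>. d2 i (Pos t) \<tau> \<noteq> None)"

text \<open>If the coordinate marked by \<open>Pos\<close> were not private, it would be marked for
  another point \<open>y\<close> of the block too and so lie in \<open>S1 i y\<close>, which is
  disjoint from \<open>S1 i x\<close>. Its position is the only place where the common marker
  \<open>d2 i (Pos t)\<close> is defined, and so does not depend on \<open>x\<close>.\<close>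

lemma Pos_S2:
  assumes i: "i \<in> Field k" and x: "x \<in> B2 i" and m: "m \<in> S1 i x"
  shows "Inl m \<in> S2 i x" "\<psi>2 i x (Inl m) = \<eta> i (\<psi>1 i x m)"
proof -
  let ?t = "\<psi>1 i x m"
  have x1: "x \<in> B1 i"
    using B2[OF i] x by blast
  have t: "?t \<in> T1 i"
    using U1D(3)[OF i x1] m by blast
  have f2: "f2 i y (Pos ?t) w = (if w = Inl (inv_into (S1 i y) (\<psi>1 i y) ?t) then Some True else None)" for y w
    by (simp add: f2_key f2'_def)
  have inv: "inv_into (S1 i x) (\<psi>1 i x) ?t = m"
    by (rule inv_into_f_f[OF U1D(2)[OF i x1] m])
  show S2: "Inl m \<in> S2 i x"
  proof (rule ccontr)
    assume "Inl m \<notin> S2 i x"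
    then have b: "b2 i (Pos ?t) (Inl m) = Some True"
      using f2_eq(1)[OF i x Pos_K2[OF t], of "Inl m"] f2[of x "Inl m"] inv by simp
    obtain y where y: "y \<in> B2 i" "y \<noteq> x"
      using B2_other[OF i] .
    have y1: "y \<in> B1 i"
      using B2[OF i] y by blast
    have "Inl m \<notin> S2 i y"
      using f2_eq(2)[OF i y(1) Pos_K2[OF t]] b by blast
    then have "inv_into (S1 i y) (\<psi>1 i y) ?t = m"
      using f2_eq(1)[OF i y(1) Pos_K2[OF t], of "Inl m"] f2[of y "Inl m"] b by (simp split: if_splits)
    then have "m \<in> S1 i y"
      using inv_into_into[of ?t "\<psi>1 i y" "S1 i y"] U1D(3)[OF i y1] t by simp
    then show False
      using U1D(1)[OF i y1 x1 y(2)] m by blast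
  qed
  have "d2 i (Pos ?t) \<tau> \<noteq> None \<longleftrightarrow> \<tau> = \<psi>2 i x (Inl m)" for \<tau>
  proof
    assume \<tau>: "d2 i (Pos ?t) \<tau> \<noteq> None"
    obtain w where w: "w \<in> S2 i x" "\<psi>2 i x w = \<tau>"
      using U2_surj[OF i x \<tau>] .
    then have "w = Inl m"
      using f2_eq(1)[OF i x Pos_K2[OF t], of w] f2[of x w] inv \<tau> by (simp split: if_splits)
    with w show "\<tau> = \<psi>2 i x (Inl m)"
      by simp
  next
    assume "\<tau> = \<psi>2 i x (Inl m)"
    then have "d2 i (Pos ?t) \<tau> = f2 i x (Pos ?t) (Inl m)"
      using f2_eq(1)[OF i x Pos_K2[OF t], of "Inl m"] S2 by simp
    also have "\<dots> = Some True"
      unfolding f2 inv by simp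
    finally show "d2 i (Pos ?t) \<tau> \<noteq> None"
      by simp
  qed
  then show "\<psi>2 i x (Inl m) = \<eta> i ?t"
    unfolding \<eta>_def by simp
qed

lemma inj_\<eta>:
  assumes i: "i \<in> Field k"
  shows "inj_on (\<eta> i) (T1 i)"
proof (rule inj_onI)
  fix t t' assume t: "t \<in> T1 i" "t' \<in> T1 i" "\<eta> i t = \<eta> i t'"
  obtain x where x: "x \<in> B2 i"
    using B2_other[OF i] .
  have x1: "x \<in> B1 i"
    using B2[OF i] x by blast
  obtain m m' where m: "m \<in> S1 i x" "\<psi>1 i x m = t" "m' \<in> S1 i x" "\<psi>1 i x m' = t'"
    using U1_surj[OF i x1 t(1)] U1_surj[OF i x1 t(2)] by metis
  then have "\<psi>2 i x (Inl m) = \<psi>2 i x (Inl m')"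
    using Pos_S2(2)[OF i x] t(3) by simp
  then have "m = m'"
    using inj_onD[OF U2D(2)[OF i x]] Pos_S2(1)[OF i x] m(1,3) by fastforce
  with m show "t = t'"
    by simp
qed

lemma Green_iff:
  assumes "j \<in> underS k i" "x \<in> B2 j" "u \<subseteq> Field s"
  shows "Green i u \<in> h2 j \<longleftrightarrow> (x, u) \<in> h1 i"
proof -
  have "h2' x \<inter> K2 j = h2 j"
    by (rule uniform_familyD(10)[OF U2[OF underS_Field(1)[OF assms(1)]] assms(2)])
  then show ?thesis
    using Green_K2[OF assms(1,3)] by (auto simp: h2'_def)
qed

lemma F_eq:
  assumes "j \<in> underS k i" "x \<in> B2 j" "u \<subseteq> Field s" "Green i u \<in> h2 j"
  shows "F i x u w = (if w \<in> S2 j x then d2 j (Green i u) (\<psi>2 j x w) else b2 j (Green i u) w)"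
    and "dom (b2 j (Green i u)) \<inter> S2 j x = {}"
proof -
  note j = underS_Field(1)[OF assms(1)]
  have "(x, u) \<in> h1 i"
    using Green_iff assms by blast
  then show "F i x u w = (if w \<in> S2 j x then d2 j (Green i u) (\<psi>2 j x w) else b2 j (Green i u) w)"
    using f2_eq(1)[OF j assms(2) Green_K2[OF assms(1,3)], of w] by (simp add: f2_key f2'_def)
  show "dom (b2 j (Green i u)) \<inter> S2 j x = {}"
    by (rule f2_eq(2)[OF j assms(2) Green_K2[OF assms(1,3)]])
qed

text \<open>
  \<open>\<Theta> j i u\<close> is the part of the condition \<open>a y x u\<close>, for \<open>y\<close> in block \<open>j\<close> and \<open>x\<close> in block \<open>i\<close>, that
  concerns common coordinates or those of \<open>y\<close> or \<open>x\<close> alone, expressed by their positions.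
\<close>

definition \<Theta> :: "'b \<Rightarrow> 'b \<Rightarrow> 'c set \<Rightarrow> 'n + 'b \<times> 'd \<rightharpoonup> bool" where
  "\<Theta> j i u w = (case w of
      Inl m \<Rightarrow> b2 j (Green i u) (Inl m)
    | Inr (i', \<tau>) \<Rightarrow>
        if i' = i then if \<tau> \<in> \<eta> i ` T1 i then b2 j (Green i u) (Inr (i, inv_into (T1 i) (\<eta> i) \<tau>)) else None
        else if i' = j \<and> d2 j Kind \<tau> \<noteq> None then d2 j (Green i u) \<tau> else None)"

lemma \<Theta>_Inr: "i \<in> Field k \<Longrightarrow> t \<in> T1 i \<Longrightarrow> \<Theta> j i u (Inr (i, \<eta> i t)) = b2 j (Green i u) (Inr (i, t))"
  by (simp add: \<Theta>_def inv_into_f_f[OF inj_\<eta>])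

lemma \<Theta>_Fn:
  assumes ji: "j \<in> underS k i" and u: "u \<subseteq> Field s" "Green i u \<in> h2 j"
  shows "\<Theta> j i u \<in> Fn s N2"
proof -
  note i = underS_Field(2)[OF ji] and j = underS_Field(1)[OF ji]
  obtain x where x: "x \<in> B2 j"
    using B2_other[OF j] .
  have xT: "x \<in> T i"
    using B_T[OF ji] B1[OF j] B2[OF j] x by blast
  have Fn: "F i x u \<in> Fn s N2"
    by (rule F_Fn[OF i xT]) (use Green_iff[OF ji x u(1)] u(2) in blast)
  note Fx = F_eq[OF ji x u]
  let ?D = "dom (F i x u)"
  \<comment> \<open>Every coordinate of \<open>\<Theta> j i u\<close> is a renamed coordinate of
    \<open>F i x u\<close> for one fixed \<open>x\<close>, so the domain stays small.\<close>
  have dom: "dom (\<Theta> j i u) \<subseteq> ?D \<union> (\<lambda>w. Inr (i, \<eta> i (snd (projr w)))) ` ?D \<union> (\<lambda>w. Inr (j, \<psi>2 j x w)) ` ?D"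
  proof
    fix w assume w: "w \<in> dom (\<Theta> j i u)"
    consider m where "w = Inl m" | \<tau> where "w = Inr (i, \<tau>)" | \<tau> where "w = Inr (j, \<tau>)" "i \<noteq> j"
      using w by (cases w) (auto simp: \<Theta>_def split: if_splits)
    then show "w \<in> ?D \<union> (\<lambda>w. Inr (i, \<eta> i (snd (projr w)))) ` ?D \<union> (\<lambda>w. Inr (j, \<psi>2 j x w)) ` ?D"
    proof cases
      case (1 m)
      then have b2: "w \<in> dom (b2 j (Green i u))"
        using w by (simp add: \<Theta>_def domIff)
      then have "w \<notin> S2 j x"
        using Fx(2) by blast
      then have "w \<in> ?D"
        using b2 Fx(1)[of w] by (simp add: domIff)
      then show ?thesis
        by blast
    next
      case (2 \<tau>)
      then obtain t where t: "t \<in> T1 i" "\<tau> = \<eta> i t"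
        using w by (auto simp: \<Theta>_def split: if_splits)
      then have "Inr (i, t) \<in> dom (b2 j (Green i u))"
        using w 2 \<Theta>_Inr[OF i t(1), of j u] by (simp add: domIff)
      note t = t this
      then have "Inr (i, t) \<in> ?D"
        using Fx(1)[of "Inr (i, t)"] Fx(2) by (auto simp: domIff)
      then show ?thesis
        using 2 t(2) by force
    next
      case (3 \<tau>)
      then have \<tau>: "\<tau> \<in> dom (d2 j (Green i u))"
        using w by (auto simp: \<Theta>_def split: if_splits)
      then obtain w' where w': "w' \<in> S2 j x" "\<psi>2 j x w' = \<tau>"
        using U2_surj[OF j x, of "Green i u"] by blast
      then have "w' \<in> ?D"
        using Fx(1)[of w'] \<tau> by (simp add: domIff)
      then show ?thesis
        using 3 w' by blast
    qed
  qed
  have D: "|?D| <o s" "?D \<subseteq> N2"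
    using Fn by (auto simp: Fn_def)
  have "|dom (\<Theta> j i u)| <o s"
    by (intro less_s_mono[OF dom] less_s_Un less_s_image D)
  moreover have "?D \<union> (\<lambda>w. Inr (i, \<eta> i (snd (projr w)))) ` ?D \<union> (\<lambda>w. Inr (j, \<psi>2 j x w)) ` ?D \<subseteq> N2"
    using D(2) by (auto simp: N2_def)
  then have "dom (\<Theta> j i u) \<subseteq> N2"
    using dom by (rule subset_trans[rotated])
  ultimately show ?thesis
    by (simp add: Fn_def)
qed

text \<open>The instance of \<open>z\<close> at \<open>x\<close>: the point \<open>x\<close> plays
  the generic point of block \<open>i\<close>, and its private coordinates take their values from
  their virtual positions. Virtual coordinates of other blocks are ignored.\<close>

definition cond :: "('n + 'b \<times> 'd \<rightharpoonup> bool) \<Rightarrow> 'b \<Rightarrow> 'd \<Rightarrow> 'n \<rightharpoonup> bool" where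
  "cond z i x m = (if Inl m \<in> S2 i x then z (Inr (i, \<psi>2 i x (Inl m))) else z (Inl m))"

lemma cond_mono: "z \<subseteq>\<^sub>m z' \<Longrightarrow> cond z i x \<subseteq>\<^sub>m cond z' i x"
  by (rule map_leI) (auto simp: cond_def map_leD split: if_splits)

lemma cond_Fn:
  assumes i: "i \<in> Field k" and x: "x \<in> B2 i" and z: "z \<in> Fn s N2"
  shows "cond z i x \<in> Fn s N"
proof -
  let ?inv = "\<lambda>w. projl (inv_into (S2 i x) (\<psi>2 i x) (snd (projr w)))"
  have "dom (cond z i x) \<subseteq> projl ` dom z \<union> ?inv ` dom z"
  proof
    fix m assume m: "m \<in> dom (cond z i x)"
    show "m \<in> projl ` dom z \<union> ?inv ` dom z"
    proof (cases "Inl m \<in> S2 i x")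
      case True
      then have "Inr (i, \<psi>2 i x (Inl m)) \<in> dom z" "?inv (Inr (i, \<psi>2 i x (Inl m))) = m"
        using m inv_into_f_f[OF U2D(2)[OF i x] True] by (auto simp: cond_def)
      then show ?thesis
        by (metis UnI2 image_eqI)
    next
      case False
      then have "Inl m \<in> dom z"
        using m by (auto simp: cond_def)
      then show ?thesis
        by force
    qed
  qed
  moreover have "|projl ` dom z \<union> ?inv ` dom z| <o s"
    using z by (intro less_s_Un less_s_image) (simp_all add: Fn_def)
  moreover have "dom (cond z i x) \<subseteq> N"
  proof
    fix m assume "m \<in> dom (cond z i x)"
    then have "Inl m \<in> S2 i x \<or> Inl m \<in> dom z"
      by (auto simp: cond_def split: if_splits)
    moreover have "dom z \<subseteq> N2"
      using z by (simp add: Fn_def)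
    ultimately show "m \<in> N"
      using S2_N[OF i x, of m] unfolding N2_def by blast
  qed
  ultimately show ?thesis
    using less_s_mono by (simp add: Fn_def)
qed

text \<open>Chosen so that \<open>cond z0 i x\<close> extends \<open>p i x\<close>: the private
  values of the initial conditions are the same for the whole block in terms of positions, and any
  other value of \<open>p i x\<close> is shared with a second point, hence in
  \<open>Q\<close>.\<close>

definition z0 :: "'n + 'b \<times> 'd \<rightharpoonup> bool" where
  "z0 w = (case w of Inl m \<Rightarrow> Q m | Inr (i, \<tau>) \<Rightarrow> if i \<in> Field k then d2 i Init \<tau> else None)"

lemma z0_Fn: "z0 \<in> Fn s N2"
proof -
  have small: "|dom (d2 i Init)| <o s" if i: "i \<in> Field k" for i
  proof -
    obtain x where x: "x \<in> B2 i"
      using B2_other[OF i] .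
    have "dom (d2 i Init) \<subseteq> \<psi>2 i x ` dom (f2' i x Init)"
    proof
      fix \<tau> assume \<tau>: "\<tau> \<in> dom (d2 i Init)"
      then obtain w where w: "w \<in> S2 i x" "\<psi>2 i x w = \<tau>"
        using U2_surj[OF i x, of Init] by blast
      then have "w \<in> dom (f2' i x Init)"
        using f2_eq(1)[OF i x Init_K2, of w] \<tau> by (simp add: f2_key domIff)
      then show "\<tau> \<in> \<psi>2 i x ` dom (f2' i x Init)"
        using w by blast
    qed
    moreover have "|\<psi>2 i x ` dom (f2' i x Init)| <o s"
      by (rule less_s_image) (use f2'_Fn[OF i _ Init_K2, of x] B2[OF i] x in \<open>auto simp: Fn_def\<close>)
    ultimately show ?thesis
      by (rule less_s_mono)
  qed
  have "dom z0 \<subseteq> Inl ` dom Q \<union> (\<Union>i\<in>Field k. (\<lambda>\<tau>. Inr (i, \<tau>)) ` dom (d2 i Init))"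
    by (force simp: z0_def dom_def split: sum.splits if_splits)
  moreover have "|Inl ` dom Q \<union> (\<Union>i\<in>Field k. (\<lambda>\<tau>. Inr (i, \<tau>)) ` dom (d2 i Init))| <o s"
    by (intro less_s_Un card_of_UNION_ordLess_infinite_Field_regularCard[OF s(2,1) k(2)] ballI less_s_image small)
       (use Q in \<open>auto simp: Fn_def intro: less_s_image\<close>)
  moreover have "dom z0 \<subseteq> N2"
    using Q by (auto simp: z0_def N2_def Fn_def)
  ultimately show ?thesis
    using less_s_mono by (simp add: Fn_def)
qed

lemma p_cond_z0:
  assumes i: "i \<in> Field k" and x: "x \<in> B2 i"
  shows "p i x \<subseteq>\<^sub>m cond z0 i x"
proof (rule map_leI)
  fix m v assume m: "p i x m = Some v"
  have f2: "f2 i y Init (Inl m) = p i y m" for y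
    by (simp add: f2_key f2'_def)
  show "cond z0 i x m = Some v"
  proof (cases "Inl m \<in> S2 i x")
    case True
    then show ?thesis
      using f2_eq(1)[OF i x Init_K2, of "Inl m"] m i by (simp add: f2 cond_def z0_def)
  next
    case False
    then have b: "b2 i Init (Inl m) = Some v"
      using f2_eq(1)[OF i x Init_K2, of "Inl m"] m by (simp add: f2)
    obtain y where y: "y \<in> B2 i" "y \<noteq> x"
      using B2_other[OF i] .
    have "Inl m \<notin> S2 i y"
      using f2_eq(2)[OF i y(1) Init_K2] b by blast
    then have "p i y m = Some v"
      using f2_eq(1)[OF i y(1) Init_K2, of "Inl m"] b by (simp add: f2)
    then have "Q m = Some v"
      using pQ[OF i _ _ y(2)[symmetric] m] x y(1) B1[OF i] B2[OF i] by blast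
    then show ?thesis
      using False by (simp add: cond_def z0_def)
  qed
qed

text \<open>Points whose private coordinates avoid \<open>Vz z\<close> are in general position with respect to \<open>z\<close>.\<close>

definition Vz :: "('n + 'b \<times> 'd \<rightharpoonup> bool) \<Rightarrow> ('n + 'b \<times> 'd) set" where
  "Vz z = {Inl m |m. Inl m \<in> dom z} \<union> {Inr (i, t) |i t. i \<in> Field k \<and> t \<in> T1 i \<and> Inr (i, \<eta> i t) \<in> dom z}"

lemma Vz_less:
  assumes "z \<in> Fn s N2"
  shows "|Vz z| <o s"
proof -
  define f :: "'n + 'b \<times> 'd \<Rightarrow> 'n + 'b \<times> 'd" where "f = (\<lambda>w. Inr (fst (projr w), inv_into (T1 (fst (projr w))) (\<eta> (fst (projr w))) (snd (projr w))))"
  have "Vz z \<subseteq> dom z \<union> f ` dom z"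
  proof
    fix w assume "w \<in> Vz z"
    then consider "w \<in> dom z" | i t where "w = Inr (i, t)" "i \<in> Field k" "t \<in> T1 i" "Inr (i, \<eta> i t) \<in> dom z"
      by (auto simp: Vz_def)
    then show "w \<in> dom z \<union> f ` dom z"
    proof cases
      case (2 i t)
      then have "f (Inr (i, \<eta> i t)) = w"
        using inv_into_f_f[OF inj_\<eta>[OF 2(2)] 2(3)] by (simp add: f_def)
      with imageI[OF 2(4), of f] show ?thesis
        by simp
    qed blast
  qed
  moreover have "|dom z \<union> f ` dom z| <o s"
    using assms by (intro less_s_Un less_s_image) (simp_all add: Fn_def)
  ultimately show ?thesis
    by (rule less_s_mono)
qed

text \<open>The private sets in a block are disjoint, so each element of \<open>A\<close> spoils at
  most one point.\<close>

lemma generic_large: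
  assumes i: "i \<in> Field k" and A: "|A| \<le>o |Pow (T i)|"
  shows "|Pow (T i)| <o |{x \<in> B2 i. S2 i x \<inter> A = {}}|"
proof (rule ccontr)
  let ?G = "{x \<in> B2 i. S2 i x \<inter> A = {}}"
  assume "\<not> ?thesis"
  then have G: "|?G| \<le>o |Pow (T i)|"
    using not_card_less by blast
  have "\<forall>x\<in>B2 i - ?G. \<exists>w. w \<in> S2 i x \<inter> A"
    by blast
  from bchoice[OF this] obtain e where e': "\<forall>x\<in>B2 i - ?G. e x \<in> S2 i x \<inter> A" ..
  note e = bspec[OF e']
  have "inj_on e (B2 i - ?G)"
  proof (rule inj_onI)
    fix x y assume xy: "x \<in> B2 i - ?G" "y \<in> B2 i - ?G" "e x = e y"
    then have "S2 i x \<inter> S2 i y \<noteq> {}"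
      using e[OF xy(1)] e[OF xy(2)] by auto
    then show "x = y"
      using U2D(1)[OF i] xy(1,2) by blast
  qed
  moreover have "e ` (B2 i - ?G) \<subseteq> A"
    using e by blast
  ultimately have "|B2 i - ?G| \<le>o |A|"
    using card_of_ordLeq by blast
  then have "|B2 i - ?G| \<le>o |Pow (T i)|"
    using A by (rule ordLeq_transitive)
  then have "|?G \<union> (B2 i - ?G)| \<le>o |Pow (T i)|"
    by (intro card_of_Un_le G infinite_Pow T i)
  moreover have "?G \<union> (B2 i - ?G) = B2 i"
    by blast
  ultimately show False
    using uniform_familyD(1)[OF U2[OF i]] not_card_less by metis
qed

text \<open>If \<open>r\<close> made the pair green, some \<open>a x y u\<close> would agree with
  \<open>r\<close>. But \<open>z\<close> and \<open>\<Theta> j i u\<close> differ somewhere, and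
  translated back this is a coordinate where \<open>a x y u\<close> contradicts an instance of
  \<open>z\<close>. General position enters when it is a common coordinate, which must not be
  private to \<open>x\<close> or \<open>y\<close>.\<close>

lemma no_green_extension:
  assumes ji: "j \<in> underS k i" and red: "\<And>u. u \<subseteq> Field s \<Longrightarrow> Green i u \<in> h2 j \<Longrightarrow> \<not> agree z (\<Theta> j i u)"
    and x: "x \<in> B2 j" "S2 j x \<inter> Vz z = {}" and y: "y \<in> B2 i" "S2 i y \<inter> Vz z = {}"
    and r: "r \<in> Fn s N" "cond z j x \<subseteq>\<^sub>m r" "cond z i y \<subseteq>\<^sub>m r"
  shows "\<not> g x y r"
proof
  note i = underS_Field(2)[OF ji] and j = underS_Field(1)[OF ji]
  assume "g x y r"
  then obtain u where u: "u \<in> V x y" "agree (a x y u) r"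
    using V_dense[OF r(1)] by blast
  have us: "u \<subseteq> Field s"
    using V u(1) by blast
  have y1: "y \<in> B1 i" and xT: "x \<in> T i"
    using B2[OF i] y(1) B_T[OF ji] B1[OF j] B2[OF j] x(1) by blast+
  have h2: "Green i u \<in> h2 j"
    using h1_iff[OF i y1 xT] u(1) Green_iff[OF ji x(1) us] by blast
  note a = a_eq[OF i y1 xT u(1)] and F = F_eq[OF ji x(1) us h2]
  have clash: False if "a x y u m = Some v'" "r m = Some v" "v \<noteq> v'" for m v v'
    using u(2) that unfolding agree_def by metis
  obtain w v v' where w: "z w = Some v" "\<Theta> j i u w = Some v'" "v \<noteq> v'"
    using red[OF us h2] unfolding agree_def by blast
  consider m where "w = Inl m" | \<tau> where "w = Inr (i, \<tau>)" | \<tau> where "w = Inr (j, \<tau>)" "i \<noteq> j"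
    using w(2) by (cases w) (auto simp: \<Theta>_def split: if_splits)
  then show False
  proof cases
    case (1 m)
    then have "w \<in> Vz z"
      using w(1) by (auto simp: Vz_def)
    then have "Inl m \<notin> S2 j x" "Inl m \<notin> S2 i y"
      using x(2) y(2) 1 by blast+
    moreover from this have "m \<notin> S1 i y"
      using Pos_S2(1)[OF i y(1)] by blast
    moreover have "b2 j (Green i u) (Inl m) = Some v'"
      using w(2) 1 by (simp add: \<Theta>_def)
    ultimately have "a x y u m = Some v'" "cond z j x m = Some v"
      using a(1)[of m] F(1)[of "Inl m"] w(1) 1 by (simp_all add: F_def cond_def)
    then show False
      using clash w(3) map_leD[OF r(2)] by blast
  next
    case (2 \<tau>)
    then obtain t where t: "t \<in> T1 i" "\<tau> = \<eta> i t"
      using w(2) by (auto simp: \<Theta>_def split: if_splits)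
    then have "b2 j (Green i u) (Inr (i, t)) = Some v'"
      using w(2) 2 \<Theta>_Inr[OF i t(1), of j u] by simp
    note t = t this
    obtain m where m: "m \<in> S1 i y" "\<psi>1 i y m = t"
      using U1_surj[OF i y1 t(1)] .
    have "Inr (i, t) \<notin> S2 j x"
      using F(2) t(3) by blast
    then have "a x y u m = Some v'"
      using a(1)[of m] F(1)[of "Inr (i, t)"] t(3) m by (simp add: F_def)
    moreover have "cond z i y m = Some v"
      using Pos_S2[OF i y(1) m(1)] m(2) w(1) 2 t(2) by (simp add: cond_def)
    ultimately show False
      using clash w(3) map_leD[OF r(3)] by blast
  next
    case (3 \<tau>)
    then have \<tau>: "d2 j Kind \<tau> \<noteq> None" "d2 j (Green i u) \<tau> = Some v'"
      using w(2) by (auto simp: \<Theta>_def split: if_splits)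
    then obtain w' where w': "w' \<in> S2 j x" "\<psi>2 j x w' = \<tau>"
      using U2_surj[OF j x(1), of "Green i u" \<tau>] by blast
    then obtain m where m: "w' = Inl m"
      using Kind_iff[OF j x(1) w'(1)] \<tau>(1) by (auto simp: isl_def)
    have b1: "b1 i (x, u) m = Some v'"
      using F(1)[of w'] w' \<tau>(2) m by (simp add: F_def)
    then have "m \<notin> S1 i y"
      using a(2) by blast
    then have "a x y u m = Some v'" "cond z j x m = Some v"
      using a(1)[of m] b1 w(1) 3 w' m by (simp_all add: cond_def)
    then show False
      using clash w(3) map_leD[OF r(2)] by blast
  qed
qed

text \<open>The recursion can always go on: the private sets chosen in the smaller blocks have
  together at most |T i| elements.\<close>

lemma generic_transversal:
  assumes z: "z \<in> Fn s N2"
  shows "\<exists>\<delta>. (\<forall>i\<in>Field k. \<delta> i \<in> B2 i \<and> S2 i (\<delta> i) \<inter> Vz z = {}) \<and>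
    (\<forall>i\<in>Field k. \<forall>j\<in>Field k. i \<noteq> j \<longrightarrow> S2 i (\<delta> i) \<inter> S2 j (\<delta> j) = {})"
proof -
  define ok where "ok \<delta> i x \<longleftrightarrow> (i \<in> Field k \<longrightarrow> x \<in> B2 i \<and> S2 i x \<inter> (Vz z \<union> (\<Union>j\<in>underS k i. S2 j (\<delta> j))) = {})"
    for \<delta> i x
  have "\<exists>\<delta>. \<forall>i. ok \<delta> i (\<delta> i)"
  proof (rule dependent_wf_choice)
    show "wf {(c, b). c \<in> underS k b}"
      using wfp_underS[OF k(1)] by (simp add: wfp_def)
    show "ok \<delta> i x = ok \<delta>' i x" if "\<And>j. (j, i) \<in> {(c, b). c \<in> underS k b} \<Longrightarrow> \<delta> j = \<delta>' j" for \<delta> \<delta>' i x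
      using that by (simp add: ok_def)
    show "\<exists>x. ok \<delta> i x" if prev: "\<And>j. (j, i) \<in> {(c, b). c \<in> underS k b} \<Longrightarrow> ok \<delta> j (\<delta> j)" for i \<delta>
    proof (cases "i \<in> Field k")
      case True
      have S2_le: "|S2 j (\<delta> j)| \<le>o |T i|" if j: "j \<in> underS k i" for j
      proof -
        have x: "\<delta> j \<in> B2 j"
          using prev[of j] j underS_Field(1)[OF j] by (simp add: ok_def)
        have "|S2 j (\<delta> j)| \<le>o |T2 j|"
          using U2D(2,3)[OF underS_Field(1)[OF j] x] card_of_ordLeq[of "S2 j (\<delta> j)" "T2 j"] by blast
        moreover have "T2 j \<subseteq> T i"
          using U2D(4)[OF underS_Field(1)[OF j]] T_mono[OF j] by blast
        then have "|T2 j| \<le>o |T i|"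
          by (rule card_of_mono1)
        ultimately show ?thesis
          by (rule ordLeq_transitive)
      qed
      have under_le: "|underS k i| \<le>o |T i|"
      proof -
        have "underS k i \<subseteq> Field k"
          using underS_Field(1) by blast
        then show ?thesis
          by (rule ordLeq_transitive[OF card_of_mono1 less_s_T[OF k(2) True]])
      qed
      have "|Vz z \<union> (\<Union>j\<in>underS k i. S2 j (\<delta> j))| \<le>o |T i|"
        by (intro card_of_Un_le card_of_UNION_ordLeq_infinite T True less_s_T[OF Vz_less[OF z]] ballI S2_le under_le)
      from generic_large[OF True card_le_Pow[OF this]]
      have "{x \<in> B2 i. S2 i x \<inter> (Vz z \<union> (\<Union>j\<in>underS k i. S2 j (\<delta> j))) = {}} \<noteq> {}"
        using not_card_less card_of_empty by metis
      then show ?thesis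
        unfolding ok_def by blast
    qed (simp add: ok_def)
  qed
  then obtain \<delta> where \<delta>: "\<And>i. ok \<delta> i (\<delta> i)"
    by blast
  show ?thesis
  proof (intro exI[of _ \<delta>] conjI ballI impI)
    show "\<delta> i \<in> B2 i" "S2 i (\<delta> i) \<inter> Vz z = {}" if "i \<in> Field k" for i
      using \<delta>[of i] that unfolding ok_def by blast+
    fix i j assume ij: "i \<in> Field k" "j \<in> Field k" "i \<noteq> j"
    then consider "i \<in> underS k j" | "j \<in> underS k i"
      using wo_rel_underS_cases[OF k(1)] by blast
    then show "S2 i (\<delta> i) \<inter> S2 j (\<delta> j) = {}"
      using \<delta>[of i] \<delta>[of j] ij(1,2) unfolding ok_def by cases blast+
  qed
qed

text \<open>The values of \<open>a (\<delta> j) (\<delta> i) (u j i)\<close> at common coordinates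
  or at those of one of the two points are already in instances of \<open>z\<close>, because
  \<open>z\<close> contains \<open>\<Theta> j i (u j i)\<close>. The remaining coordinates are
  private to the pair: different pairs have different ones, and no instance of \<open>z\<close> is
  defined there. So all these conditions and instances have a common extension.\<close>

lemma green_amalgamation:
  assumes z: "z \<in> Fn s N2" and H: "H \<subseteq> Field k"
    and green: "\<And>i j. i \<in> H \<Longrightarrow> j \<in> H \<Longrightarrow> j \<in> underS k i \<Longrightarrow>
      \<exists>u. u \<subseteq> Field s \<and> Green i u \<in> h2 j \<and> \<Theta> j i u \<subseteq>\<^sub>m z"
  shows "\<exists>\<delta>. \<exists>q\<in>Fn s N. (\<forall>i\<in>H. \<delta> i \<in> B2 i \<and> cond z i (\<delta> i) \<subseteq>\<^sub>m q) \<and>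
    (\<forall>i\<in>H. \<forall>j\<in>H. j \<in> underS k i \<longrightarrow> g (\<delta> j) (\<delta> i) q)"
proof -
  obtain \<delta> where \<delta>': "\<forall>i\<in>Field k. \<delta> i \<in> B2 i \<and> S2 i (\<delta> i) \<inter> Vz z = {}"
    and disj': "\<forall>i\<in>Field k. \<forall>j\<in>Field k. i \<noteq> j \<longrightarrow> S2 i (\<delta> i) \<inter> S2 j (\<delta> j) = {}"
    using generic_transversal[OF z] by blast
  note \<delta> = bspec[OF \<delta>']
  have disj: "S2 i (\<delta> i) \<inter> S2 j (\<delta> j) = {}" if "i \<in> Field k" "j \<in> Field k" "i \<noteq> j" for i j
    using disj' that by blast
  define u where "u j i = (SOME u. u \<subseteq> Field s \<and> Green i u \<in> h2 j \<and> \<Theta> j i u \<subseteq>\<^sub>m z)" for j i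
  have u: "u j i \<subseteq> Field s \<and> Green i (u j i) \<in> h2 j \<and> \<Theta> j i (u j i) \<subseteq>\<^sub>m z"
    if "i \<in> H" "j \<in> H" "j \<in> underS k i" for i j
    unfolding u_def by (rule someI_ex[OF green[OF that]])
  define I where "I = {(j, i). i \<in> H \<and> j \<in> H \<and> j \<in> underS k i}"
  define A where "A = (\<lambda>(j, i). a (\<delta> j) (\<delta> i) (u j i))"
  \<comment> \<open>A real coordinate that is private to the larger point and whose virtual
    substitute is private to the smaller one. Exactly such coordinates are omitted in
    \<open>\<Theta>\<close>.\<close>
  define free where "free j i m \<longleftrightarrow> m \<in> S1 i (\<delta> i) \<and> Inr (i, \<psi>1 i (\<delta> i) m) \<in> S2 j (\<delta> j)" for j i m
  have uV: "u j i \<in> V (\<delta> j) (\<delta> i)" if ji: "(j, i) \<in> I" for j i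
  proof -
    have f: "i \<in> H" "j \<in> H" "j \<in> underS k i"
      using ji by (auto simp: I_def)
    note fi = underS_Field(2)[OF f(3)] and fj = underS_Field(1)[OF f(3)]
    have "(\<delta> j, u j i) \<in> h1 i"
      using Green_iff[OF f(3)] \<delta>[OF fj] u[OF f] by blast
    moreover have "\<delta> i \<in> B1 i" "\<delta> j \<in> T i"
      using \<delta>[OF fi] B2[OF fi] \<delta>[OF fj] B2[OF fj] B1[OF fj] B_T[OF f(3)] by blast+
    ultimately show ?thesis
      using h1_iff[OF fi] by blast
  qed
  have A_cases: "cond z j (\<delta> j) m = Some v \<or> cond z i (\<delta> i) m = Some v \<or> free j i m"
    if ji: "(j, i) \<in> I" and m: "A (j, i) m = Some v" for j i m v
  proof -
    have f: "i \<in> H" "j \<in> H" "j \<in> underS k i"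
      using ji by (auto simp: I_def)
    note fi = underS_Field(2)[OF f(3)] and fj = underS_Field(1)[OF f(3)]
    note U = u[OF f]
    have y1: "\<delta> i \<in> B1 i" and xT: "\<delta> j \<in> T i"
      using \<delta>[OF fi] B2[OF fi] \<delta>[OF fj] B2[OF fj] B1[OF fj] B_T[OF f(3)] by blast+
    have x2: "\<delta> j \<in> B2 j" and y2: "\<delta> i \<in> B2 i"
      using \<delta> fi fj by blast+
    have us: "u j i \<subseteq> Field s" and ug: "Green i (u j i) \<in> h2 j" and uz: "\<Theta> j i (u j i) \<subseteq>\<^sub>m z"
      using U by blast+
    note a = a_eq(1)[OF fi y1 xT uV[OF ji], of m] and F = F_eq(1)[OF f(3) x2 us ug]
    have m': "a (\<delta> j) (\<delta> i) (u j i) m = Some v"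
      using m by (simp add: A_def)
    show ?thesis
    proof (cases "m \<in> S1 i (\<delta> i)")
      case True
      let ?t = "\<psi>1 i (\<delta> i) m"
      have t: "?t \<in> T1 i"
        using U1D(3)[OF fi y1] True by blast
      have Ft: "F i (\<delta> j) (u j i) (Inr (i, ?t)) = Some v"
        using a m' True by (simp add: F_def)
      show ?thesis
      proof (cases "Inr (i, ?t) \<in> S2 j (\<delta> j)")
        case False
        then have "b2 j (Green i (u j i)) (Inr (i, ?t)) = Some v"
          using F Ft by simp
        then have "\<Theta> j i (u j i) (Inr (i, \<eta> i ?t)) = Some v"
          by (simp add: \<Theta>_Inr[OF fi t])
        then have "z (Inr (i, \<eta> i ?t)) = Some v"
          by (rule map_leD[OF uz])
        then have "cond z i (\<delta> i) m = Some v"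
          using Pos_S2[OF fi y2 True] by (simp add: cond_def)
        then show ?thesis
          by blast
      qed (use True free_def in blast)
    next
      case False
      then have Fm: "F i (\<delta> j) (u j i) (Inl m) = Some v"
        using a m' by (simp add: F_def)
      have "cond z j (\<delta> j) m = Some v"
      proof (cases "Inl m \<in> S2 j (\<delta> j)")
        case True
        let ?\<tau> = "\<psi>2 j (\<delta> j) (Inl m)"
        have "d2 j (Green i (u j i)) ?\<tau> = Some v"
          using F Fm True by simp
        moreover have "d2 j Kind ?\<tau> \<noteq> None"
          using Kind_iff[OF fj x2 True] by simp
        ultimately have "\<Theta> j i (u j i) (Inr (j, ?\<tau>)) = Some v"
          using underS_Field(3)[OF f(3)] by (simp add: \<Theta>_def)
        then have "z (Inr (j, ?\<tau>)) = Some v"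
          by (rule map_leD[OF uz])
        then show ?thesis
          using True by (simp add: cond_def)
      next
        case False
        then have "\<Theta> j i (u j i) (Inl m) = Some v"
          using F Fm by (simp add: \<Theta>_def)
        then have "z (Inl m) = Some v"
          by (rule map_leD[OF uz])
        then show ?thesis
          using False by (simp add: cond_def)
      qed
      then show ?thesis
        by blast
    qed
  qed
  have free_S2: "Inl m \<in> S2 i (\<delta> i)" if "(j, i) \<in> I" "free j i m" for j i m
  proof -
    have "i \<in> Field k"
      using that(1) H by (auto simp: I_def)
    then show ?thesis
      using Pos_S2(1)[of i "\<delta> i" m] \<delta> that(2) by (auto simp: free_def)
  qed
  have notVz: "z (Inl m) = None" if "i \<in> Field k" "Inl m \<in> S2 i (\<delta> i)" for i m
  proof (rule ccontr)
    assume "z (Inl m) \<noteq> None"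
    then have "Inl m \<in> Vz z"
      by (auto simp: Vz_def)
    then show False
      using \<delta>[OF that(1)] that(2) by blast
  qed
  \<comment> \<open>For \<open>i' = i\<close> the virtual substitute of \<open>m\<close> is private
    to \<open>\<delta> j\<close> and so avoids \<open>Vz z\<close>, hence \<open>z\<close> is
    undefined at the position of \<open>m\<close>; for this purpose \<open>Vz z\<close> contains
    virtual coordinates. For other blocks \<open>m\<close> is neither private nor in the domain of
    \<open>z\<close>.\<close>
  have free_None: "cond z i' (\<delta> i') m = None" if ji: "(j, i) \<in> I" "free j i m" and i': "i' \<in> Field k" for j i i' m
  proof (cases "i' = i")
    case True
    have i: "i \<in> Field k" "j \<in> Field k"
      using ji(1) H by (auto simp: I_def)
    let ?t = "\<psi>1 i (\<delta> i) m"
    have "?t \<in> T1 i"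
      using U1D(3)[OF i(1), of "\<delta> i"] B2[OF i(1)] \<delta>[OF i(1)] ji(2) by (auto simp: free_def)
    moreover have "Inr (i, ?t) \<notin> Vz z"
      using \<delta>[OF i(2)] ji(2) by (auto simp: free_def)
    ultimately have "z (Inr (i, \<eta> i ?t)) = None"
      using i(1) by (auto simp: Vz_def)
    then show ?thesis
      using Pos_S2[OF i(1), of "\<delta> i" m] \<delta>[OF i(1)] ji(2) by (simp add: True cond_def free_def)
  next
    case False
    have i: "i \<in> Field k"
      using ji(1) H by (auto simp: I_def)
    have "Inl m \<notin> S2 i' (\<delta> i')"
      using disj[OF i' i False] free_S2[OF ji] by blast
    then show ?thesis
      using notVz[OF i free_S2[OF ji]] by (simp add: cond_def)
  qed
  have cond_agree: "v = v'"
    if "i \<in> Field k" "i' \<in> Field k" "cond z i (\<delta> i) m = Some v" "cond z i' (\<delta> i') m = Some v'" for i i' m v v'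
  proof (cases "i = i'")
    case False
    have "\<not> (Inl m \<in> S2 i (\<delta> i) \<and> Inl m \<in> S2 i' (\<delta> i'))"
      using disj[OF that(1,2) False] by blast
    then show ?thesis
      using that(3,4) notVz[OF that(1), of m] notVz[OF that(2), of m] by (auto simp: cond_def split: if_splits)
  qed (use that in simp)
  define FF where "FF = (\<lambda>i. cond z i (\<delta> i)) ` H \<union> A ` I"
  have FF_cases: "(\<exists>i\<in>Field k. cond z i (\<delta> i) m = Some v) \<or> (\<exists>j i. (j, i) \<in> I \<and> X = A (j, i) \<and> free j i m)"
    if "X \<in> FF" "X m = Some v" for X m v
  proof -
    from that(1) consider i where "i \<in> H" "X = cond z i (\<delta> i)" | j i where "(j, i) \<in> I" "X = A (j, i)"
      by (auto simp: FF_def)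
    then show ?thesis
    proof cases
      case (2 j i)
      then have "i \<in> Field k" "j \<in> Field k"
        using H by (auto simp: I_def)
      then show ?thesis
        using A_cases[OF 2(1)] 2 that(2) by blast
    qed (use that(2) H in blast)
  qed
  have agr: "agree X Y" if XY: "X \<in> FF" "Y \<in> FF" for X Y
    unfolding agree_def
  proof (intro allI impI)
    fix m v w assume v: "X m = Some v" and w: "Y m = Some w"
    from FF_cases[OF XY(1) v] FF_cases[OF XY(2) w] show "v = w"
    proof (elim disjE exE bexE conjE)
      fix j i j' i'
      assume 1: "(j, i) \<in> I" "X = A (j, i)" "free j i m" and 2: "(j', i') \<in> I" "Y = A (j', i')" "free j' i' m"
      have f: "i \<in> Field k" "j \<in> Field k" "i' \<in> Field k" "j' \<in> Field k"
        using 1(1) 2(1) H by (auto simp: I_def)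
      \<comment> \<open>The coordinate determines the larger point of the pair, and its virtual
        substitute the smaller one.\<close>
      have "i = i'"
        using disj[OF f(1,3)] free_S2[OF 1(1,3)] free_S2[OF 2(1,3)] by blast
      moreover from this have "j = j'"
        using disj[OF f(2,4)] 1(3) 2(3) by (auto simp: free_def)
      ultimately show "v = w"
        using 1(2) 2(2) v w by simp
    next
      fix i i' assume "i \<in> Field k" "i' \<in> Field k" "cond z i (\<delta> i) m = Some v" "cond z i' (\<delta> i') m = Some w"
      then show "v = w"
        by (rule cond_agree)
    next
      fix i' j i assume "(j, i) \<in> I" "free j i m" "i' \<in> Field k" "cond z i' (\<delta> i') m = Some v"
      then show "v = w"
        using free_None by simp
    next
      fix i' j i assume "(j, i) \<in> I" "free j i m" "i' \<in> Field k" "cond z i' (\<delta> i') m = Some w"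
      then show "v = w"
        using free_None by simp
    qed
  qed
  have up: "X \<subseteq>\<^sub>m mUnion FF" if "X \<in> FF" for X
    using agr that by (rule mUnion_upper)
  have FF_Fn: "mUnion FF \<in> Fn s N"
  proof (rule Fn_mUnion[OF s])
    have "I \<subseteq> Field k \<times> Field k"
      using H by (auto simp: I_def)
    then have "|I| <o s"
      by (rule pairs_less)
    then show "|FF| <o s"
      unfolding FF_def by (intro less_s_Un less_s_image less_s_mono[OF H k(2)])
    show "FF \<subseteq> Fn s N"
      using cond_Fn[OF _ _ z] \<delta> H a(1)[OF uV] by (auto simp: FF_def A_def)
  qed
  have "\<delta> i \<in> B2 i \<and> cond z i (\<delta> i) \<subseteq>\<^sub>m mUnion FF" if "i \<in> H" for i
    using \<delta> H that up[of "cond z i (\<delta> i)"] by (auto simp: FF_def)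
  moreover have "g (\<delta> j) (\<delta> i) (mUnion FF)" if "i \<in> H" "j \<in> H" "j \<in> underS k i" for i j
  proof -
    have ji: "(j, i) \<in> I"
      using that by (simp add: I_def)
    have "A (j, i) \<subseteq>\<^sub>m mUnion FF"
      by (rule up) (use ji in \<open>auto simp: FF_def\<close>)
    then show ?thesis
      using g_mono[OF a(2)[OF uV[OF ji]] FF_Fn] by (simp add: A_def)
  qed
  ultimately show ?thesis
    using FF_Fn by (intro exI[of _ \<delta>] bexI[of _ "mUnion FF"]) blast+
qed

text \<open>There are fewer than \<open>s\<close> pairs of blocks, so a single condition can decide
  all of them.\<close>

lemma ex_decisive_state:
  shows "\<exists>z\<in>Fn s N2. z0 \<subseteq>\<^sub>m z \<and> (\<forall>i j. j \<in> underS k i \<longrightarrow>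
    (\<exists>u. u \<subseteq> Field s \<and> Green i u \<in> h2 j \<and> \<Theta> j i u \<subseteq>\<^sub>m z) \<or>
    (\<forall>u. u \<subseteq> Field s \<longrightarrow> Green i u \<in> h2 j \<longrightarrow> \<not> agree z (\<Theta> j i u)))"
proof -
  define I where "I = {(j, i). j \<in> underS k i}"
  define C where "C = (\<lambda>(j, i). {\<Theta> j i u |u. u \<subseteq> Field s \<and> Green i u \<in> h2 j})"
  have "I \<subseteq> Field k \<times> Field k"
    using underS_Field by (auto simp: I_def)
  then have I: "|I| <o s"
    by (rule pairs_less)
  have "\<exists>z\<in>Fn s N2. z0 \<subseteq>\<^sub>m z \<and> (\<forall>e\<in>I. (\<exists>c\<in>C e. c \<subseteq>\<^sub>m z) \<or> (\<forall>c\<in>C e. \<not> agree z c))"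
    by (rule Fn_decide[OF s I _ z0_Fn]) (auto simp: I_def C_def \<Theta>_Fn)
  then obtain z where z: "z \<in> Fn s N2" "z0 \<subseteq>\<^sub>m z"
    "\<And>e. e \<in> I \<Longrightarrow> (\<exists>c\<in>C e. c \<subseteq>\<^sub>m z) \<or> (\<forall>c\<in>C e. \<not> agree z c)"
    by blast
  show ?thesis
  proof (intro bexI[OF _ z(1)] conjI allI impI z(2))
    fix i j assume "j \<in> underS k i"
    then show "(\<exists>u. u \<subseteq> Field s \<and> Green i u \<in> h2 j \<and> \<Theta> j i u \<subseteq>\<^sub>m z) \<or>
      (\<forall>u. u \<subseteq> Field s \<longrightarrow> Green i u \<in> h2 j \<longrightarrow> \<not> agree z (\<Theta> j i u))"
      using z(3)[of "(j, i)"] by (auto simp: I_def C_def)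
  qed
qed

end

section \<open>The dichotomy for Cohen conditions\<close>

lemma green_chain_mono: "green_chain s N th l g q' \<Longrightarrow> q \<subseteq>\<^sub>m q' \<Longrightarrow> green_chain s N th l g q"
  unfolding green_chain_def by (meson map_le_trans)

lemma Fn_empty: "Cinfinite s \<Longrightarrow> Map.empty \<in> Fn s N"
  using finite_less[of s "{}"] by (simp add: Fn_def)

text \<open>The common parts of the conditions in different blocks need an upper bound
  \<open>Q\<close>. So each block is treated below the common parts of all earlier ones, where the
  absence of green sets persists.\<close>

lemma homogeneous_blocks:
  fixes k :: "'b rel" and s :: "'c rel" and l :: "'d rel" and N :: "'n set" and T :: "'b \<Rightarrow> 'd set"
  assumes s: "Cinfinite s" "regularCard s" and l: "Well_order l" and th: "Well_order th" "|Field th| <o s"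
    and k: "Well_order k" "|Field k| <o s"
    and TB: "\<forall>i\<in>Field k. infinite (T i) \<and> |Field s| \<le>o |T i| \<and> B i \<subseteq> Field l \<and> |Pow (T i)| <o |B i|"
    and q: "q \<in> Fn s N"
    and g_mono: "\<forall>x y p. \<forall>q\<in>Fn s N. g x y p \<longrightarrow> p \<subseteq>\<^sub>m q \<longrightarrow> g x y q"
    and no_green: "\<not> green_chain s N th l g q"
  shows "\<exists>C p. \<exists>Q\<in>Fn s N. q \<subseteq>\<^sub>m Q \<and> (\<forall>i\<in>Field k. C i \<subseteq> B i \<and> |Pow (T i)| <o |C i| \<and>
    (\<forall>x\<in>C i. p i x \<in> Fn s N \<and> q \<subseteq>\<^sub>m p i x) \<and>
    (\<forall>x\<in>C i. \<forall>y\<in>C i. x \<noteq> y \<longrightarrow> (\<forall>m v. p i x m = Some v \<longrightarrow> p i y m = Some v \<longrightarrow> Q m = Some v)) \<and>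
    (\<forall>x\<in>C i. \<forall>y\<in>C i. x \<in> underS l y \<longrightarrow> \<not> (\<exists>r\<in>Fn s N. p i x \<subseteq>\<^sub>m r \<and> p i y \<subseteq>\<^sub>m r \<and> g x y r)))"
proof -
  define ok where "ok F i v \<longleftrightarrow> (i \<in> Field k \<longrightarrow> (case v of (C, p, q') \<Rightarrow>
      C \<subseteq> B i \<and> |Pow (T i)| <o |C| \<and> q' \<in> Fn s N \<and> q \<subseteq>\<^sub>m q' \<and> (\<forall>j\<in>underS k i. snd (snd (F j)) \<subseteq>\<^sub>m q') \<and>
      (\<forall>x\<in>C. p x \<in> Fn s N \<and> q' \<subseteq>\<^sub>m p x) \<and>
      (\<forall>x\<in>C. \<forall>y\<in>C. x \<noteq> y \<longrightarrow> dom (p x) \<inter> dom (p y) \<subseteq> dom q') \<and>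
      (\<forall>x\<in>C. \<forall>y\<in>C. x \<in> underS l y \<longrightarrow> \<not> (\<exists>r\<in>Fn s N. p x \<subseteq>\<^sub>m r \<and> p y \<subseteq>\<^sub>m r \<and> g x y r))))"
    for F :: "'b \<Rightarrow> 'd set \<times> ('d \<Rightarrow> 'n \<rightharpoonup> bool) \<times> ('n \<rightharpoonup> bool)" and i v
  have sub: "underS k i \<subseteq> Field k" for i
    by (auto simp: underS_def Field_def)
  have "\<exists>F. \<forall>i. ok F i (F i)"
  proof (rule dependent_wf_choice)
    show "wf {(c, b). c \<in> underS k b}"
      using wfp_underS[OF k(1)] by (simp add: wfp_def)
    show "ok F i v = ok F' i v" if "\<And>j. (j, i) \<in> {(c, b). c \<in> underS k b} \<Longrightarrow> F j = F' j" for F F' i v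
      using that by (simp add: ok_def)
    show "\<exists>v. ok F i v" if prev: "\<And>j. (j, i) \<in> {(c, b). c \<in> underS k b} \<Longrightarrow> ok F j (F j)" for i F
    proof (cases "i \<in> Field k")
      case True
      have st: "snd (snd (F j)) \<in> Fn s N \<and> q \<subseteq>\<^sub>m snd (snd (F j)) \<and> (\<forall>e\<in>underS k j. snd (snd (F e)) \<subseteq>\<^sub>m snd (snd (F j)))"
        if "j \<in> underS k i" for j
        using prev[of j] that sub by (auto simp: ok_def case_prod_beta)
      have "\<exists>q'\<in>Fn s N. q \<subseteq>\<^sub>m q' \<and> (\<forall>j\<in>underS k i. snd (snd (F j)) \<subseteq>\<^sub>m q')"
      proof (rule Fn_chain[OF s k(1) sub])
        show "|underS k i| <o s"
          by (rule ordLeq_ordLess_trans[OF card_of_mono1[OF sub] k(2)])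
      qed (use st q in auto)
      then obtain q0 where q0: "q0 \<in> Fn s N" "q \<subseteq>\<^sub>m q0" "\<forall>j\<in>underS k i. snd (snd (F j)) \<subseteq>\<^sub>m q0"
        by blast
      have no_green': "\<not> green_chain s N th l g q0"
        using no_green green_chain_mono[OF _ q0(2)] by blast
      have TBi: "infinite (T i)" "|Field s| \<le>o |T i|" "B i \<subseteq> Field l" "|Pow (T i)| <o |B i|"
        using TB True by blast+
      from block_step[OF s l th TBi q0(1) g_mono no_green']
      obtain C p q' where C: "C \<subseteq> B i" "|Pow (T i)| <o |C|" "q' \<in> Fn s N" "q0 \<subseteq>\<^sub>m q'"
        "\<forall>x\<in>C. p x \<in> Fn s N \<and> q' \<subseteq>\<^sub>m p x"
        "\<forall>x\<in>C. \<forall>y\<in>C. x \<noteq> y \<longrightarrow> dom (p x) \<inter> dom (p y) \<subseteq> dom q'"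
        "\<forall>x\<in>C. \<forall>y\<in>C. x \<in> underS l y \<longrightarrow> \<not> (\<exists>r\<in>Fn s N. p x \<subseteq>\<^sub>m r \<and> p y \<subseteq>\<^sub>m r \<and> g x y r)"
        by (elim exE conjE) (rule that)
      have "q \<subseteq>\<^sub>m q'" "\<forall>j\<in>underS k i. snd (snd (F j)) \<subseteq>\<^sub>m q'"
        using q0(2,3) C(4) map_le_trans by blast+
      then have "ok F i (C, p, q')"
        unfolding ok_def case_prod_conv using C by (intro impI conjI)
      then show ?thesis
        by (rule exI[of _ "(C, p, q')"])
    qed (simp add: ok_def)
  qed
  then obtain F where F: "\<And>i. ok F i (F i)"
    by blast
  define C where "C i = fst (F i)" for i
  define p where "p i = fst (snd (F i))" for i
  define qs where "qs i = snd (snd (F i))" for i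
  have st: "C i \<subseteq> B i" "|Pow (T i)| <o |C i|" "qs i \<in> Fn s N" "q \<subseteq>\<^sub>m qs i" "\<forall>j\<in>underS k i. qs j \<subseteq>\<^sub>m qs i"
    "\<forall>x\<in>C i. p i x \<in> Fn s N \<and> qs i \<subseteq>\<^sub>m p i x"
    "\<forall>x\<in>C i. \<forall>y\<in>C i. x \<noteq> y \<longrightarrow> dom (p i x) \<inter> dom (p i y) \<subseteq> dom (qs i)"
    "\<forall>x\<in>C i. \<forall>y\<in>C i. x \<in> underS l y \<longrightarrow> \<not> (\<exists>r\<in>Fn s N. p i x \<subseteq>\<^sub>m r \<and> p i y \<subseteq>\<^sub>m r \<and> g x y r)"
    if "i \<in> Field k" for i
    using F[of i] that unfolding ok_def C_def p_def qs_def case_prod_beta by simp_all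
  have "\<exists>Q\<in>Fn s N. q \<subseteq>\<^sub>m Q \<and> (\<forall>i\<in>Field k. qs i \<subseteq>\<^sub>m Q)"
    by (rule Fn_chain[OF s k(1) subset_refl k(2)]) (use st q in auto)
  then obtain Q where Q: "Q \<in> Fn s N" "q \<subseteq>\<^sub>m Q" "\<forall>i\<in>Field k. qs i \<subseteq>\<^sub>m Q"
    by blast
  have "Q m = Some v" if i: "i \<in> Field k" and xy: "x \<in> C i" "y \<in> C i" "x \<noteq> y"
    and m: "p i x m = Some v" "p i y m = Some v" for i x y m v
  proof -
    have "m \<in> dom (qs i)"
      using st(7)[OF i] xy m by blast
    then obtain w where w: "qs i m = Some w"
      by blast
    have "qs i \<subseteq>\<^sub>m p i x" "qs i \<subseteq>\<^sub>m Q"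
      using st(6)[OF i] xy(1) Q(3) i by blast+
    then have "p i x m = Some w" "Q m = Some w"
      using map_leD w by metis+
    then show ?thesis
      using m(1) by simp
  qed
  moreover have "q \<subseteq>\<^sub>m p i x" if "i \<in> Field k" "x \<in> C i" for i x
    by (rule map_le_trans[OF st(4)[OF that(1)]]) (use st(6)[OF that(1)] that(2) in blast)
  ultimately show ?thesis
    using Q(1,2) st(1,2,6,8) by (intro exI[of _ C] exI[of _ p] bexI[of _ Q] conjI ballI impI allI) blast+
qed

text \<open>Pairs are red by \<open>red\<close> inside a block and by
  \<open>no_green_extension\<close> across blocks. To make the fibres of \<open>\<phi>\<close>
  predense, each gets at least |Field s| points of one block: a condition \<open>r\<close> has a
  smaller domain and private sets are disjoint, so some point of the fibre has its private
  coordinates outside \<open>dom r\<close>.\<close>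

lemma (in block_system2) red_set:
  fixes l :: "'d rel"
  assumes l: "Card_order l" "infinite (Field l)" and B_l: "\<And>i. i \<in> Field k \<Longrightarrow> B i \<subseteq> Field l"
    and B_disj: "\<And>i j. i \<in> Field k \<Longrightarrow> j \<in> Field k \<Longrightarrow> i \<noteq> j \<Longrightarrow> B i \<inter> B j = {}"
    and B_less: "\<And>i j x y. j \<in> underS k i \<Longrightarrow> x \<in> B j \<Longrightarrow> y \<in> B i \<Longrightarrow> x \<in> underS l y"
    and red: "\<And>i x y. i \<in> Field k \<Longrightarrow> x \<in> B i \<Longrightarrow> y \<in> B i \<Longrightarrow> x \<in> underS l y \<Longrightarrow>
      \<not> (\<exists>r\<in>Fn s N. p i x \<subseteq>\<^sub>m r \<and> p i y \<subseteq>\<^sub>m r \<and> g x y r)"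
    and z: "z \<in> Fn s N2" "z0 \<subseteq>\<^sub>m z" and Z: "Z \<subseteq> Field k"
    and red_Z: "\<And>i j u. i \<in> Z \<Longrightarrow> j \<in> Z \<Longrightarrow> j \<in> underS k i \<Longrightarrow> u \<subseteq> Field s \<Longrightarrow> Green i u \<in> h2 j \<Longrightarrow> \<not> agree z (\<Theta> j i u)"
    and unbounded: "\<And>x. x \<in> Field l \<Longrightarrow> \<exists>i\<in>Z. underS l x \<subseteq> T i"
  shows "\<exists>q'\<in>Fn s N. Q \<subseteq>\<^sub>m q' \<and> (\<exists>C \<phi> c. C \<subseteq> Field l \<and> (\<forall>x\<in>C. \<phi> x \<in> Field l \<and> c x \<in> Fn s N) \<and>
    (\<forall>y\<in>Field l. \<forall>r\<in>Fn s N. q' \<subseteq>\<^sub>m r \<longrightarrow> (\<exists>x\<in>C. \<phi> x = y \<and> (\<exists>r'\<in>Fn s N. r \<subseteq>\<^sub>m r' \<and> c x \<subseteq>\<^sub>m r'))) \<and>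
    (\<forall>x\<in>C. \<forall>y\<in>C. x \<in> underS l y \<longrightarrow> \<not> (\<exists>r\<in>Fn s N. c x \<subseteq>\<^sub>m r \<and> c y \<subseteq>\<^sub>m r \<and> g x y r)))"
proof -
  have wl: "Well_order l"
    using l(1) by (simp add: card_order_on_def)
  define D where "D i = {x \<in> B2 i. S2 i x \<inter> Vz z = {}}" for i
  have D_large: "|Pow (T i)| <o |D i|" if "i \<in> Field k" for i
    unfolding D_def by (rule generic_large[OF that card_le_Pow[OF less_s_T[OF Vz_less[OF z(1)] that]]])
  have D_B2: "D i \<subseteq> B2 i" for i
    by (auto simp: D_def)
  have D_B: "D i \<subseteq> B i" if "i \<in> Field k" for i
    using D_B2[of i] B1[OF that] B2[OF that] by blast
  define C where "C = (\<Union>i\<in>Z. D i)"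
  have C_l: "C \<subseteq> Field l"
    using D_B B_l Z unfolding C_def by blast
  define idx where "idx x = (THE i. i \<in> Z \<and> x \<in> D i)" for x
  have idx: "idx x = i" if "i \<in> Z" "x \<in> D i" for i x
    unfolding idx_def
  proof (rule the_equality)
    fix j assume j: "j \<in> Z \<and> x \<in> D j"
    show "j = i"
    proof (rule ccontr)
      assume "j \<noteq> i"
      then have "B j \<inter> B i = {}"
        using B_disj j that(1) Z by blast
      then show False
        using j that D_B Z by blast
    qed
  qed (use that in blast)
  \<comment> \<open>A smaller \<open>C\<close> would be no larger than some \<open>T i\<close> with
    \<open>i\<close> in \<open>Z\<close>, while already its part \<open>D i\<close> is larger than
    the power set of \<open>T i\<close>.\<close>
  have "\<not> |C| <o l"
  proof
    assume "|C| <o l"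
    then obtain x where x: "x \<in> Field l" "|C| =o |underS l x|"
      using card_less_underS[OF l(1)] by blast
    obtain i where i: "i \<in> Z" "underS l x \<subseteq> T i"
      using unbounded[OF x(1)] by blast
    have "|C| \<le>o |T i|"
      by (rule ordIso_ordLeq_trans[OF x(2) card_of_mono1[OF i(2)]])
    then have "|C| \<le>o |Pow (T i)|"
      by (rule card_le_Pow)
    moreover have "|D i| \<le>o |C|"
      by (rule card_of_mono1) (use i(1) in \<open>auto simp: C_def\<close>)
    ultimately have "|D i| \<le>o |Pow (T i)|"
      using ordLeq_transitive by blast
    moreover have "i \<in> Field k"
      using i(1) Z by blast
    ultimately show False
      using D_large not_card_less by blast
  qed
  then have "l \<le>o |C|"
    using not_ordLess_iff_ordLeq[OF wl card_of_Well_order] by blast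
  then have "|Field l| \<le>o |C|"
    by (rule ordIso_ordLeq_trans[OF card_of_Field_ordIso[OF l(1)]])
  then have "|C| =o |Field l|"
    using card_of_mono1[OF C_l] by (simp add: ordIso_iff_ordLeq)
  then obtain \<beta> where \<beta>: "bij_betw \<beta> C (Field l)"
    using card_of_ordIso by blast
  \<comment> \<open>The first component of \<open>e i\<close> splits \<open>D i\<close> into fibres
    of size at least |Field s|, indexed by \<open>D i\<close> itself; \<open>\<beta>\<close> turns
    the indices into the points of \<open>l\<close>.\<close>
  have "\<exists>e. e ` D i = D i \<times> Field s" if i: "i \<in> Field k" for i
  proof -
    have sT: "|Field s| \<le>o |D i|"
      by (rule ordLeq_transitive[OF card_le_Pow[OF s_T[OF i]] ordLess_imp_ordLeq[OF D_large[OF i]]])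
    have inf: "infinite (D i)"
      by (rule card_of_ordLeq_infinite[OF ordLess_imp_ordLeq[OF D_large[OF i]] infinite_Pow[OF T(1)[OF i]]])
    have "|D i \<times> Field s| \<le>o |D i|"
      by (intro card_of_Times_le inf sT ordIso_imp_ordLeq[OF card_of_refl])
    moreover have "Field s \<noteq> {}"
      using s(1) by (auto simp: cinfinite_def)
    then have "D i \<times> Field s \<noteq> {}"
      using inf by auto
    ultimately show ?thesis
      using card_of_ordLeq2[of "D i \<times> Field s" "D i"] by blast
  qed
  then obtain e where e: "\<And>i. i \<in> Field k \<Longrightarrow> e i ` D i = D i \<times> Field s"
    by metis
  define \<phi> where "\<phi> x = \<beta> (fst (e (idx x) x))" for x
  define c where "c x = cond z (idx x) x" for x
  have z0_cond: "p i x \<subseteq>\<^sub>m cond z i x" if "i \<in> Field k" "x \<in> B2 i" for i x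
    by (rule map_le_trans[OF p_cond_z0[OF that] cond_mono[OF z(2)]])
  \<comment> \<open>The real part of \<open>z\<close>. Outside the private coordinates of
    \<open>x\<close>, the instance of \<open>z\<close> at \<open>x\<close> coincides with
    it.\<close>
  define q' where "q' = (\<lambda>m. z (Inl m))"
  have q'_Fn: "q' \<in> Fn s N"
  proof -
    have "dom q' \<subseteq> projl ` dom z"
    proof
      fix m assume "m \<in> dom q'"
      then have "Inl m \<in> dom z"
        by (auto simp: q'_def)
      from imageI[OF this, of projl] show "m \<in> projl ` dom z"
        by simp
    qed
    moreover have "|projl ` dom z| <o s"
      using z(1) by (intro less_s_image) (simp add: Fn_def)
    moreover have "dom q' \<subseteq> N"
      using z(1) by (auto simp: q'_def Fn_def N2_def)
    ultimately show ?thesis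
      using less_s_mono by (simp add: Fn_def)
  qed
  have "Q \<subseteq>\<^sub>m q'"
  proof (rule map_leI)
    fix m v assume "Q m = Some v"
    then have "z0 (Inl m) = Some v"
      by (simp add: z0_def)
    then show "q' m = Some v"
      unfolding q'_def by (rule map_leD[OF z(2)])
  qed
  moreover have "\<phi> x \<in> Field l \<and> c x \<in> Fn s N" if "x \<in> C" for x
  proof -
    obtain i where i: "i \<in> Z" "x \<in> D i"
      using \<open>x \<in> C\<close> by (auto simp: C_def)
    then have ik: "i \<in> Field k"
      using Z by blast
    have "e i x \<in> D i \<times> Field s"
      using e[OF ik] i(2) by blast
    then have "fst (e i x) \<in> C"
      using i(1) by (auto simp: C_def)
    then show ?thesis
      using \<beta> cond_Fn[OF ik _ z(1)] D_B2 i by (auto simp: \<phi>_def c_def idx[OF i] bij_betw_def)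
  qed
  moreover have "\<exists>x\<in>C. \<phi> x = y \<and> (\<exists>r'\<in>Fn s N. r \<subseteq>\<^sub>m r' \<and> c x \<subseteq>\<^sub>m r')"
    if y: "y \<in> Field l" and r: "r \<in> Fn s N" "q' \<subseteq>\<^sub>m r" for y r
  proof -
    have "y \<in> \<beta> ` C"
      using \<beta> y by (simp add: bij_betw_def)
    then obtain y' where y': "y' \<in> C" "\<beta> y' = y"
      by blast
    then obtain i where i: "i \<in> Z" "y' \<in> D i"
      by (auto simp: C_def)
    then have ik: "i \<in> Field k"
      using Z by blast
    \<comment> \<open>Otherwise each point of the fibre owns a coordinate in \<open>dom r\<close>,
      and \<open>Field s\<close> would be embedded into \<open>dom r\<close>.\<close>
    have "\<exists>x\<in>D i. fst (e i x) = y' \<and> S2 i x \<inter> Inl ` dom r = {}"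
    proof (rule ccontr)
      assume no: "\<not> ?thesis"
      have "\<exists>x w. x \<in> D i \<and> e i x = (y', v) \<and> w \<in> S2 i x \<inter> Inl ` dom r" if v: "v \<in> Field s" for v
      proof -
        have "(y', v) \<in> e i ` D i"
          using e[OF ik] i(2) v by simp
        then obtain x where "x \<in> D i" "e i x = (y', v)"
          by force
        moreover from this have "S2 i x \<inter> Inl ` dom r \<noteq> {}"
          using no by auto
        ultimately show ?thesis
          by blast
      qed
      then obtain X W where XW: "\<And>v. v \<in> Field s \<Longrightarrow> X v \<in> D i \<and> e i (X v) = (y', v) \<and> W v \<in> S2 i (X v) \<inter> Inl ` dom r"
        by metis
      have "inj_on W (Field s)"
      proof (rule inj_onI)
        fix v v' assume v: "v \<in> Field s" "v' \<in> Field s" "W v = W v'"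
        then have "S2 i (X v) \<inter> S2 i (X v') \<noteq> {}"
          using XW[OF v(1)] XW[OF v(2)] by auto
        moreover have "X v \<in> B2 i" "X v' \<in> B2 i"
          using D_B2 XW[OF v(1)] XW[OF v(2)] by (simp_all add: subset_iff)
        ultimately have eq: "X v = X v'"
          using U2D(1)[OF ik] by metis
        have "e i (X v) = (y', v)" "e i (X v') = (y', v')"
          using XW[OF v(1)] XW[OF v(2)] by blast+
        then show "v = v'"
          unfolding eq by simp
      qed
      moreover have "W ` Field s \<subseteq> Inl ` dom r"
        using XW by blast
      ultimately have "|Field s| \<le>o |Inl ` dom r :: ('n + 'b \<times> 'd) set|"
        using card_of_ordLeq by blast
      then have "|Field s| \<le>o |dom r|"
        by (rule ordLeq_transitive[OF _ card_of_image])
      moreover have "|dom r| <o |Field s|"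
        by (rule ordLess_ordIso_trans[OF _ ordIso_symmetric[OF card_of_Field_ordIso[OF conjunct2[OF s(1)]]]])
          (use r(1) in \<open>simp add: Fn_def\<close>)
      ultimately show False
        using not_card_less by blast
    qed
    then obtain x where x: "x \<in> D i" "fst (e i x) = y'" "S2 i x \<inter> Inl ` dom r = {}"
      by blast
    have "agree r (cond z i x)"
      unfolding agree_def
    proof (intro allI impI)
      fix m v w assume m: "r m = Some v" "cond z i x m = Some w"
      have "Inl m \<notin> S2 i x"
        using x(3) m(1) by blast
      then have "q' m = Some w"
        using m(2) by (simp add: cond_def q'_def)
      then show "v = w"
        using map_leD[OF r(2)] m(1) by simp
    qed
    moreover have "cond z i x \<in> Fn s N"
      using cond_Fn[OF ik _ z(1)] D_B2 x(1) by blast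
    ultimately have "\<exists>r'\<in>Fn s N. r \<subseteq>\<^sub>m r' \<and> c x \<subseteq>\<^sub>m r'"
      using Fn_Un[OF s(1) r(1)] by (simp add: c_def idx[OF i(1) x(1)])
    moreover have "\<phi> x = y" "x \<in> C"
      using x(1,2) y'(2) i(1) by (auto simp: \<phi>_def idx[OF i(1) x(1)] C_def)
    ultimately show ?thesis
      by blast
  qed
  moreover have "\<not> (\<exists>r\<in>Fn s N. c x \<subseteq>\<^sub>m r \<and> c y \<subseteq>\<^sub>m r \<and> g x y r)"
    if xy: "x \<in> C" "y \<in> C" "x \<in> underS l y" for x y
  proof
    assume "\<exists>r\<in>Fn s N. c x \<subseteq>\<^sub>m r \<and> c y \<subseteq>\<^sub>m r \<and> g x y r"
    then obtain r where r: "r \<in> Fn s N" "c x \<subseteq>\<^sub>m r" "c y \<subseteq>\<^sub>m r" "g x y r"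
      by blast
    obtain j i where j: "j \<in> Z" "x \<in> D j" and i: "i \<in> Z" "y \<in> D i"
      using xy(1,2) by (auto simp: C_def)
    have ik: "i \<in> Field k" and jk: "j \<in> Field k"
      using i j Z by blast+
    have cr: "cond z j x \<subseteq>\<^sub>m r" "cond z i y \<subseteq>\<^sub>m r"
      using r(2,3) by (simp_all add: c_def idx[OF j] idx[OF i])
    consider "j = i" | "j \<in> underS k i" | "i \<in> underS k j"
      using wo_rel_underS_cases[OF k(1) jk ik] by blast
    then show False
    proof cases
      case 1
      have "p i x \<subseteq>\<^sub>m r" "p i y \<subseteq>\<^sub>m r"
        using map_le_trans[OF z0_cond cr(1)] map_le_trans[OF z0_cond cr(2)] D_B2 ik i(2) j(2) 1 by blast+
      then show False
        using red[OF ik _ _ xy(3)] D_B[OF ik] i(2) j(2) 1 r(1,4) by blast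
    next
      case 2
      have "\<not> g x y r"
        by (rule no_green_extension[OF 2 red_Z[OF i(1) j(1) 2] _ _ _ _ r(1) cr]) (use i(2) j(2) in \<open>auto simp: D_def\<close>)
      with r(4) show False
        by blast
    next
      case 3
      then have "y \<in> underS l x"
        using B_less[OF 3] D_B[OF ik] D_B[OF jk] i(2) j(2) by blast
      then show False
        using underS_asym[OF wl xy(3)] by blast
    qed
  qed
  ultimately show ?thesis
    using q'_Fn C_l
    by (intro bexI[of _ q'] conjI exI[of _ C] exI[of _ \<phi>] exI[of _ c] ballI impI) blast+
qed

text \<open>The tree argument with a single trivial condition, applied to \<kappa> itself; here
  \<open>small\<close> bounds the number of sequences.\<close>

lemma regular_partition:
  fixes k :: "'b rel" and th :: "'a rel"
  assumes th: "Well_order th" and k: "Cinfinite k" "regularCard k" and less: "|Field th| <o k"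
    and small: "\<forall>\<mu>::'b rel. Card_order \<mu> \<longrightarrow> \<mu> <o k \<longrightarrow> cless_exp \<mu> th <o k"
  shows "(\<exists>h. (\<forall>x\<in>succ_field th. h x \<in> Field k) \<and>
      (\<forall>x\<in>succ_field th. \<forall>y\<in>succ_field th. succ_less th x y \<longrightarrow> h x \<in> underS k (h y) \<and> G (h x) (h y))) \<or>
    (\<exists>Z. Z \<subseteq> Field k \<and> \<not> |Z| <o k \<and> (\<forall>x\<in>Z. \<forall>y\<in>Z. x \<in> underS k y \<longrightarrow> \<not> G x y))"
proof -
  have wk: "Well_order k"
    using k(1) by (simp add: card_order_on_def)
  have "(\<exists>h. \<exists>q\<in>{()}. (\<forall>x\<in>succ_field th. h x \<in> Field k \<and> True) \<and>
      (\<forall>x\<in>succ_field th. \<forall>y\<in>succ_field th. succ_less th x y \<longrightarrow> h x \<in> underS k (h y) \<and> G (h x) (h y))) \<or>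
    (\<exists>Z p. Z \<subseteq> Field k \<and> \<not> |Z| <o k \<and> (\<forall>x\<in>Z. p x \<in> {()} \<and> True) \<and>
      (\<forall>x\<in>Z. \<forall>y\<in>Z. x \<in> underS k y \<longrightarrow> \<not> (\<exists>q\<in>{()}. True \<and> True \<and> G x y)))"
  proof (rule ramsey_tree[OF th k less _ wk subset_refl, where le = "\<lambda>_ _. True" and g = "\<lambda>x y _. G x y"])
    fix Lab :: "('b \<times> unit) set" assume Lab: "|Lab| <o k"
    \<comment> \<open>The labels carry a trivial condition, which is projected away because
      \<open>small\<close> speaks of cardinals on the type of \<open>k\<close>.\<close>
    have "|fst ` Lab| <o k"
      by (rule ordLeq_ordLess_trans[OF card_of_image Lab])
    then have le: "cless_exp |fst ` Lab| th <o k"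
      using small by (simp add: card_of_Card_order)
    let ?S = "{f. (\<exists>b\<in>Field th. dom f = underS th b) \<and> ran f \<subseteq> Lab}"
    let ?S' = "{f. (\<exists>b\<in>Field th. dom f = underS th b) \<and> ran f \<subseteq> fst ` Lab}"
    have "inj_on (\<lambda>f. map_option fst \<circ> f) ?S"
    proof (rule inj_onI)
      fix f f' :: "'a \<rightharpoonup> 'b \<times> unit" assume eq: "map_option fst \<circ> f = map_option fst \<circ> f'"
      show "f = f'"
      proof
        fix a
        have "map_option fst (f a) = map_option fst (f' a)"
          using fun_cong[OF eq, of a] by simp
        then show "f a = f' a"
          by (cases "f a"; cases "f' a") (auto simp: prod_eq_iff)
      qed
    qed
    moreover have "(\<lambda>f. map_option fst \<circ> f) ` ?S \<subseteq> ?S'"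
      by (force simp: ran_def dom_def)
    ultimately have "|?S| \<le>o |?S'|"
      using card_of_ordLeq by blast
    also have "|?S'| = cless_exp |fst ` Lab| th"
      by (simp add: cless_exp_def Field_card_of)
    finally show "|?S| <o k"
      using le by (rule ordLeq_ordLess_trans)
  next
    show "\<not> |Field k| <o k"
      using not_ordLess_ordIso card_of_Field_ordIso k(1) by blast
  qed auto
  then show ?thesis
    by auto
qed

text \<open>The conclusion is the red alternative required by \<open>forced_Arrow\<close>, under the
  failure of the green one, \<open>green_chain\<close>.\<close>

theorem cohen_dichotomy:
  fixes th :: "'a rel" and k :: "'b rel" and s :: "'c rel" and l :: "'d rel" and N :: "'n set"
  assumes co: "Card_order th" "Card_order k" "Card_order s" "Card_order l"
    and th: "natLeq \<le>o th" "th <o k" and k: "k <o s" "is_cofinality k l"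
    and s: "s =o cless_exp s s" "s <o l" and l: "strong_limit l"
    and small: "\<forall>\<mu>::'b rel. Card_order \<mu> \<longrightarrow> \<mu> <o k \<longrightarrow> cless_exp \<mu> th <o k"
    and q: "q \<in> Fn s N"
    and g_mono: "\<forall>x y p. \<forall>q\<in>Fn s N. g x y p \<longrightarrow> p \<subseteq>\<^sub>m q \<longrightarrow> g x y q"
    and no_green: "\<not> green_chain s N th l g q"
  shows "\<exists>q'\<in>Fn s N. q \<subseteq>\<^sub>m q' \<and> (\<exists>C \<phi> c. C \<subseteq> Field l \<and> (\<forall>x\<in>C. \<phi> x \<in> Field l \<and> c x \<in> Fn s N) \<and>
    (\<forall>y\<in>Field l. \<forall>r\<in>Fn s N. q' \<subseteq>\<^sub>m r \<longrightarrow> (\<exists>x\<in>C. \<phi> x = y \<and> (\<exists>r'\<in>Fn s N. r \<subseteq>\<^sub>m r' \<and> c x \<subseteq>\<^sub>m r'))) \<and>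
    (\<forall>x\<in>C. \<forall>y\<in>C. x \<in> underS l y \<longrightarrow> \<not> (\<exists>r\<in>Fn s N. c x \<subseteq>\<^sub>m r \<and> c y \<subseteq>\<^sub>m r \<and> g x y r)))"
proof -
  have wo: "Well_order th" "Well_order k" "Well_order s" "Well_order l"
    using co by (simp_all add: card_order_on_def)
  have cth: "cinfinite th"
    by (rule cinfinite_mono[OF th(1) natLeq_cinfinite])
  have ck: "Cinfinite k"
    using cinfinite_mono[OF ordLess_imp_ordLeq[OF th(2)] cth] co(2) by simp
  have cs: "Cinfinite s"
    using cinfinite_mono[OF ordLess_imp_ordLeq[OF k(1)]] ck co(3) by simp
  have cl: "infinite (Field l)"
    using cinfinite_mono[OF ordLess_imp_ordLeq[OF s(2)]] cs by (simp add: cinfinite_def)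
  have rs: "regularCard s"
    using regularCard_of_cless_exp[OF co(3) _ s(1)] cs by (simp add: cinfinite_def)
  have rk: "regularCard k"
    by (rule regularCard_cofinality[OF wo(4) k(2)])
  have Field_less: "|Field r| <o r'" if "Card_order r" "r <o r'" for r :: "'x rel" and r' :: "'y rel"
    by (rule ordIso_ordLess_trans[OF card_of_Field_ordIso[OF that(1)] that(2)])
  have th_k: "|Field th| <o k"
    by (rule Field_less[OF co(1) th(2)])
  have th_s: "|Field th| <o s"
    by (rule ordLess_transitive[OF th_k k(1)])
  have k_s: "|Field k| <o s"
    by (rule Field_less[OF co(2) k(1)])
  \<comment> \<open>This power set contains all antichain indices, and every block is to start
    beyond its size.\<close>
  have "|Pow (Field s)| <o l"
    by (rule strong_limit_Pow[OF co(4) l Field_less[OF co(3) s(2)]])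
  from block_sequence[OF co(4) cl l k(2) _ this] ck obtain a b where
    ab: "\<And>i. i \<in> Field k \<Longrightarrow> a i \<in> Field l \<and> b i \<in> Field l \<and> |Pow (Field s)| <o |underS l (a i)| \<and>
      |Pow (underS l (a i))| <o |underS l (b i)| \<and> (\<forall>j\<in>underS k i. b j = a i \<or> b j \<in> underS l (a i))"
    and unb: "\<And>x. x \<in> Field l \<Longrightarrow> \<exists>j\<in>Field k. \<forall>i\<in>Field k. j \<in> underS k i \<longrightarrow> x \<in> underS l (a i)"
    unfolding cinfinite_def by metis
  define T where "T i = underS l (a i)" for i
  \<comment> \<open>Removing \<open>T i\<close> makes the blocks disjoint and consecutive; they stay
    large, because \<open>T i\<close> is not larger than its power set.\<close>
  define B where "B i = underS l (b i) - T i" for i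
  have sub: "j \<in> Field k" "i \<in> Field k" if "j \<in> underS k i" for i j
    using that by (auto simp: underS_def Field_def)
  have T_inf: "infinite (T i)" if "i \<in> Field k" for i
  proof -
    have "infinite (Pow (Field s))"
      using cs by (simp add: cinfinite_def)
    then show ?thesis
      using card_of_ordLeq_infinite[OF ordLess_imp_ordLeq] ab[OF that] unfolding T_def by blast
  qed
  have T_s: "|Pow (Field s)| \<le>o |T i|" if "i \<in> Field k" for i
    unfolding T_def by (rule ordLess_imp_ordLeq) (use ab[OF that] in blast)
  have T_s': "|Field s| \<le>o |T i|" if "i \<in> Field k" for i
    by (rule ordLeq_transitive[OF ordLess_imp_ordLeq[OF card_of_Pow] T_s[OF that]])
  have B_large: "|Pow (T i)| <o |B i|" if i: "i \<in> Field k" for i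
  proof (rule ccontr)
    assume "\<not> ?thesis"
    then have "|B i| \<le>o |Pow (T i)|"
      using not_card_less by blast
    then have "|T i \<union> B i| \<le>o |Pow (T i)|"
      by (intro card_of_Un_le infinite_Pow T_inf[OF i] card_le_Pow[OF ordIso_imp_ordLeq[OF card_of_refl]])
    moreover have "|underS l (b i)| \<le>o |T i \<union> B i|"
      by (rule card_of_mono1) (auto simp: B_def)
    ultimately have "|underS l (b i)| \<le>o |Pow (T i)|"
      by (rule ordLeq_transitive[rotated])
    then show False
      using ab[OF i] not_card_less unfolding T_def by blast
  qed
  have bT: "underS l (b j) \<subseteq> T i" if "j \<in> underS k i" for i j
    unfolding T_def by (rule card_underS_mono[OF wo(4)]) (use ab[OF sub(2)[OF that]] that in blast)
  have B_T: "B j \<subseteq> T i" if "j \<in> underS k i" for i j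
    using bT[OF that] by (auto simp: B_def)
  have T_mono: "T j \<subseteq> T i" if ji: "j \<in> underS k i" for i j
  proof -
    have j: "j \<in> Field k"
      by (rule sub(1)[OF ji])
    \<comment> \<open>The block is not empty, so \<open>a j\<close> lies below \<open>b j\<close>;
      hence the \<open>T i\<close> increase.\<close>
    have "\<not> underS l (b j) \<subseteq> T j"
      using B_large[OF j] not_card_less card_of_empty unfolding B_def by (metis Diff_eq_empty_iff)
    then have "T j \<subseteq> underS l (b j)"
      using wo_rel_underS_cases[OF wo(4), of "a j" "b j"] ab[OF j] card_underS_mono[OF wo(4)] unfolding T_def by metis
    then show ?thesis
      using bT[OF ji] by blast
  qed
  have B_l: "B i \<subseteq> Field l" for i
    by (auto simp: B_def underS_def Field_def)
  have B_less: "x \<in> underS l y" if ji: "j \<in> underS k i" and x: "x \<in> B j" and y: "y \<in> B i" for i j x y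
  proof -
    have "x \<in> underS l (a i)"
      using B_T[OF ji] x by (auto simp: T_def)
    moreover have "y = a i \<or> a i \<in> underS l y"
      using wo_rel_underS_cases[OF wo(4), of y "a i"] B_l y ab[OF sub(2)[OF ji]] by (auto simp: B_def T_def)
    ultimately show ?thesis
      using underS_trans[OF wo(4)] by blast
  qed
  have B_disj: "B i \<inter> B j = {}" if ij: "i \<in> Field k" "j \<in> Field k" "i \<noteq> j" for i j
  proof -
    have "x \<notin> underS l x" for x
      by (simp add: underS_def)
    then show ?thesis
      using wo_rel_underS_cases[OF wo(2) ij(1,2)] ij(3) B_less by blast
  qed
  have TB: "\<forall>i\<in>Field k. infinite (T i) \<and> |Field s| \<le>o |T i| \<and> B i \<subseteq> Field l \<and> |Pow (T i)| <o |B i|"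
    using T_inf T_s' B_l B_large by blast
  obtain C p Q where q_Q: "Q \<in> Fn s N" "q \<subseteq>\<^sub>m Q" and C0: "\<forall>i\<in>Field k. C i \<subseteq> B i \<and> |Pow (T i)| <o |C i| \<and>
    (\<forall>x\<in>C i. p i x \<in> Fn s N \<and> q \<subseteq>\<^sub>m p i x) \<and>
    (\<forall>x\<in>C i. \<forall>y\<in>C i. x \<noteq> y \<longrightarrow> (\<forall>m v. p i x m = Some v \<longrightarrow> p i y m = Some v \<longrightarrow> Q m = Some v)) \<and>
    (\<forall>x\<in>C i. \<forall>y\<in>C i. x \<in> underS l y \<longrightarrow> \<not> (\<exists>r\<in>Fn s N. p i x \<subseteq>\<^sub>m r \<and> p i y \<subseteq>\<^sub>m r \<and> g x y r))"
    using homogeneous_blocks[OF cs rs wo(4,1) th_s wo(2) k_s TB q g_mono no_green]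
    by (elim exE bexE conjE) (rule that)
  note C = bspec[OF C0]
  have CB: "C i \<subseteq> B i" if "i \<in> Field k" for i
    using C[OF that] by blast
  interpret block_system k s N T C g p Q
  proof unfold_locales
    show "C j \<subseteq> T i" if "j \<in> underS k i" for i j
      using CB[OF sub(1)[OF that]] B_T[OF that] by blast
    show "Q m = Some v" if "i \<in> Field k" "x \<in> C i" "y \<in> C i" "x \<noteq> y" "p i x m = Some v" "p i y m = Some v" for i x y m v
      using C[OF that(1)] that(2-) by blast
    show "p i x \<in> Fn s N" if "i \<in> Field k" "x \<in> C i" for i x
      using C[OF that(1)] that(2) by blast
    show "|Pow (T i)| <o |C i|" if "i \<in> Field k" for i
      using C[OF that(1)] by blast
    show "infinite (Field k)"
      using ck by (simp add: cinfinite_def)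
    show "g x y r'" if "g x y r" "r' \<in> Fn s N" "r \<subseteq>\<^sub>m r'" for x y r r'
      using g_mono that by blast
  qed (fact cs rs wo(2) k_s T_inf T_s T_mono q_Q(1))+
  obtain a' V B1 S1 \<psi>1 T1 b1 d1 h1 where "block_system1 k s N T C g p Q a' V B1 S1 \<psi>1 T1 b1 d1 h1"
    using ex_block_system1 by (elim exE) (rule that)
  then interpret block_system1 k s N T C g p Q a' V B1 S1 \<psi>1 T1 b1 d1 h1 .
  obtain B2 S2 \<psi>2 T2 b2 d2 h2 where "block_system2 k s N T C g p Q a' V B1 S1 \<psi>1 T1 b1 d1 h1 B2 S2 \<psi>2 T2 b2 d2 h2"
    using ex_block_system2 by (elim exE) (rule that)
  then interpret block_system2 k s N T C g p Q a' V B1 S1 \<psi>1 T1 b1 d1 h1 B2 S2 \<psi>2 T2 b2 d2 h2 .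
  obtain z where z: "z \<in> Fn s N2" "z0 \<subseteq>\<^sub>m z" and dec: "\<forall>i j. j \<in> underS k i \<longrightarrow>
    (\<exists>u. u \<subseteq> Field s \<and> Green i u \<in> h2 j \<and> \<Theta> j i u \<subseteq>\<^sub>m z) \<or>
    (\<forall>u. u \<subseteq> Field s \<longrightarrow> Green i u \<in> h2 j \<longrightarrow> \<not> agree z (\<Theta> j i u))"
    using ex_decisive_state by (elim bexE conjE) (rule that)
  define G where "G j i \<longleftrightarrow> (\<exists>u. u \<subseteq> Field s \<and> Green i u \<in> h2 j \<and> \<Theta> j i u \<subseteq>\<^sub>m z)" for j i
  consider h where "\<forall>x\<in>succ_field th. h x \<in> Field k"
      "\<forall>x\<in>succ_field th. \<forall>y\<in>succ_field th. succ_less th x y \<longrightarrow> h x \<in> underS k (h y) \<and> G (h x) (h y)"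
    | Z where "Z \<subseteq> Field k" "\<not> |Z| <o k" "\<forall>x\<in>Z. \<forall>y\<in>Z. x \<in> underS k y \<longrightarrow> \<not> G x y"
    using regular_partition[OF wo(1) ck rk th_k small, of G] by (elim disjE exE conjE) (rule that; assumption)+
  then show ?thesis
  proof cases
    case (1 h)
    let ?H = "h ` succ_field th"
    have tot: "x = y \<or> succ_less th x y \<or> succ_less th y x" if "x \<in> succ_field th" "y \<in> succ_field th" for x y
      using that by (auto simp: succ_field_def succ_less_def dest: wo_rel_underS_cases[OF wo(1)])
    have irr: "x \<notin> underS k x" for x
      by (simp add: underS_def)
    have "\<exists>u. u \<subseteq> Field s \<and> Green i u \<in> h2 j \<and> \<Theta> j i u \<subseteq>\<^sub>m z"
      if ij: "i \<in> ?H" "j \<in> ?H" "j \<in> underS k i" for i j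
    proof -
      obtain x y where xy: "x \<in> succ_field th" "y \<in> succ_field th" "j = h x" "i = h y"
        using ij(1,2) by blast
      have "\<not> succ_less th y x"
        using 1(2) xy ij(3) underS_asym[OF wo(2)] by blast
      then have "succ_less th x y"
        using tot[OF xy(1,2)] ij(3) irr xy by auto
      then show ?thesis
        using 1(2) xy unfolding G_def by blast
    qed
    moreover have "?H \<subseteq> Field k"
      using 1(1) by blast
    ultimately obtain \<delta> q1 where q1: "q1 \<in> Fn s N" "\<forall>i\<in>?H. \<delta> i \<in> B2 i \<and> cond z i (\<delta> i) \<subseteq>\<^sub>m q1"
      "\<forall>i\<in>?H. \<forall>j\<in>?H. j \<in> underS k i \<longrightarrow> g (\<delta> j) (\<delta> i) q1"
      using green_amalgamation[OF z(1), of ?H] by blast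
    have \<delta>C: "\<delta> (h x) \<in> C (h x)" if "x \<in> succ_field th" for x
      using q1(2) that 1(1) B1 B2 by blast
    have "q \<subseteq>\<^sub>m q1"
    proof -
      \<comment> \<open>\<open>None\<close> is an index that is always at hand; the initial
        condition of its point extends \<open>q\<close> and is contained in
        \<open>q1\<close>.\<close>
      have None: "None \<in> succ_field th"
        by (simp add: succ_field_def)
      let ?i = "h None"
      have i: "?i \<in> Field k" and x: "\<delta> ?i \<in> B2 ?i" "cond z ?i (\<delta> ?i) \<subseteq>\<^sub>m q1"
        using None 1(1) q1(2) by blast+
      have "q \<subseteq>\<^sub>m p ?i (\<delta> ?i)"
        using C[OF i] \<delta>C[OF None] by blast
      also have "\<dots> \<subseteq>\<^sub>m cond z0 ?i (\<delta> ?i)"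
        by (rule p_cond_z0[OF i x(1)])
      also (map_le_trans) have "\<dots> \<subseteq>\<^sub>m cond z ?i (\<delta> ?i)"
        by (rule cond_mono[OF z(2)])
      also (map_le_trans) note x(2)
      finally (map_le_trans) show ?thesis .
    qed
    moreover have "\<delta> (h x) \<in> Field l" if "x \<in> succ_field th" for x
      using \<delta>C[OF that] CB 1(1) B_l that by blast
    moreover have "\<delta> (h x) \<in> underS l (\<delta> (h y)) \<and> g (\<delta> (h x)) (\<delta> (h y)) q1"
      if xy: "x \<in> succ_field th" "y \<in> succ_field th" "succ_less th x y" for x y
    proof -
      have hxy: "h x \<in> underS k (h y)"
        using 1(2) xy by blast
      then show ?thesis
        using B_less[OF hxy] \<delta>C[OF xy(1)] \<delta>C[OF xy(2)] CB 1(1) q1(3) xy(1,2) by blast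
    qed
    ultimately have "green_chain s N th l g q"
      unfolding green_chain_def using q1(1) by (intro exI[of _ "\<lambda>x. \<delta> (h x)"] bexI[of _ q1]) blast+
    with no_green show ?thesis
      by blast
  next
    case (2 Z)
    have "\<exists>q'\<in>Fn s N. Q \<subseteq>\<^sub>m q' \<and> (\<exists>C \<phi> c. C \<subseteq> Field l \<and> (\<forall>x\<in>C. \<phi> x \<in> Field l \<and> c x \<in> Fn s N) \<and>
      (\<forall>y\<in>Field l. \<forall>r\<in>Fn s N. q' \<subseteq>\<^sub>m r \<longrightarrow> (\<exists>x\<in>C. \<phi> x = y \<and> (\<exists>r'\<in>Fn s N. r \<subseteq>\<^sub>m r' \<and> c x \<subseteq>\<^sub>m r'))) \<and>
      (\<forall>x\<in>C. \<forall>y\<in>C. x \<in> underS l y \<longrightarrow> \<not> (\<exists>r\<in>Fn s N. c x \<subseteq>\<^sub>m r \<and> c y \<subseteq>\<^sub>m r \<and> g x y r)))"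
    proof (rule red_set[OF co(4) cl _ _ _ _ z 2(1)])
      show "C i \<subseteq> Field l" if "i \<in> Field k" for i
        using CB[OF that] B_l by blast
      show "C i \<inter> C j = {}" if "i \<in> Field k" "j \<in> Field k" "i \<noteq> j" for i j
        using CB[OF that(1)] CB[OF that(2)] B_disj[OF that] by blast
      show "x \<in> underS l y" if "j \<in> underS k i" "x \<in> C j" "y \<in> C i" for i j x y
        using B_less[OF that(1)] CB[OF sub(1)[OF that(1)]] CB[OF sub(2)[OF that(1)]] that(2,3) by blast
      show "\<not> (\<exists>r\<in>Fn s N. p i x \<subseteq>\<^sub>m r \<and> p i y \<subseteq>\<^sub>m r \<and> g x y r)"
        if "i \<in> Field k" "x \<in> C i" "y \<in> C i" "x \<in> underS l y" for i x y
        using C[OF that(1)] that(2-) by blast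
      show "\<not> agree z (\<Theta> j i u)" if "i \<in> Z" "j \<in> Z" "j \<in> underS k i" "u \<subseteq> Field s" "Green i u \<in> h2 j" for i j u
        using dec that 2(3) unfolding G_def by blast
      show "\<exists>i\<in>Z. underS l x \<subseteq> T i" if x: "x \<in> Field l" for x
      proof -
        obtain j where j: "j \<in> Field k" "\<forall>i\<in>Field k. j \<in> underS k i \<longrightarrow> x \<in> underS l (a i)"
          using unb[OF x] by blast
        \<comment> \<open>\<open>Z\<close> has \<kappa> elements and so contains some
          \<open>i\<close> above \<open>j\<close>.\<close>
        have "|underS k j \<union> {j}| <o k"
          by (rule Un_Cinfinite_bound_strict[OF card_of_underS[OF co(2) j(1)] finite_less[OF ck] ck]) simp
        then have "\<not> Z \<subseteq> underS k j \<union> {j}"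
          using 2(2) ordLeq_ordLess_trans[OF card_of_mono1] by blast
        then obtain i where i: "i \<in> Z" "i \<notin> underS k j" "i \<noteq> j"
          by blast
        then have "j \<in> underS k i"
          using wo_rel_underS_cases[OF wo(2) j(1), of i] 2(1) by blast
        then have "x \<in> underS l (a i)"
          using j(2) i(1) 2(1) by blast
        then show ?thesis
          using i(1) underS_subset[OF wo(4)] unfolding T_def by blast
      qed
    qed
    then show ?thesis
      using map_le_trans[OF q_Q(2)] by blast
  qed
qed

theorem theorem4:
  fixes \<theta> :: "'a rel" and \<kappa> :: "'b rel" and \<sigma> :: "'c rel" and l :: "'d rel" and \<nu> :: "'e rel"
  assumes "Card_order \<theta>" and "Card_order \<kappa>" and "Card_order \<sigma>" and "Card_order l" and "Card_order \<nu>"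
    and "natLeq \<le>o \<theta>" and "\<theta> <o \<kappa>" and "\<kappa> <o \<sigma>" and "\<sigma> =o cless_exp \<sigma> \<sigma>" and "\<sigma> <o l"
    and "is_cofinality \<kappa> l" and "\<kappa> <o l" and "l \<le>o \<nu>"
    and "strong_limit l"
    and "\<forall>\<mu>::'b rel. Card_order \<mu> \<longrightarrow> \<mu> <o \<kappa> \<longrightarrow> cless_exp \<mu> \<theta> <o \<kappa>"
    and large_universe: "|Cohen \<nu> \<sigma>| \<le>o |UNIV :: 'i set|"
  shows "forced (Cohen \<nu> \<sigma>) Cohen_le
    (Arrow (ord_name Map.empty l :: ('i, 'e \<times> 'c \<rightharpoonup> bool) pname)
           (succ_name Map.empty (ord_name Map.empty \<theta>)))"
proof -
  have cs: "Cinfinite \<sigma>"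
    using cinfinite_mono[OF ordLeq_transitive[OF assms(6) ordLess_imp_ordLeq[OF ordLess_transitive[OF assms(7,8)]]]
        natLeq_cinfinite] assms(3) by simp
  define N where "N = Field \<nu> \<times> Field \<sigma>"
  have P: "Cohen \<nu> \<sigma> = Fn \<sigma> N"
    by (auto simp: Cohen_def Fn_def N_def)
  have "Field \<sigma> \<noteq> {}"
    using cs by (auto simp: cinfinite_def)
  then obtain c0 where c0: "c0 \<in> Field \<sigma>"
    by blast
  \<comment> \<open>Conditions with one coordinate embed \<nu> into the forcing, so the bound on the
    set of conditions is also one on \<nu>, \<lambda> and \<theta>, as their check names
    require.\<close>
  have "(\<lambda>e. [(e, c0) \<mapsto> True]) ` Field \<nu> \<subseteq> Fn \<sigma> N"
  proof
    fix f assume "f \<in> (\<lambda>e. [(e, c0) \<mapsto> True]) ` Field \<nu>"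
    then obtain e where e: "e \<in> Field \<nu>" "f = [(e, c0) \<mapsto> True]"
      by blast
    have "dom f = {(e, c0)}"
      unfolding e(2) by simp
    moreover have "|{(e, c0)}| <o \<sigma>"
      by (rule finite_less[OF cs]) simp
    ultimately show "f \<in> Fn \<sigma> N"
      using e(1) c0 by (simp add: Fn_def N_def)
  qed
  moreover have "inj_on (\<lambda>e. [(e, c0) \<mapsto> True]) (Field \<nu>)"
  proof (rule inj_onI)
    fix e e' assume "[(e, c0) \<mapsto> True] = [(e', c0) \<mapsto> True]"
    from fun_cong[OF this, of "(e, c0)"] show "e = e'"
      by (simp split: if_splits)
  qed
  ultimately have "|Field \<nu>| \<le>o |Fn \<sigma> N|"
    using card_of_ordLeq by blast
  then have \<nu>_i: "|Field \<nu>| \<le>o |UNIV :: 'i set|"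
    using large_universe unfolding P by (rule ordLeq_transitive)
  have l_i: "|Field l| \<le>o |UNIV :: 'i set|"
    by (rule ordLeq_transitive[OF card_of_mono2[OF assms(13)] \<nu>_i])
  have \<theta>_i: "|Field \<theta>| \<le>o |UNIV :: 'i set|"
    by (rule ordLeq_transitive[OF card_of_mono2[OF ordLess_imp_ordLeq[OF ordLess_transitive[OF assms(7,12)]]] l_i])
  have "infinite (Field \<sigma>)"
    using cs by (simp add: cinfinite_def)
  then have "infinite (Field l)"
    by (rule card_of_ordLeq_infinite[OF card_of_mono2[OF ordLess_imp_ordLeq[OF assms(10)]]])
  then have inf: "infinite (UNIV :: 'i set)"
    by (rule card_of_ordLeq_infinite[OF l_i])
  interpret forcing_names "Cohen \<nu> \<sigma>" Cohen_le Map.empty "TYPE('i)"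
  proof unfold_locales
    show "Cohen_le r p" if "Cohen_le r q" "Cohen_le q p" for p q r :: "'e \<times> 'c \<rightharpoonup> bool"
      using that map_le_trans unfolding Cohen_le_def by blast
  qed (simp_all add: Cohen_le_def P Fn_empty[OF cs] inf large_universe[unfolded P])
  have wo: "Well_order l" "Well_order \<theta>"
    using assms(1,4) by (simp_all add: card_order_on_def)
  have "fc p (Arrow (ord_name Map.empty l :: ('i, 'e \<times> 'c \<rightharpoonup> bool) pname)
           (succ_name Map.empty (ord_name Map.empty \<theta>)))" if p: "p \<in> Cohen \<nu> \<sigma>" for p
  proof (rule forced_Arrow[OF wo(1) l_i wo(2) \<theta>_i _ p], goal_cases)
    case (1 g q)
    have g_mono: "\<forall>x y r. \<forall>r'\<in>Fn \<sigma> N. g x y r \<longrightarrow> r \<subseteq>\<^sub>m r' \<longrightarrow> g x y r'"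
      using 1(2) unfolding P Cohen_le_def by blast
    have q: "q \<in> Fn \<sigma> N"
      using 1(1) by (simp add: P)
    show ?case
    proof (cases "green_chain \<sigma> N \<theta> l g q")
      case True
      then show ?thesis
        unfolding P Cohen_le_def green_chain_def by blast
    next
      case False
      from cohen_dichotomy[OF assms(1-4,6-8,11,9,10,14,15) q g_mono this] show ?thesis
        unfolding P Cohen_le_def by (rule disjI2)
    qed
  qed
  then show ?thesis
    by (simp add: forced_def)
qed

end
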